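(* Consider two points in $\operatorname{SL}(2)$ that lie on the same vertical fiber with vertical displacement $2a>0$; there exist cylindrical coordinates in which they are $(0,0,0)$ and $(0,0,2a)$. Let $\mathcal{L}(B_t)$ and $\mathcal{L}(\tilde B_t)$ be the laws at time $t$ of $\operatorname{SL}(2)$-Brownian motions started from these two points. Then there exist constants $C>0$, $c>0$ and $T_0>0$, not depending on $a$, such that \[ \mathrm{dist}_{\mathrm{TV}}\big(\mathcal{L}(B_t),\mathcal{L}(\tilde B_t)\big)\le Ce^{-ct}\quad\text{for all } t>T_0 . \]
   Context: $\operatorname{SL}(2)=\operatorname{SL}(2,\mathbb{R})$ carries the left-invariant sub-Riemannian structure with horizontal orthonormal frame given by the left-invariant fields of $X=\frac12\begin{pmatrix}1&0\\0&-1\end{pmatrix}$, $Y=\frac12\begin{pmatrix}0&1\\1&0\end{pmatrix}$. In cylindrical coordinates $(r,\theta,z)\in\mathbb{R}^+\times[0,2\pi]\times(-2\pi,2\pi]$ ($z$ modulo $4\pi$), $(r,\theta,z)\mapsto\exp(r\cos\theta X+r\sin\theta Y)\exp(zZ)$ with $Z=\frac12\begin{pmatrix}0&1\\-1&0\end{pmatrix}$, the sub-Laplacian is $\Delta_{\mathcal{H}}=\partial_r^2+\coth r\,\partial_r+\frac{1}{\sinh^2r}\partial_\theta^2+\frac{1}{\cosh^2(r/2)}\partial_\theta\partial_z+\tanh^2(r/2)\partial_z^2$, and Brownian motion is the diffusion generated by $\frac12\Delta_{\mathcal{H}}$. Vertical fibers are the circles $\{(r,\theta,z): z\in(-2\pi,2\pi]\}$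 for fixed $(r,\theta)$; vertical displacement is measured in the $z$ coordinate. $\mathrm{dist}_{\mathrm{TV}}(\mu,\nu)=\sup_A|\mu(A)-\nu(A)|$. *)

theory Defs
  imports "HOL-Analysis.Analysis" "HOL-Probability.Probability"
begin

type_synonym mat2 = "real^2^2"

definition SL2 :: "mat2 set" where
  "SL2 = {g. det g = 1}"

text \<open>One-parameter subgroups exp(sX), exp(sY), exp(sZ) for
  X = 1/2 diag(1,-1), Y = 1/2 [[0,1],[1,0]], Z = 1/2 [[0,1],[-1,0]],
  written out explicitly.\<close>
definition expX :: "real \<Rightarrow> mat2" where
  "expX s = vector [vector [exp (s/2), 0], vector [0, exp (-(s/2))]]"

definition expY :: "real \<Rightarrow> mat2" where
  "expY s = vector [vector [cosh (s/2), sinh (s/2)], vector [sinh (s/2), cosh (s/2)]]"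

definition expZ :: "real \<Rightarrow> mat2" where
  "expZ s = vector [vector [cos (s/2), sin (s/2)], vector [- sin (s/2), cos (s/2)]]"

text \<open>Sub-Laplacian: sum of squares of the left-invariant fields of X and Y,
  (X~^2 f)(g) = d^2/ds^2 f(g exp(sX)) at s = 0.\<close>
definition subLap :: "(mat2 \<Rightarrow> real) \<Rightarrow> mat2 \<Rightarrow> real" where
  "subLap f g = (deriv ^^ 2) (\<lambda>s. f (g ** expX s)) 0 + (deriv ^^ 2) (\<lambda>s. f (g ** expY s)) 0"

text \<open>Test functions: C^2 functions on the ambient matrix space with compact support
  (their restrictions to SL2 exhaust the C^2_c functions on SL2).\<close>
definition C2_fun :: "(mat2 \<Rightarrow> real) \<Rightarrow> bool" where
  "C2_fun f \<longleftrightarrow> (\<exists>(f' :: mat2 \<Rightarrow> (mat2 \<Rightarrow>\<^sub>L real)) (f'' :: mat2 \<Rightarrow> (mat2 \<Rightarrow>\<^sub>L (mat2 \<Rightarrow>\<^sub>L real))).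
      (\<forall>x. (f has_derivative blinfun_apply (f' x)) (at x)) \<and>
      (\<forall>x. (f' has_derivative blinfun_apply (f'' x)) (at x)) \<and>
      continuous_on UNIV f'')"

definition test_fun :: "(mat2 \<Rightarrow> real) \<Rightarrow> bool" where
  "test_fun f \<longleftrightarrow> C2_fun f \<and> compact (closure {x. f x \<noteq> 0})"

text \<open>mu t (t >= 0) is the law at time t of the Brownian motion on SL(2) started at x,
  i.e. of the diffusion generated by (1/2) subLap: a family of Borel probability
  measures concentrated on SL2, with mu 0 = delta_x, solving the forward Kolmogorov
  equation d/dt int f d(mu t) = int (1/2) subLap f d(mu t) for all test functions.\<close>
definition SL2_BM_law :: "mat2 \<Rightarrow> (real \<Rightarrow> mat2 measure) \<Rightarrow> bool" where
  "SL2_BM_law x \<mu> \<longleftrightarrow>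
     (\<forall>t\<ge>0. prob_space (\<mu> t) \<and> sets (\<mu> t) = sets borel \<and> measure (\<mu> t) SL2 = 1) \<and>
     \<mu> 0 = return borel x \<and>
     (\<forall>f. test_fun f \<longrightarrow> (\<forall>t\<ge>0.
        ((\<lambda>s. integral\<^sup>L (\<mu> s) f) has_real_derivative
           integral\<^sup>L (\<mu> t) (\<lambda>y. subLap f y / 2)) (at t within {0..})))"

definition dist_TV :: "'a measure \<Rightarrow> 'a measure \<Rightarrow> real" where
  "dist_TV \<mu> \<nu> = (SUP A\<in>sets \<mu>. \<bar>measure \<mu> A - measure \<nu> A\<bar>)"

end

theory Submission
  imports Defs "HOL-Complex_Analysis.Complex_Analysis"
begin

text \<open>In Iwasawa coordinates \<open>g = n(x) a(e\<^sup>v) k(\<phi>)\<close> the Brownian motion is explicit: \<open>v\<close> is a Brownian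
  motion with drift \<open>- 1/2\<close>, driven independently of a second Brownian motion \<open>\<beta>\<close>, with
  \<open>dx = e\<^sup>v d\<beta>\<close> and \<open>d\<phi> = d\<beta> / 2\<close>. Given the path of \<open>v\<close>, the pair \<open>(x, \<phi>)\<close> is Gaussian, and the
  conditional variance of \<open>2\<phi>\<close> given \<open>x\<close> is the minimum over \<open>l\<close> of \<open>\<integral> (1 - l e\<^sup>v)\<^sup>2 ds\<close>. This is
  superadditive in time; its values on successive unit intervals, being invariant under scaling of
  \<open>e\<^sup>v\<close>, are independent and nondegenerate, so the
  Fourier modes \<open>e\<^sup>i\<^sup>m\<^sup>\<phi>\<close> with \<open>m \<noteq> 0\<close> decay exponentially, summably in \<open>m\<close>, while the mode
  \<open>m = 0\<close> does not see the displacement along the fibre.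

  No stochastic calculus is needed. Tested against a wave \<open>e\<^sup>i\<^sup>p\<^sup>x e\<^sup>i\<^sup>m\<^sup>\<phi> F(v)\<close>, the forward equation is
  compared step by step with a walk in which \<open>v\<close> moves by \<open>\<plusminus>\<surd>\<epsilon> - \<epsilon>/2\<close> and \<open>\<beta>\<close> has Gaussian
  increments. Keeping \<open>F\<close> analytic and bounded in a strip around the real axis makes the error uniform by
  Cauchy estimates. Trigonometric polynomials on large tori then approximate indicators of compact sets.\<close>

text \<open>A family satisfying \<open>SL2_BM_law\<close> comes without paths, Markov property or
  uniqueness, so no coupling is available. The comparison is by duality: the walk acts on the
  amplitude while the law is followed back to its Dirac mass, and only means of test functions
  occur. This needs a class of amplitudes that survives arbitrarily many steps; real shifts leave a
  complex strip invariant. The second obstacle is that approximating polynomials may have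
  coefficients far larger than their supremum norm, so no estimate can be made wave by wave. For a
  fixed path the multiplier is Gaussian in \<open>p\<close>, hence an average of translations, and
  the projection to one angular mode is an average of rotations; neither increases the supremum
  norm. Summing over the modes needs a factor \<open>1 / m\<^sup>2\<close>. One block yields only
  the power -1/2 of \<open>m\<close>, so four blocks are spent on it and the others give the
  exponential rate. The atoms of the walk have mass up to \<open>1 / sqrt M\<close>, which limits
  this to \<open>m \<le> M\<close>; the number of steps is therefore chosen after the
  polynomial.\<close>

no_notation fps_nth (infixl "$" 75)

section \<open>Functions of class \<open>C\<^sup>k\<close> on a Euclidean space\<close>

text \<open>Order 1 and above is phrased through partial derivatives in the standard basis, so that iterated derivatives stay scalar valued.\<close>

fun Ck :: "nat \<Rightarrow> 'a::euclidean_space set \<Rightarrow> ('a \<Rightarrow> 'b::real_normed_field) \<Rightarrow> bool" where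
  "Ck 0 U f \<longleftrightarrow> continuous_on U f"
| "Ck (Suc k) U f \<longleftrightarrow> (\<exists>D. (\<forall>x\<in>U. (f has_derivative (\<lambda>h. \<Sum>b\<in>Basis. (h \<bullet> b) *\<^sub>R D b x)) (at x)) \<and>
     (\<forall>b\<in>Basis. Ck k U (D b)))"

lemma Ck_SucI:
  assumes "\<And>x. x \<in> U \<Longrightarrow> (f has_derivative (\<lambda>h. \<Sum>b\<in>Basis. (h \<bullet> b) *\<^sub>R D b x)) (at x)"
    and "\<And>b. b \<in> Basis \<Longrightarrow> Ck k U (D b)"
  shows "Ck (Suc k) U f"
  using assms by (auto simp: Ck.simps)

lemma Ck_SucE:
  assumes "Ck (Suc k) U f"
  obtains D where "\<And>x. x \<in> U \<Longrightarrow> (f has_derivative (\<lambda>h. \<Sum>b\<in>Basis. (h \<bullet> b) *\<^sub>R D b x)) (at x)"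
    and "\<And>b. b \<in> Basis \<Longrightarrow> Ck k U (D b)"
  using assms by (auto simp: Ck.simps)

declare Ck.simps(2) [simp del]

lemma Ck_subset: "Ck k U f \<Longrightarrow> V \<subseteq> U \<Longrightarrow> Ck k V f"
proof (induction k arbitrary: f)
  case (Suc k)
  obtain D where "\<And>x. x \<in> U \<Longrightarrow> (f has_derivative (\<lambda>h. \<Sum>b\<in>Basis. (h \<bullet> b) *\<^sub>R D b x)) (at x)"
    and "\<And>b. b \<in> Basis \<Longrightarrow> Ck k U (D b)" using Suc(2) by (rule Ck_SucE) blast
  note D = this
  show ?case
  proof (rule Ck_SucI[where D=D])
    show "Ck k V (D b)" if "b \<in> Basis" for b
      using that by (intro Suc(1)[OF D(2) Suc(3)])
  qed (use Suc(3) D(1) in blast)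
qed (auto intro: continuous_on_subset)

lemma Ck_imp_continuous: "Ck k U f \<Longrightarrow> continuous_on U f"
proof (cases k)
  case (Suc j)
  assume "Ck k U f"
  then have "f differentiable (at x)" if "x \<in> U" for x
    using that unfolding Suc Ck.simps differentiable_def by blast
  then show ?thesis by (intro continuous_at_imp_continuous_on ballI differentiable_imp_continuous_within)
qed simp

lemma Ck_down: "Ck (Suc k) U f \<Longrightarrow> Ck k U f"
proof (induction k arbitrary: f)
  case 0
  then show ?case using Ck_imp_continuous by auto
next
  case (Suc k)
  obtain D where "\<And>x. x \<in> U \<Longrightarrow> (f has_derivative (\<lambda>h. \<Sum>b\<in>Basis. (h \<bullet> b) *\<^sub>R D b x)) (at x)"
    and "\<And>b. b \<in> Basis \<Longrightarrow> Ck (Suc k) U (D b)" using Suc(2) by (rule Ck_SucE) blast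
  note D = this
  show ?case by (rule Ck_SucI[where D=D, OF D(1) Suc(1)[OF D(2)]])
qed

lemma Ck_const: "Ck k U (\<lambda>x. c)"
proof (induction k arbitrary: c)
  case (Suc k)
  show ?case by (rule Ck_SucI[where D="\<lambda>b x. 0", OF _ Suc]) simp
qed auto

lemma Ck_linear:
  assumes "bounded_linear f"
  shows "Ck k U f"
proof (cases k)
  case 0
  then show ?thesis using assms by (simp add: linear_continuous_on)
next
  case (Suc j)
  interpret bounded_linear f by fact
  have "f h = (\<Sum>b\<in>Basis. (h \<bullet> b) *\<^sub>R f b)" for h
  proof -
    have "f h = f (\<Sum>b\<in>Basis. (h \<bullet> b) *\<^sub>R b)" by (simp add: euclidean_representation)
    then show ?thesis by (simp add: sum scale)
  qed
  then have eq: "f = (\<lambda>h. \<Sum>b\<in>Basis. (h \<bullet> b) *\<^sub>R f b)" by (rule ext)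
  have "(f has_derivative (\<lambda>h. \<Sum>b\<in>Basis. (h \<bullet> b) *\<^sub>R f b)) (at x)" for x
    by (rule has_derivative_eq_rhs[OF bounded_linear_imp_has_derivative[OF assms] eq])
  then show ?thesis unfolding Suc by (rule Ck_SucI[where D="\<lambda>b x. f b", OF _ Ck_const])
qed

lemma Ck_add: "Ck k U f \<Longrightarrow> Ck k U g \<Longrightarrow> Ck k U (\<lambda>x. f x + g x)"
proof (induction k arbitrary: f g)
  case (Suc k)
  obtain D where D: "\<And>x. x \<in> U \<Longrightarrow> (f has_derivative (\<lambda>h. \<Sum>b\<in>Basis. (h \<bullet> b) *\<^sub>R D b x)) (at x)"
    "\<And>b. b \<in> Basis \<Longrightarrow> Ck k U (D b)" using Suc(2) by (rule Ck_SucE) blast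
  obtain E where E: "\<And>x. x \<in> U \<Longrightarrow> (g has_derivative (\<lambda>h. \<Sum>b\<in>Basis. (h \<bullet> b) *\<^sub>R E b x)) (at x)"
    "\<And>b. b \<in> Basis \<Longrightarrow> Ck k U (E b)" using Suc(3) by (rule Ck_SucE) blast
  show ?case
  proof (rule Ck_SucI[where D="\<lambda>b x. D b x + E b x"])
    fix x assume "x \<in> U"
    show "((\<lambda>x. f x + g x) has_derivative (\<lambda>h. \<Sum>b\<in>Basis. (h \<bullet> b) *\<^sub>R (D b x + E b x))) (at x)"
      by (rule has_derivative_eq_rhs[OF has_derivative_add[OF D(1) E(1)]])
         (use \<open>x \<in> U\<close> in \<open>auto simp: scaleR_add_right sum.distrib\<close>)
  qed (intro Suc(1) D(2) E(2))
qed (simp add: continuous_on_add)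

lemma Ck_mult: "Ck k U f \<Longrightarrow> Ck k U g \<Longrightarrow> Ck k U (\<lambda>x. f x * g x)"
proof (induction k arbitrary: f g)
  case (Suc k)
  obtain D where D: "\<And>x. x \<in> U \<Longrightarrow> (f has_derivative (\<lambda>h. \<Sum>b\<in>Basis. (h \<bullet> b) *\<^sub>R D b x)) (at x)"
    "\<And>b. b \<in> Basis \<Longrightarrow> Ck k U (D b)" using Suc(2) by (rule Ck_SucE) blast
  obtain E where E: "\<And>x. x \<in> U \<Longrightarrow> (g has_derivative (\<lambda>h. \<Sum>b\<in>Basis. (h \<bullet> b) *\<^sub>R E b x)) (at x)"
    "\<And>b. b \<in> Basis \<Longrightarrow> Ck k U (E b)" using Suc(3) by (rule Ck_SucE) blast
  have fg: "Ck k U f" "Ck k U g"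
    using Suc(2,3) by (metis Ck_down)+
  show ?case
  proof (rule Ck_SucI[where D="\<lambda>b x. f x * E b x + D b x * g x"])
    fix x assume "x \<in> U"
    show "((\<lambda>x. f x * g x) has_derivative (\<lambda>h. \<Sum>b\<in>Basis. (h \<bullet> b) *\<^sub>R (f x * E b x + D b x * g x))) (at x)"
      by (rule has_derivative_eq_rhs[OF has_derivative_mult[OF D(1) E(1)]])
         (use \<open>x \<in> U\<close> in \<open>auto simp: scaleR_add_right sum.distrib sum_distrib_left sum_distrib_right\<close>)
  qed (intro Ck_add Suc(1) fg D(2) E(2))
qed (simp add: continuous_on_mult)

lemma Ck_chain:
  assumes f: "Ck (Suc k) U f" and "Ck k U (\<lambda>x. \<phi>' (f x))"
    and \<phi>: "\<And>x. x \<in> U \<Longrightarrow> (\<phi> has_field_derivative \<phi>' (f x)) (at (f x))"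
  shows "Ck (Suc k) U (\<lambda>x. \<phi> (f x))"
proof -
  obtain D where D: "\<And>x. x \<in> U \<Longrightarrow> (f has_derivative (\<lambda>h. \<Sum>b\<in>Basis. (h \<bullet> b) *\<^sub>R D b x)) (at x)"
    "\<And>b. b \<in> Basis \<Longrightarrow> Ck k U (D b)" using f by (rule Ck_SucE) blast
  show ?thesis
  proof (rule Ck_SucI[where D="\<lambda>b x. \<phi>' (f x) * D b x"])
    fix x assume "x \<in> U"
    show "((\<lambda>x. \<phi> (f x)) has_derivative (\<lambda>h. \<Sum>b\<in>Basis. (h \<bullet> b) *\<^sub>R (\<phi>' (f x) * D b x))) (at x)"
      by (rule has_derivative_eq_rhs[OF has_derivative_compose[OF D(1)[OF \<open>x \<in> U\<close>] \<phi>[OF \<open>x \<in> U\<close>, unfolded has_field_derivative_def]]])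
         (auto simp: sum_distrib_left)
  qed (intro Ck_mult assms(2) D(2))
qed

text \<open>Derivatives of holomorphic functions are again holomorphic, so the induction closes
  without computing any of them. For this reason real logarithms and reciprocals are written below
  as real parts of holomorphic functions.\<close>

lemma Ck_holomorphic:
  assumes "\<phi> holomorphic_on S" "open S" "f ` U \<subseteq> S" "Ck k U f"
  shows "Ck k U (\<lambda>x. \<phi> (f x))"
  using assms
proof (induction k arbitrary: \<phi>)
  case 0
  then show ?case
    by (auto intro: continuous_on_compose2 holomorphic_on_imp_continuous_on)
next
  case (Suc k)
  have "Ck k U (\<lambda>x. deriv \<phi> (f x))"
    by (rule Suc(1)[OF holomorphic_deriv[OF Suc(2,3)] Suc(3,4) Ck_down[OF Suc(5)]])
  moreover have "(\<phi> has_field_derivative deriv \<phi> (f x)) (at (f x))" if "x \<in> U" for x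
    using that Suc(2,3,4) by (intro holomorphic_derivI) auto
  ultimately show ?case
    by (rule Ck_chain[where \<phi>'="deriv \<phi>", OF Suc(5)])
qed

lemma Ck_Re: "Ck k U f \<Longrightarrow> Ck k U (\<lambda>x. Re (f x))"
proof (induction k arbitrary: f)
  case (Suc k)
  obtain D where D: "\<And>x. x \<in> U \<Longrightarrow> (f has_derivative (\<lambda>h. \<Sum>b\<in>Basis. (h \<bullet> b) *\<^sub>R D b x)) (at x)"
    "\<And>b. b \<in> Basis \<Longrightarrow> Ck k U (D b)" using Suc(2) by (rule Ck_SucE) blast
  show ?case
  proof (rule Ck_SucI[where D="\<lambda>b x. Re (D b x)"])
    fix x assume "x \<in> U"
    show "((\<lambda>x. Re (f x)) has_derivative (\<lambda>h. \<Sum>b\<in>Basis. (h \<bullet> b) *\<^sub>R Re (D b x))) (at x)"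
      by (rule has_derivative_eq_rhs[OF has_derivative_Re[OF D(1)[OF \<open>x \<in> U\<close>]]])
         (auto simp: Re_sum)
  qed (intro Suc(1) D(2))
qed (auto intro: continuous_intros)

lemma Ck_of_real: "Ck k U f \<Longrightarrow> Ck k U (\<lambda>x. of_real (f x) :: complex)"
proof (induction k arbitrary: f)
  case (Suc k)
  obtain D where D: "\<And>x. x \<in> U \<Longrightarrow> (f has_derivative (\<lambda>h. \<Sum>b\<in>Basis. (h \<bullet> b) *\<^sub>R D b x)) (at x)"
    "\<And>b. b \<in> Basis \<Longrightarrow> Ck k U (D b)" using Suc(2) by (rule Ck_SucE) blast
  show ?case
  proof (rule Ck_SucI[where D="\<lambda>b x. of_real (D b x)"])
    fix x assume "x \<in> U"
    show "((\<lambda>x. of_real (f x) :: complex) has_derivative (\<lambda>h. \<Sum>b\<in>Basis. (h \<bullet> b) *\<^sub>R of_real (D b x))) (at x)"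
      by (rule has_derivative_eq_rhs[OF has_derivative_of_real[OF D(1)[OF \<open>x \<in> U\<close>]]])
         (auto simp: scaleR_conv_of_real)
  qed (intro Suc(1) D(2))
qed (auto intro: continuous_intros)

text \<open>The cube is the least integer power of the positive part that is of class C^2, the
  regularity of the test functions.\<close>

definition pos_cube :: "real \<Rightarrow> real" where "pos_cube u = (max 0 u) ^ 3"

lemma max0_power_deriv:
  "((\<lambda>u. (max 0 u) ^ Suc (Suc n)) has_real_derivative real (Suc (Suc n)) * (max 0 u) ^ Suc n) (at u)"
proof (cases "u = 0")
  case True
  have "((\<lambda>h. (max 0 h) ^ Suc (Suc n) / h) \<longlongrightarrow> 0) (at (0::real))"
  proof (rule Lim_null_comparison)
    have "norm ((max 0 h) ^ Suc (Suc n) / h) \<le> \<bar>h\<bar> ^ Suc n" for h :: real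
    proof (cases "h > 0")
      case False
      then have "(max 0 h) ^ Suc (Suc n) / h = 0" by (simp add: max_absorb1)
      then show ?thesis by (metis abs_ge_zero norm_zero zero_le_power)
    qed (simp add: max_absorb2)
    then show "\<forall>\<^sub>F h in at (0::real). norm ((max 0 h) ^ Suc (Suc n) / h) \<le> \<bar>h\<bar> ^ Suc n"
      by (auto intro: always_eventually)
    show "((\<lambda>h. \<bar>h\<bar> ^ Suc n) \<longlongrightarrow> 0) (at (0::real))"
      by (rule tendsto_eq_intros refl | simp)+
  qed
  then show ?thesis using True by (simp add: DERIV_def)
next
  case False
  show ?thesis
  proof (cases "u > 0")
    case True
    have "((\<lambda>u. u ^ Suc (Suc n)) has_real_derivative real (Suc (Suc n)) * (max 0 u) ^ Suc n) (at u)"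
      by (rule derivative_eq_intros refl)+ (use True in auto)
    then show ?thesis
      by (rule has_field_derivative_transform_within_open[where S="{0<..}"]) (use True in auto)
  next
    case f: False
    have "((\<lambda>u. 0) has_real_derivative real (Suc (Suc n)) * (max 0 u) ^ Suc n) (at u)"
      by (rule derivative_eq_intros refl)+ (use f in auto)
    then show ?thesis
      by (rule has_field_derivative_transform_within_open[where S="{..<0}"]) (use f False in auto)
  qed
qed

lemma pos_cube_deriv: "(pos_cube has_real_derivative 3 * (max 0 u)\<^sup>2) (at u)"
  and pos2_deriv: "((\<lambda>u. (max 0 u)\<^sup>2) has_real_derivative 2 * max 0 u) (at u)"
  using max0_power_deriv[of 1 u] max0_power_deriv[of 0 u]
  by (simp_all add: pos_cube_def[abs_def] numeral_eq_Suc)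

lemma Ck_pos_cube:
  assumes "Ck 2 U (f :: _ \<Rightarrow> real)"
  shows "Ck 2 U (\<lambda>x. pos_cube (f x))"
proof -
  have f: "Ck (Suc (Suc 0)) U f" "Ck (Suc 0) U f" using assms by (auto simp: numeral_2_eq_2 intro: Ck_down)
  have "continuous_on U (\<lambda>x. max 0 (f x))"
    using Ck_imp_continuous[OF f(2)] by (intro continuous_intros)
  then have "Ck (Suc 0) U (\<lambda>x. 3 * (max 0 (f x))\<^sup>2)"
    using f(2) by (intro Ck_mult[OF Ck_const] Ck_chain[where \<phi>="\<lambda>u. (max 0 u)\<^sup>2" and \<phi>'="\<lambda>u. 2 * max 0 u"] pos2_deriv) simp_all
  then have "Ck (Suc (Suc 0)) U (\<lambda>x. pos_cube (f x))"
    by (rule Ck_chain[where \<phi>'="\<lambda>u. 3 * (max 0 u)\<^sup>2", OF f(1)]) (rule pos_cube_deriv)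
  then show ?thesis by (simp add: numeral_2_eq_2)
qed

lemma C2_fun_of_Ck:
  assumes "Ck 2 UNIV (f :: mat2 \<Rightarrow> real)"
  shows "C2_fun f"
proof -
  obtain D where "\<forall>x\<in>UNIV. (f has_derivative (\<lambda>h. \<Sum>b\<in>Basis. (h \<bullet> b) *\<^sub>R D b x)) (at x)"
    and D2: "\<forall>b\<in>Basis. Ck (Suc 0) UNIV (D b)"
    using assms unfolding numeral_2_eq_2 Ck.simps(2)[of "Suc 0"] by (elim exE conjE)
  then have D: "(f has_derivative (\<lambda>h. \<Sum>b\<in>Basis. (h \<bullet> b) *\<^sub>R D b x)) (at x)" for x by simp
  from D2 have "\<forall>b\<in>Basis. \<exists>E. (\<forall>x\<in>UNIV. (D b has_derivative (\<lambda>h. \<Sum>c\<in>Basis. (h \<bullet> c) *\<^sub>R E c x)) (at x)) \<and> (\<forall>c\<in>Basis. continuous_on UNIV (E c))"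
    unfolding Ck.simps .
  from bchoice[OF this] obtain E where E0: "\<forall>b\<in>Basis. (\<forall>x\<in>UNIV. (D b has_derivative (\<lambda>h. \<Sum>c\<in>Basis. (h \<bullet> c) *\<^sub>R E b c x)) (at x)) \<and> (\<forall>c\<in>Basis. continuous_on UNIV (E b c))" ..
  have E: "(D b has_derivative (\<lambda>h. \<Sum>c\<in>Basis. (h \<bullet> c) *\<^sub>R E b c x)) (at x)"
     "c \<in> Basis \<Longrightarrow> continuous_on UNIV (E b c)" if "b \<in> Basis" for b c x
    using bspec[OF E0 that] by simp_all
  define f' where "f' x = (\<Sum>b\<in>Basis. D b x *\<^sub>R blinfun_inner_left b)" for x
  define f'' where "f'' x = (\<Sum>b\<in>Basis. \<Sum>c\<in>Basis. E b c x *\<^sub>R (blinfun_scaleR_left (blinfun_inner_left b) o\<^sub>L blinfun_inner_left c))" for x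
  have 1: "(f has_derivative blinfun_apply (f' x)) (at x)" for x
    by (rule has_derivative_eq_rhs[OF D]) (simp add: f'_def blinfun.sum_left blinfun.scaleR_left fun_eq_iff mult.commute)
  have 2: "(f' has_derivative blinfun_apply (f'' x)) (at x)" for x
    unfolding f'_def
    by (rule has_derivative_eq_rhs, rule has_derivative_sum, rule has_derivative_scaleR_left, rule E(1))
       (auto simp: f''_def blinfun.sum_left blinfun.scaleR_left scaleR_sum_left mult.commute intro!: ext blinfun_eqI)
  have 3: "continuous_on UNIV f''"
    unfolding f''_def by (intro continuous_intros E(2))
  show ?thesis unfolding C2_fun_def by (intro exI[of _ f'] exI[of _ f''] conjI allI 1 2 3)
qed

section \<open>Iwasawa coordinates and cut-off waves\<close>

lemma Ck_cong:
  assumes "Ck k U f" "open U" "\<And>x. x \<in> U \<Longrightarrow> f x = g x"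
  shows "Ck k U g"
proof (cases k)
  case 0
  then show ?thesis using assms by (simp cong: continuous_on_cong)
next
  case (Suc j)
  obtain D where D: "\<And>x. x \<in> U \<Longrightarrow> (f has_derivative (\<lambda>h. \<Sum>b\<in>Basis. (h \<bullet> b) *\<^sub>R D b x)) (at x)"
    "\<And>b. b \<in> Basis \<Longrightarrow> Ck j U (D b)" using assms(1) unfolding Suc by (rule Ck_SucE) blast
  show ?thesis unfolding Suc
  proof (rule Ck_SucI[where D=D])
    fix x assume x: "x \<in> U"
    show "(g has_derivative (\<lambda>h. \<Sum>b\<in>Basis. (h \<bullet> b) *\<^sub>R D b x)) (at x)"
      by (rule has_derivative_transform_within_open[OF D(1)[OF x] assms(2) x assms(3)])
  qed (rule D(2))
qed

text \<open>By uniqueness of the derivative the partial derivatives on \<open>U\<close> vanish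
  outside \<open>K\<close>. Their extensions by zero therefore satisfy the hypotheses again, one
  order lower.\<close>

lemma Ck_extend_zero:
  assumes "Ck k U f" "open U" "closed K" "K \<subseteq> U" "\<And>x. x \<notin> K \<Longrightarrow> f x = 0"
  shows "Ck k UNIV f"
  using assms
proof (induction k arbitrary: f)
  case 0
  have "continuous_on (- K) f"
    using 0(5) by (subst continuous_on_cong[OF refl, of _ _ "\<lambda>x. 0"]) auto
  then have "continuous_on (U \<union> (- K)) f"
    using 0 by (intro continuous_on_open_Un) (auto simp: open_Compl)
  moreover have "U \<union> (- K) = UNIV" using 0 by auto
  ultimately show ?case by simp
next
  case (Suc k)
  obtain D where D: "\<And>x. x \<in> U \<Longrightarrow> (f has_derivative (\<lambda>h. \<Sum>b\<in>Basis. (h \<bullet> b) *\<^sub>R D b x)) (at x)"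
    "\<And>b. b \<in> Basis \<Longrightarrow> Ck k U (D b)" using Suc(2) by (rule Ck_SucE) blast
  define E where "E b x = (if x \<in> U then D b x else 0)" for b x
  have out: "(f has_derivative (\<lambda>h. 0)) (at x)" if "x \<notin> K" for x
    by (rule has_derivative_transform_within_open[OF has_derivative_const, of "-K"])
       (use that Suc(4,6) in \<open>auto simp: open_Compl\<close>)
  have E0: "E b x = 0" if b: "b \<in> Basis" and x: "x \<notin> K" for b x
  proof (cases "x \<in> U")
    case True
    have "(\<lambda>h. \<Sum>b\<in>Basis. (h \<bullet> b) *\<^sub>R D b x) = (\<lambda>h. 0)"
      by (rule has_derivative_unique[OF D(1)[OF True] out[OF x]])
    then have "(\<Sum>c\<in>Basis. (b \<bullet> c) *\<^sub>R D c x) = 0" by metis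
    moreover have "(\<Sum>c\<in>Basis. (b \<bullet> c) *\<^sub>R D c x) = (\<Sum>c\<in>Basis. if c = b then D c x else 0)"
      by (rule sum.cong) (use b in \<open>auto simp: inner_Basis\<close>)
    ultimately show ?thesis using b by (simp add: E_def)
  qed (simp add: E_def)
  show ?case
  proof (rule Ck_SucI[where D=E])
    fix x
    show "(f has_derivative (\<lambda>h. \<Sum>b\<in>Basis. (h \<bullet> b) *\<^sub>R E b x)) (at x)"
    proof (cases "x \<in> U")
      case True
      then show ?thesis using D(1)[OF True] by (simp add: E_def)
    next
      case False
      then have "x \<notin> K" using Suc(5) by auto
      then show ?thesis using out by (simp add: E0)
    qed
  next
    fix b :: 'a assume b: "b \<in> Basis"
    show "Ck k UNIV (E b)"
    proof (rule Suc(1)[OF _ Suc(3-5)])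
      show "Ck k U (E b)" by (rule Ck_cong[OF D(2)[OF b] Suc(3)]) (simp add: E_def)
    qed (rule E0[OF b])
  qed
qed

text \<open>With \<open>(c, d)\<close> the bottom row of \<open>g\<close>, the point of the upper half plane is \<open>x + i e\<^sup>v\<close>, \<open>e\<^sup>v = 1 / (c\<^sup>2 + d\<^sup>2)\<close>,
  and the fibre coordinate is the unit complex number \<open>(d + i c) / |d + i c|\<close>, which turns by \<open>- s / 2\<close>
  under \<open>expZ s\<close>. The coordinates extend to all matrices with nonzero bottom row.\<close>

definition iw_q :: "mat2 \<Rightarrow> real" where "iw_q g = (g$2$1)\<^sup>2 + (g$2$2)\<^sup>2"
definition iw_x :: "mat2 \<Rightarrow> real" where "iw_x g = (g$1$1 * g$2$1 + g$1$2 * g$2$2) / iw_q g"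
definition iw_v :: "mat2 \<Rightarrow> real" where "iw_v g = - ln (iw_q g)"
definition iw_w :: "mat2 \<Rightarrow> complex" where "iw_w g = Complex (g$2$2) (g$2$1) / of_real (sqrt (iw_q g))"
definition sq_norm :: "mat2 \<Rightarrow> real" where "sq_norm g = (g$1$1)\<^sup>2 + (g$1$2)\<^sup>2 + (g$2$1)\<^sup>2 + (g$2$2)\<^sup>2"

text \<open>Left translations by upper unipotent matrices and right rotations by \<open>expZ\<close>
  commute with the sub-Laplacian and multiply a wave by a phase. On such functions the generator
  reduces to an ordinary differential operator in \<open>v\<close>. The amplitude takes a complex
  argument because it will be continued to a strip.\<close>

definition wave :: "real \<Rightarrow> int \<Rightarrow> (complex \<Rightarrow> complex) \<Rightarrow> mat2 \<Rightarrow> complex" where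
  "wave p m F g = cis (p * iw_x g) * iw_w g powi m * F (of_real (iw_v g))"

text \<open>The determinant term vanishes on \<open>SL2\<close>; off \<open>SL2\<close> it forces the bottom row of \<open>g\<close> to be nonzero where the
  argument is nonnegative. The logarithm makes horizontal derivatives of the cut-off of order \<open>1 / R\<close>.\<close>

definition cut_arg :: "real \<Rightarrow> mat2 \<Rightarrow> real" where
  "cut_arg R g = 1 - (ln (1 + sq_norm g) / R)\<^sup>2 - 4 * (det g - 1)\<^sup>2"

definition cut_wave :: "real \<Rightarrow> real \<Rightarrow> int \<Rightarrow> (complex \<Rightarrow> complex) \<Rightarrow> mat2 \<Rightarrow> real" where
  "cut_wave R p m F g = pos_cube (cut_arg R g) * Re (wave p m F g)"

definition strip :: "real \<Rightarrow> complex set" where "strip r = {z. \<bar>Im z\<bar> < r}"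

lemma open_strip: "open (strip r)"
  unfolding strip_def by (intro open_Collect_less continuous_intros)

lemma of_real_strip: "r > 0 \<Longrightarrow> of_real x \<in> strip r"
  by (simp add: strip_def)

section \<open>Smoothness of the coordinates and of the waves\<close>

lemma Ck_entry: "Ck k U (\<lambda>g::mat2. g$i$j)"
  by (intro Ck_linear bounded_linear_compose[OF bounded_linear_vec_nth bounded_linear_vec_nth])

lemma Ck_diff: "Ck k U f \<Longrightarrow> Ck k U g \<Longrightarrow> Ck k U (\<lambda>x. f x - g x)"
  using Ck_add[of k U f "\<lambda>x. - 1 * g x"] Ck_mult[OF Ck_const[of k U "-1"], of g] by simp

lemma Ck_power2: "Ck k U f \<Longrightarrow> Ck k U (\<lambda>x. (f x)\<^sup>2)"
  using Ck_mult[of k U f f] by (simp add: power2_eq_square)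

lemma Ck_divide_const: "Ck k U f \<Longrightarrow> Ck k U (\<lambda>x. f x / c)"
  using Ck_mult[of k U f "\<lambda>x. inverse c"] Ck_const[of k U "inverse c"] by (simp add: divide_inverse)

lemma Ck_det: "Ck k U (det :: mat2 \<Rightarrow> real)"
proof -
  have "Ck k U (\<lambda>g::mat2. g$1$1 * g$2$2 - g$1$2 * g$2$1)"
    by (intro Ck_diff Ck_mult Ck_entry)
  then show ?thesis by (simp only: det_2[symmetric])
qed

lemma Ck_iw_q: "Ck k U iw_q"
  unfolding iw_q_def[abs_def] power2_eq_square by (intro Ck_add Ck_mult Ck_entry)

lemma open_iw_q: "open {g. iw_q g > 0}"
  unfolding iw_q_def by (intro open_Collect_less continuous_intros)

lemma Ck_iw_v: "Ck k {g. iw_q g > 0} iw_v"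
proof -
  have "Ck k {g. iw_q g > 0} (\<lambda>g. - 1 * Re (Ln (of_real (iw_q g))))"
    by (intro Ck_mult Ck_const Ck_Re Ck_holomorphic[of Ln "- \<real>\<^sub>\<le>\<^sub>0"] Ck_of_real Ck_iw_q)
       (auto intro!: holomorphic_intros simp: open_Compl complex_nonpos_Reals_iff)
  then show ?thesis
    by (rule Ck_cong[OF _ open_iw_q]) (simp add: iw_v_def Ln_of_real)
qed

lemma Ck_iw_x: "Ck k {g. iw_q g > 0} iw_x"
proof -
  have "Ck k {g. iw_q g > 0} (\<lambda>g. (g$1$1 * g$2$1 + g$1$2 * g$2$2) * Re (inverse (of_real (iw_q g))))"
    by (intro Ck_add Ck_mult Ck_entry Ck_Re Ck_holomorphic[of inverse "- {0}"] Ck_of_real Ck_iw_q)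
       (auto intro!: holomorphic_intros)
  then show ?thesis
    by (rule Ck_cong[OF _ open_iw_q]) (auto simp: iw_x_def divide_inverse simp flip: of_real_inverse)
qed

lemma Ck_iw_w: "Ck k {g. iw_q g > 0} iw_w"
proof -
  have "Ck k {g. iw_q g > 0} (\<lambda>g. (of_real (g$2$2) + \<i> * of_real (g$2$1)) * exp (of_real (iw_v g) * (1/2)))"
    by (intro Ck_add Ck_mult Ck_const Ck_of_real Ck_entry Ck_iw_v
         Ck_holomorphic[where \<phi>="\<lambda>z. exp (z * (1/2))" and S=UNIV])
       (auto intro!: holomorphic_intros)
  then show ?thesis
  proof (rule Ck_cong[OF _ open_iw_q])
    fix g assume "g \<in> {g. 0 < iw_q g}"
    then have "sqrt (iw_q g) = exp (ln (iw_q g) / 2)"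
      using exp_ln[of "sqrt (iw_q g)"] ln_sqrt[of "iw_q g"] by simp
    moreover have "exp (iw_v g / 2) = inverse (exp (ln (iw_q g) / 2))"
      unfolding iw_v_def exp_minus[symmetric] by simp
    ultimately have "exp (iw_v g / 2) = 1 / sqrt (iw_q g)" by (simp only: inverse_eq_divide)
    moreover have "exp (complex_of_real (iw_v g) * (1/2)) = of_real (exp (iw_v g / 2))"
      by (simp flip: exp_of_real)
    ultimately have "exp (of_real (iw_v g) * (1/2)) = 1 / complex_of_real (sqrt (iw_q g))" by simp
    then show "(of_real (g$2$2) + \<i> * of_real (g$2$1)) * exp (of_real (iw_v g) * (1/2)) = iw_w g"
      by (simp add: iw_w_def Complex_eq)
  qed
qed

lemma norm_iw_w: "iw_q g > 0 \<Longrightarrow> norm (iw_w g) = 1"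
  by (auto simp: iw_w_def norm_divide iw_q_def complex_norm add.commute)

lemma Ck_wave:
  assumes "F holomorphic_on strip r" "r > 0"
  shows "Ck k {g. iw_q g > 0} (wave p m F)"
proof -
  have "Ck k {g. iw_q g > 0} (\<lambda>g. exp (\<i> * of_real p * of_real (iw_x g)) * (iw_w g powi m) * F (of_real (iw_v g)))"
  proof (intro Ck_mult)
    show "Ck k {g. iw_q g > 0} (\<lambda>g. exp (\<i> * of_real p * of_real (iw_x g)))"
      by (rule Ck_holomorphic[where \<phi>="\<lambda>z. exp (\<i> * of_real p * z)" and S=UNIV])
         (auto intro!: holomorphic_intros Ck_of_real Ck_iw_x)
    show "Ck k {g. iw_q g > 0} (\<lambda>g. iw_w g powi m)"
      by (rule Ck_holomorphic[where \<phi>="\<lambda>z. z powi m" and S="-{0}"])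
         (use norm_iw_w in \<open>force intro!: holomorphic_intros Ck_iw_w\<close>)+
    show "Ck k {g. iw_q g > 0} (\<lambda>g. F (of_real (iw_v g)))"
      by (rule Ck_holomorphic[OF assms(1) open_strip]) (auto intro!: Ck_of_real Ck_iw_v of_real_strip assms)
  qed
  then show ?thesis
    by (rule Ck_cong[OF _ open_iw_q]) (simp add: wave_def cis_conv_exp mult_ac)
qed

section \<open>The cut-off and its support\<close>

lemma sq_norm_norm: "sq_norm g = (norm g)\<^sup>2"
  unfolding sq_norm_def power2_norm_eq_inner by (simp add: inner_vec_def sum_2 power2_eq_square)

lemma Ck_cut_arg: "Ck k UNIV (cut_arg R)"
proof -
  have "Ck k UNIV (\<lambda>g. Re (Ln (1 + of_real (sq_norm g))))"
  proof (intro Ck_Re Ck_holomorphic[of Ln "- \<real>\<^sub>\<le>\<^sub>0"] Ck_add Ck_const Ck_of_real)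
    show "Ck k UNIV sq_norm" unfolding sq_norm_def[abs_def] power2_eq_square by (intro Ck_add Ck_mult Ck_entry)
  qed (auto intro!: holomorphic_intros simp: open_Compl complex_nonpos_Reals_iff sq_norm_norm, smt (verit) zero_le_power2)
  moreover have "Re (Ln (1 + of_real (sq_norm g))) = ln (1 + sq_norm g)" for g
  proof -
    have "1 + complex_of_real (sq_norm g) = of_real (1 + sq_norm g)" by simp
    moreover have "1 + sq_norm g > 0" by (simp add: sq_norm_norm add_pos_nonneg)
    ultimately show ?thesis by (simp only: Ln_of_real Re_complex_of_real)
  qed
  ultimately have l: "Ck k UNIV (\<lambda>g. ln (1 + sq_norm g))" by simp
  show ?thesis
    unfolding cut_arg_def[abs_def]
    by (intro Ck_diff Ck_power2 Ck_divide_const Ck_mult Ck_const Ck_det l)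
qed

lemma cut_arg_iw_q:
  assumes "cut_arg R g \<ge> 0"
  shows "iw_q g > 0"
proof (rule ccontr)
  assume "\<not> ?thesis"
  then have "g$2$1 = 0" "g$2$2 = 0" by (auto simp: iw_q_def) (smt (verit) zero_le_power2 zero_less_power2)+
  then have "det g = 0" by (simp add: det_2)
  then have "cut_arg R g = 1 - (ln (1 + sq_norm g) / R)\<^sup>2 - 4" by (simp add: cut_arg_def)
  then show False using assms by (smt (verit) zero_le_power2)
qed

lemma cut_arg_compact:
  assumes "R > 0"
  shows "compact {g. cut_arg R g \<ge> 0}"
proof -
  have cl: "closed {g. cut_arg R g \<ge> 0}"
    using Ck_imp_continuous[OF Ck_cut_arg[of 0 R]] by (intro closed_Collect_le continuous_intros)
  have "norm g \<le> sqrt (exp R)" if "cut_arg R g \<ge> 0" for g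
  proof -
    have "(ln (1 + sq_norm g) / R)\<^sup>2 \<le> 1" using that unfolding cut_arg_def by (smt (verit) zero_le_power2)
    then have "ln (1 + sq_norm g) / R \<le> 1" using abs_square_le_1[of "ln (1 + sq_norm g) / R"] by linarith
    then have "ln (1 + sq_norm g) \<le> R" using assms by (simp add: field_simps)
    moreover have "1 + sq_norm g > 0" by (simp add: sq_norm_norm add_pos_nonneg)
    ultimately have "1 + sq_norm g \<le> exp R" by (metis exp_ln exp_le_cancel_iff)
    then show ?thesis by (simp add: sq_norm_norm real_le_rsqrt)
  qed
  then show ?thesis using cl unfolding compact_eq_bounded_closed bounded_iff by blast
qed

lemma test_fun_cut_wave:
  assumes "F holomorphic_on strip r" "r > 0" "R > 0"
  shows "test_fun (cut_wave R p m F)"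
proof -
  have "Ck 2 {g. iw_q g > 0} (cut_wave R p m F)"
    unfolding cut_wave_def[abs_def]
    by (intro Ck_mult Ck_pos_cube Ck_Re Ck_wave[OF assms(1,2)] Ck_subset[OF Ck_cut_arg]) simp
  moreover have z: "cut_wave R p m F g = 0" if "g \<notin> {g. cut_arg R g \<ge> 0}" for g
    using that by (simp add: cut_wave_def pos_cube_def)
  ultimately have "Ck 2 UNIV (cut_wave R p m F)"
    using cut_arg_compact[OF assms(3)] cut_arg_iw_q
    by (intro Ck_extend_zero[of 2 "{g. iw_q g > 0}" _ "{g. cut_arg R g \<ge> 0}"] open_iw_q)
       (auto simp: compact_imp_closed)
  then have "C2_fun (cut_wave R p m F)" by (rule C2_fun_of_Ck)
  moreover have "compact (closure {g. cut_wave R p m F g \<noteq> 0})"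
    using z cut_arg_compact[OF assms(3)]
    by (intro compact_closure[THEN iffD2] bounded_subset[OF compact_imp_bounded[of "{g. cut_arg R g \<ge> 0}"]]) auto
  ultimately show ?thesis by (simp add: test_fun_def)
qed

section \<open>The sub-Laplacian on waves\<close>

text \<open>Half the sub-Laplacian maps the wave of amplitude \<open>F\<close> to the wave of amplitude \<open>gen_op p m F\<close>.\<close>

definition gen_op :: "real \<Rightarrow> int \<Rightarrow> (complex \<Rightarrow> complex) \<Rightarrow> complex \<Rightarrow> complex" where
  "gen_op p m F z = (deriv (deriv F) z - deriv F z - (of_real p * exp z + of_int m / 2)\<^sup>2 * F z) / 2"

text \<open>One speed \<open>a\<close> drives both \<open>x\<close> and the phase, with weights
  \<open>e^v\<close> and 1/2. This produces the combination of \<open>p * exp v\<close> and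
  \<open>m / 2\<close> whose square appears in \<open>gen_op\<close>.\<close>

lemma curve_first:
  fixes x v a b :: "real \<Rightarrow> real" and w :: "real \<Rightarrow> complex" and F F1 :: "complex \<Rightarrow> complex"
  assumes x: "(x has_real_derivative exp (v s) * a s) (at s)"
    and v: "(v has_real_derivative b s) (at s)"
    and w: "(w has_vector_derivative \<i> * of_real (a s / 2) * w s) (at s)" "w s \<noteq> 0"
    and F: "(F has_field_derivative F1 (of_real (v s))) (at (of_real (v s)))"
  shows "((\<lambda>s. cis (p * x s) * w s powi m * F (of_real (v s))) has_vector_derivative
     cis (p * x s) * w s powi m * (\<i> * (of_real p * exp (of_real (v s)) + of_int m / 2) * of_real (a s) * F (of_real (v s))
        + of_real (b s) * F1 (of_real (v s)))) (at s)"
proof -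
  have 1: "((\<lambda>s. cis (p * x s)) has_vector_derivative (p * (exp (v s) * a s)) *\<^sub>R (\<i> * cis (p * x s))) (at s)"
  proof -
    have "((\<lambda>s. p * x s) has_real_derivative p * (exp (v s) * a s)) (at s)" by (rule DERIV_cmult[OF x])
    moreover have "(cis has_vector_derivative (\<i> * cis t)) (at t)" for t
      using has_derivative_cis[of "\<lambda>t. t" "\<lambda>t. t" t UNIV] by (simp add: has_vector_derivative_def scaleR_conv_of_real mult_ac)
    ultimately show ?thesis
      using vector_diff_chain_at[of "\<lambda>s. p * x s" "p * (exp (v s) * a s)" s cis "\<i> * cis (p * x s)"]
      by (simp add: o_def has_real_derivative_iff_has_vector_derivative)
  qed
  have 2: "((\<lambda>s. w s powi m) has_vector_derivative of_real (a s) * (\<i> * of_int m / 2) * w s powi m) (at s)"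
  proof -
    have "((\<lambda>z. z powi m) has_field_derivative of_int m * w s powi (m - 1)) (at (w s))"
      using w(2) by (auto intro!: derivative_eq_intros)
    from field_vector_diff_chain_at[OF w(1) this]
    have "((\<lambda>s. w s powi m) has_vector_derivative \<i> * of_real (a s / 2) * w s * (of_int m * w s powi (m - 1))) (at s)"
      by (simp add: o_def)
    moreover have "w s * w s powi (m - 1) = w s powi m"
      using w(2) by (metis power_int_add_1' diff_add_cancel)
    moreover have "\<i> * of_real (a s / 2) * w s * (of_int m * w s powi (m - 1)) =
       of_real (a s) * (\<i> * of_int m / 2) * (w s * w s powi (m - 1))"
      by simp
    ultimately show ?thesis by (simp only:)
  qed
  have 3: "((\<lambda>s. F (of_real (v s))) has_vector_derivative of_real (b s) * F1 (of_real (v s))) (at s)"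
  proof -
    have "((\<lambda>s. complex_of_real (v s)) has_vector_derivative of_real (b s)) (at s)"
      using v by (intro has_vector_derivative_of_real)
        (simp add: has_real_derivative_iff_has_vector_derivative)
    from field_vector_diff_chain_at[OF this F] show ?thesis by (simp add: o_def)
  qed
  show ?thesis
    by (rule has_vector_derivative_eq_rhs[OF has_vector_derivative_mult[OF has_vector_derivative_mult[OF 1 2] 3]])
       (simp add: scaleR_conv_of_real exp_of_real algebra_simps)
qed

text \<open>Writing \<open>a\<close> and \<open>b\<close> as sine and cosine of an angle, the
  equations for them say that the angle grows at the rate \<open>a\<close>. This is how the unit
  tangent of a hyperbolic geodesic turns against the frame \<open>e^v d/dx\<close>,
  \<open>d/dv\<close>; the horizontal curves considered below lie over geodesics.\<close>

lemma curve_second: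
  fixes x v a b :: "real \<Rightarrow> real" and w :: "real \<Rightarrow> complex" and p :: real and m :: int and F F1 F2 :: "complex \<Rightarrow> complex"
  assumes x: "\<And>s. (x has_real_derivative exp (v s) * a s) (at s)"
    and v: "\<And>s. (v has_real_derivative b s) (at s)"
    and w: "\<And>s. (w has_vector_derivative \<i> * of_real (a s / 2) * w s) (at s)" "\<And>s. w s \<noteq> 0"
    and a: "\<And>s. (a has_real_derivative a s * b s) (at s)"
    and b: "\<And>s. (b has_real_derivative - (a s)\<^sup>2) (at s)"
    and F: "\<And>t::real. (F has_field_derivative F1 (of_real t)) (at (of_real t))"
           "\<And>t::real. (F1 has_field_derivative F2 (of_real t)) (at (of_real t))"
  defines "E \<equiv> \<lambda>s. cis (p * x s) * w s powi m"
    and "Q \<equiv> \<lambda>s. of_real p * exp (of_real (v s)) + of_int m / 2"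
  shows "((\<lambda>s. E s * F (of_real (v s))) has_vector_derivative
            E s * (\<i> * Q s * of_real (a s) * F (of_real (v s)) + of_real (b s) * F1 (of_real (v s)))) (at s)"
    and "((\<lambda>s. E s * (\<i> * Q s * of_real (a s) * F (of_real (v s)) + of_real (b s) * F1 (of_real (v s)))) has_vector_derivative
            E s * (- (Q s)\<^sup>2 * of_real ((a s)\<^sup>2) * F (of_real (v s))
               + 2 * \<i> * Q s * of_real (a s * b s) * F1 (of_real (v s))
               + \<i> * (of_real p * exp (of_real (v s)) + Q s) * of_real (a s * b s) * F (of_real (v s))
               - of_real ((a s)\<^sup>2) * F1 (of_real (v s)) + of_real ((b s)\<^sup>2) * F2 (of_real (v s)))) (at s)"
proof -
  show "((\<lambda>s. E s * F (of_real (v s))) has_vector_derivative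
            E s * (\<i> * Q s * of_real (a s) * F (of_real (v s)) + of_real (b s) * F1 (of_real (v s)))) (at s)"
    unfolding E_def Q_def by (rule curve_first[where x=x and v=v and a=a and b=b and w=w and s=s and F=F and ?F1.0=F1, OF x v w F(1)])
  define A where "A s = \<i> * Q s * of_real (a s)" for s
  have Q': "(Q has_vector_derivative of_real (p * (exp (v s) * b s))) (at s)"
  proof -
    have "((\<lambda>s. p * exp (v s) + of_int m / 2) has_real_derivative p * (exp (v s) * b s)) (at s)"
      by (rule derivative_eq_intros v refl | simp)+
    then have "((\<lambda>s. complex_of_real (p * exp (v s) + of_int m / 2)) has_vector_derivative of_real (p * (exp (v s) * b s))) (at s)"
      by (intro has_vector_derivative_of_real) (simp add: has_real_derivative_iff_has_vector_derivative)
    then show ?thesis by (simp add: Q_def[abs_def] exp_of_real)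
  qed
  have a': "((\<lambda>s. complex_of_real (a s)) has_vector_derivative of_real (a s * b s)) (at s)"
    using a by (intro has_vector_derivative_of_real) (simp add: has_real_derivative_iff_has_vector_derivative)
  have b': "((\<lambda>s. complex_of_real (b s)) has_vector_derivative of_real (- (a s)\<^sup>2)) (at s)"
    using b by (intro has_vector_derivative_of_real) (simp add: has_real_derivative_iff_has_vector_derivative)
  have A': "(A has_vector_derivative \<i> * of_real p * exp (of_real (v s)) * of_real (a s * b s) + A s * of_real (b s)) (at s)"
    unfolding A_def
    by (rule has_vector_derivative_eq_rhs[OF has_vector_derivative_mult[OF has_vector_derivative_mult_right[OF Q'] a']])
       (simp add: exp_of_real algebra_simps)
  have f: "((\<lambda>s. E s * F (of_real (v s))) has_vector_derivative
            E s * (A s * F (of_real (v s)) + of_real (b s) * F1 (of_real (v s)))) (at s)"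
    unfolding E_def Q_def A_def by (rule curve_first[where x=x and v=v and a=a and b=b and w=w and s=s and F=F and ?F1.0=F1, OF x v w F(1)])
  have f1: "((\<lambda>s. E s * F1 (of_real (v s))) has_vector_derivative
            E s * (A s * F1 (of_real (v s)) + of_real (b s) * F2 (of_real (v s)))) (at s)"
    unfolding E_def Q_def A_def by (rule curve_first[where x=x and v=v and a=a and b=b and w=w and s=s and F=F1 and ?F1.0=F2, OF x v w F(2)])
  have "((\<lambda>s. A s * (E s * F (of_real (v s))) + of_real (b s) * (E s * F1 (of_real (v s)))) has_vector_derivative
     (A s * (E s * (A s * F (of_real (v s)) + of_real (b s) * F1 (of_real (v s)))) +
      (\<i> * of_real p * exp (of_real (v s)) * of_real (a s * b s) + A s * of_real (b s)) * (E s * F (of_real (v s)))) +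
     (of_real (b s) * (E s * (A s * F1 (of_real (v s)) + of_real (b s) * F2 (of_real (v s)))) +
      of_real (- (a s)\<^sup>2) * (E s * F1 (of_real (v s))))) (at s)"
    by (intro has_vector_derivative_add has_vector_derivative_mult A' f b' f1)
  moreover have "A s * (E s * F (of_real (v s))) + of_real (b s) * (E s * F1 (of_real (v s))) =
     E s * (\<i> * Q s * of_real (a s) * F (of_real (v s)) + of_real (b s) * F1 (of_real (v s)))" for s
    by (simp add: A_def algebra_simps)
  ultimately have *: "((\<lambda>s. E s * (\<i> * Q s * of_real (a s) * F (of_real (v s)) + of_real (b s) * F1 (of_real (v s)))) has_vector_derivative
     (A s * (E s * (A s * F (of_real (v s)) + of_real (b s) * F1 (of_real (v s)))) +
      (\<i> * of_real p * exp (of_real (v s)) * of_real (a s * b s) + A s * of_real (b s)) * (E s * F (of_real (v s)))) +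
     (of_real (b s) * (E s * (A s * F1 (of_real (v s)) + of_real (b s) * F2 (of_real (v s)))) +
      of_real (- (a s)\<^sup>2) * (E s * F1 (of_real (v s))))) (at s)"
    by simp
  show "((\<lambda>s. E s * (\<i> * Q s * of_real (a s) * F (of_real (v s)) + of_real (b s) * F1 (of_real (v s)))) has_vector_derivative
            E s * (- (Q s)\<^sup>2 * of_real ((a s)\<^sup>2) * F (of_real (v s))
               + 2 * \<i> * Q s * of_real (a s * b s) * F1 (of_real (v s))
               + \<i> * (of_real p * exp (of_real (v s)) + Q s) * of_real (a s * b s) * F (of_real (v s))
               - of_real ((a s)\<^sup>2) * F1 (of_real (v s)) + of_real ((b s)\<^sup>2) * F2 (of_real (v s)))) (at s)"
    by (rule has_vector_derivative_eq_rhs[OF *])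
       (simp add: A_def power2_eq_square, simp add: algebra_simps)
qed

text \<open>The hypotheses are those of the squared norm along a horizontal one-parameter subgroup,
  a combination of \<open>exp s\<close> and \<open>exp (- s)\<close>; then
  \<open>ln (1 + N s)\<close> has bounded first and second derivatives. Differentiating its square
  leaves a factor of the logarithm, which is at most \<open>R\<close> where the cut-off does not
  vanish, so one of the two powers of \<open>1 / R\<close> survives.\<close>

lemma cutoff_curve:
  fixes N N1 :: "real \<Rightarrow> real"
  assumes N: "\<And>s. (N has_real_derivative N1 s) (at s)" "\<And>s. (N1 has_real_derivative N s) (at s)"
    and b: "\<And>s. \<bar>N1 s\<bar> \<le> N s" and R: "R \<ge> 1"
  shows "\<exists>\<chi>1 \<chi>2. (\<forall>s. ((\<lambda>s. pos_cube (1 - (ln (1 + N s) / R)\<^sup>2)) has_real_derivative \<chi>1 s) (at s)) \<and>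
     (\<forall>s. (\<chi>1 has_real_derivative \<chi>2 s) (at s)) \<and> (\<forall>s. \<bar>\<chi>1 s\<bar> \<le> 6 / R \<and> \<bar>\<chi>2 s\<bar> \<le> 36 / R)"
proof -
  have N0: "N s \<ge> 0" for s using b[of s] by linarith
  define l l1 l2 where "l s = ln (1 + N s)" and "l1 s = N1 s / (1 + N s)"
    and "l2 s = (N s * (1 + N s) - N1 s * N1 s) / ((1 + N s) * (1 + N s))" for s
  have l: "(l has_real_derivative l1 s) (at s)" "(l1 has_real_derivative l2 s) (at s)" for s
    unfolding l_def l1_def l2_def
    using N0[of s] by (auto intro!: derivative_eq_intros N simp: divide_simps)
  have l1: "\<bar>l1 s\<bar> \<le> 1" for s
    using b[of s] N0[of s] by (simp add: l1_def abs_divide)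
  have l2: "\<bar>l2 s\<bar> \<le> 1" for s
  proof -
    have "N1 s * N1 s \<le> N s * N s"
      using b[of s] by (metis abs_mult_self_eq abs_ge_zero mult_mono N0)
    then have "\<bar>N s * (1 + N s) - N1 s * N1 s\<bar> \<le> (1 + N s) * (1 + N s)"
      using N0[of s] by (simp add: algebra_simps abs_if)
    then show ?thesis using N0[of s] by (simp add: l2_def abs_divide abs_mult)
  qed
  define P P1 P2 where "P s = 1 - (l s / R)\<^sup>2" and "P1 s = - 2 * (l s * l1 s) / R\<^sup>2"
    and "P2 s = - 2 * (l1 s * l1 s + l s * l2 s) / R\<^sup>2" for s
  have P: "(P has_real_derivative P1 s) (at s)" "(P1 has_real_derivative P2 s) (at s)" for s
    unfolding P_def P1_def P2_def
    using R by (auto intro!: derivative_eq_intros l simp: field_simps power2_eq_square)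
  define c1 c2 where "c1 s = 3 * (max 0 (P s))\<^sup>2 * P1 s"
    and "c2 s = 3 * (max 0 (P s))\<^sup>2 * P2 s + 3 * (2 * max 0 (P s) * P1 s) * P1 s" for s
  have d1: "((\<lambda>s. pos_cube (1 - (ln (1 + N s) / R)\<^sup>2)) has_real_derivative c1 s) (at s)" for s
    using DERIV_chain2[OF pos_cube_deriv P(1)] by (simp add: P_def[abs_def] l_def c1_def)
  have d2: "(c1 has_real_derivative c2 s) (at s)" for s
  proof -
    have "((\<lambda>s. (max 0 (P s))\<^sup>2) has_real_derivative 2 * max 0 (P s) * P1 s) (at s)"
      by (rule DERIV_chain2[OF pos2_deriv P(1)])
    from DERIV_mult[OF DERIV_cmult[OF this, of 3] P(2)]
    show ?thesis unfolding c1_def c2_def by (simp add: algebra_simps)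
  qed
  have bd: "\<bar>c1 s\<bar> \<le> 6 / R \<and> \<bar>c2 s\<bar> \<le> 36 / R" for s
  proof (cases "P s \<le> 0")
    case True
    then show ?thesis using R by (simp add: c1_def c2_def)
  next
    case False
    have l0: "l s \<ge> 0" using N0[of s] by (simp add: l_def)
    have "(l s / R)\<^sup>2 \<le> 1" using False by (simp add: P_def)
    then have "\<bar>l s / R\<bar> \<le> 1" by (simp add: abs_square_le_1)
    then have lR: "l s \<le> R" using R by (simp add: divide_simps split: if_splits)
    have cut_arg: "0 \<le> max 0 (P s)" "max 0 (P s) \<le> 1" by (auto simp: P_def)
    then have PP2: "0 \<le> (max 0 (P s))\<^sup>2" "(max 0 (P s))\<^sup>2 \<le> 1" by (auto simp: power_le_one)
    have "\<bar>l s * l1 s\<bar> \<le> R * 1" unfolding abs_mult using l1[of s] l0 lR by (intro mult_mono) auto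
    then have P1: "\<bar>P1 s\<bar> \<le> 2 / R"
      using R by (simp add: P1_def abs_divide abs_mult power2_eq_square divide_simps)
    have "\<bar>l1 s * l1 s\<bar> \<le> 1 * 1" unfolding abs_mult using l1[of s] by (intro mult_mono) auto
    moreover have "\<bar>l s * l2 s\<bar> \<le> R * 1" unfolding abs_mult using l2[of s] l0 lR by (intro mult_mono) auto
    ultimately have "\<bar>l1 s * l1 s + l s * l2 s\<bar> \<le> 2 * R" using R by linarith
    then have P2: "\<bar>P2 s\<bar> \<le> 4 / R"
      using R by (simp add: P2_def abs_divide abs_mult power2_eq_square divide_simps)
    have "\<bar>c1 s\<bar> = 3 * ((max 0 (P s))\<^sup>2 * \<bar>P1 s\<bar>)" by (simp add: c1_def abs_mult)
    also have "\<dots> \<le> 3 * (1 * (2 / R))" using PP2 P1 by (intro mult_mono) auto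
    finally have 1: "\<bar>c1 s\<bar> \<le> 6 / R" by simp
    have "\<bar>3 * (max 0 (P s))\<^sup>2 * P2 s\<bar> = 3 * ((max 0 (P s))\<^sup>2 * \<bar>P2 s\<bar>)" by (simp add: abs_mult)
    also have "\<dots> \<le> 3 * (1 * (4 / R))" using PP2 P2 by (intro mult_mono) auto
    finally have 2: "\<bar>3 * (max 0 (P s))\<^sup>2 * P2 s\<bar> \<le> 12 / R" by simp
    have "\<bar>3 * (2 * max 0 (P s) * P1 s) * P1 s\<bar> = 6 * (max 0 (P s) * (\<bar>P1 s\<bar> * \<bar>P1 s\<bar>))" by (simp add: abs_mult)
    also have "\<dots> \<le> 6 * (1 * (2 / R * (2 / 1)))"
    proof -
      have "2 / R \<le> 2 / 1" using R by (intro divide_left_mono) auto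
      then have "\<bar>P1 s\<bar> \<le> 2 / 1" using P1 by linarith
      then have q: "\<bar>P1 s\<bar> * \<bar>P1 s\<bar> \<le> 2 / R * (2 / 1)" using P1 R by (intro mult_mono) auto
      have "max 0 (P s) * (\<bar>P1 s\<bar> * \<bar>P1 s\<bar>) \<le> 1 * (2 / R * (2 / 1))"
        by (rule mult_mono[OF cut_arg(2) q]) auto
      then show ?thesis by (rule mult_left_mono) simp
    qed
    finally have 3: "\<bar>3 * (2 * max 0 (P s) * P1 s) * P1 s\<bar> \<le> 24 / R" by simp
    have "\<bar>c2 s\<bar> \<le> 12 / R + 24 / R" unfolding c2_def using 2 3 by linarith
    then show ?thesis using 1 by simp
  qed
  show ?thesis using d1 d2 bd by blast
qed

section \<open>Second derivatives of cut-off waves along horizontal curves\<close>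

lemma second_deriv_eq:
  assumes "\<And>s. (u has_real_derivative u1 s) (at s)" "(u1 has_real_derivative u2) (at 0)"
  shows "(deriv ^^ 2) u 0 = u2"
proof -
  have "deriv u = u1" using DERIV_imp_deriv[OF assms(1)] by (rule ext)
  then show ?thesis using DERIV_imp_deriv[OF assms(2)] by (simp add: numeral_2_eq_2)
qed

lemma has_derivative_second_product:
  assumes "\<And>s. (c has_real_derivative c1 s) (at s)" "\<And>s. (c1 has_real_derivative c2 s) (at s)"
    and "\<And>s. (h has_real_derivative h1 s) (at s)" "\<And>s. (h1 has_real_derivative h2 s) (at s)"
  shows "(deriv ^^ 2) (\<lambda>s. c s * h s) 0 = c2 0 * h 0 + 2 * c1 0 * h1 0 + c 0 * h2 0"
proof (rule second_deriv_eq)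
  show "((\<lambda>s. c s * h s) has_real_derivative c1 s * h s + h1 s * c s) (at s)" for s
    by (rule DERIV_mult[OF assms(1,3)])
  show "((\<lambda>s. c1 s * h s + h1 s * c s) has_real_derivative c2 0 * h 0 + 2 * c1 0 * h1 0 + c 0 * h2 0) (at 0)"
    using DERIV_add[OF DERIV_mult[OF assms(2,3)] DERIV_mult[OF assms(4,1)], of 0]
    by (simp add: algebra_simps)
qed

lemma exp_iw_v: "iw_q g > 0 \<Longrightarrow> exp (iw_v g) = 1 / iw_q g"
  by (simp add: iw_v_def exp_minus divide_inverse)

lemma iw_w_exp: "iw_q g > 0 \<Longrightarrow> iw_w g = Complex (g$2$2) (g$2$1) * of_real (exp (iw_v g / 2))"
proof -
  assume q: "iw_q g > 0"
  have "exp (iw_v g / 2) = inverse (exp (ln (iw_q g) / 2))"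
    unfolding iw_v_def exp_minus[symmetric] by simp
  also have "exp (ln (iw_q g) / 2) = sqrt (iw_q g)"
    using exp_ln[of "sqrt (iw_q g)"] ln_sqrt[of "iw_q g"] q by simp
  finally have e: "exp (iw_v g / 2) = inverse (sqrt (iw_q g))" .
  show ?thesis unfolding iw_w_def e by (simp only: divide_inverse of_real_inverse)
qed

text \<open>In the product rule, the terms that differentiate the cut-off contain only the wave and
  its first derivative and carry a factor \<open>1 / R\<close>; the assumption on \<open>B\<close>
  controls exactly these two. The principal term keeps the cut-off undifferentiated.\<close>

lemma horizontal_curve:
  fixes \<gamma> :: "real \<Rightarrow> mat2" and C D C1 D1 n n1 a b N1 :: "real \<Rightarrow> real"
    and p :: real and m :: int and F :: "complex \<Rightarrow> complex"
  assumes \<gamma>: "\<And>s. \<gamma> s$2$1 = C s" "\<And>s. \<gamma> s$2$2 = D s" "\<And>s. \<gamma> s$1$1 * C s + \<gamma> s$1$2 * D s = n s"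
    and q: "\<And>s. (C s)\<^sup>2 + (D s)\<^sup>2 > 0" and det: "\<And>s. det (\<gamma> s) = 1"
    and d: "\<And>s. (C has_real_derivative C1 s) (at s)" "\<And>s. (D has_real_derivative D1 s) (at s)"
           "\<And>s. (n has_real_derivative n1 s) (at s)"
           "\<And>s. (a has_real_derivative a s * b s) (at s)" "\<And>s. (b has_real_derivative - (a s)\<^sup>2) (at s)"
           "\<And>s. ((\<lambda>s. sq_norm (\<gamma> s)) has_real_derivative N1 s) (at s)" "\<And>s. (N1 has_real_derivative sq_norm (\<gamma> s)) (at s)"
    and rel: "\<And>s. b s * D s + 2 * D1 s = - a s * C s" "\<And>s. b s * C s + 2 * C1 s = a s * D s"
             "\<And>s. n1 s + n s * b s = a s"
    and N1: "\<And>s. \<bar>N1 s\<bar> \<le> sq_norm (\<gamma> s)"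
    and ab: "\<bar>a 0\<bar> \<le> 1" "\<bar>b 0\<bar> \<le> 1"
    and F: "F holomorphic_on strip r" "r > 0" and R: "R \<ge> 1"
  defines "v \<equiv> complex_of_real (iw_v (\<gamma> 0))"
  defines "Q \<equiv> of_real p * exp v + of_int m / 2"
  assumes B: "norm (F v) + norm (Q * F v) + norm (deriv F v) \<le> B"
  shows "\<bar>(deriv ^^ 2) (\<lambda>s. cut_wave R p m F (\<gamma> s)) 0
     - pos_cube (cut_arg R (\<gamma> 0)) * Re (cis (p * iw_x (\<gamma> 0)) * iw_w (\<gamma> 0) powi m *
            (- Q\<^sup>2 * of_real ((a 0)\<^sup>2) * F v
               + 2 * \<i> * Q * of_real (a 0 * b 0) * deriv F v
               + \<i> * (of_real p * exp v + Q) * of_real (a 0 * b 0) * F v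
               - of_real ((a 0)\<^sup>2) * deriv F v + of_real ((b 0)\<^sup>2) * deriv (deriv F) v))\<bar> \<le> 36 * B / R"
proof -
  have iw_q: "iw_q (\<gamma> s) = (C s)\<^sup>2 + (D s)\<^sup>2" for s by (simp add: iw_q_def \<gamma>)
  have qp: "iw_q (\<gamma> s) > 0" for s using q by (simp add: iw_q)
  have dq: "((\<lambda>s. iw_q (\<gamma> s)) has_real_derivative - b s * iw_q (\<gamma> s)) (at s)" for s
  proof -
    have "((\<lambda>s. (C s)\<^sup>2 + (D s)\<^sup>2) has_real_derivative 2 * C s * C1 s + 2 * D s * D1 s) (at s)"
      by (rule derivative_eq_intros d refl | simp)+
    moreover have "2 * C s * C1 s + 2 * D s * D1 s = - b s * ((C s)\<^sup>2 + (D s)\<^sup>2)"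
    proof -
      have "2 * D1 s = - a s * C s - b s * D s" "2 * C1 s = a s * D s - b s * C s"
        using rel(1,2)[of s] by linarith+
      then have "C s * (2 * C1 s) + D s * (2 * D1 s) = C s * (a s * D s - b s * C s) + D s * (- a s * C s - b s * D s)"
        by simp
      then show ?thesis by (simp add: power2_eq_square algebra_simps)
    qed
    ultimately show ?thesis by (simp add: iw_q)
  qed
  have dv: "((\<lambda>s. iw_v (\<gamma> s)) has_real_derivative b s) (at s)" for s
  proof -
    have "((\<lambda>s. - ln (iw_q (\<gamma> s))) has_real_derivative - (1 / iw_q (\<gamma> s) * (- b s * iw_q (\<gamma> s)))) (at s)"
      by (intro DERIV_minus DERIV_chain2[OF DERIV_ln_divide[OF qp] dq])
    then show ?thesis using qp[of s] by (simp add: iw_v_def[abs_def])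
  qed
  have dx: "((\<lambda>s. iw_x (\<gamma> s)) has_real_derivative exp (iw_v (\<gamma> s)) * a s) (at s)" for s
  proof -
    have "((\<lambda>s. n s / iw_q (\<gamma> s)) has_real_derivative (n1 s * iw_q (\<gamma> s) - n s * (- b s * iw_q (\<gamma> s))) / (iw_q (\<gamma> s) * iw_q (\<gamma> s))) (at s)"
      using qp[of s] by (intro DERIV_divide d dq) simp
    moreover have "(n1 s * iw_q (\<gamma> s) - n s * (- b s * iw_q (\<gamma> s))) / (iw_q (\<gamma> s) * iw_q (\<gamma> s)) = exp (iw_v (\<gamma> s)) * a s"
      using qp[of s] rel(3)[of s, symmetric] by (simp add: exp_iw_v field_simps)
    ultimately show ?thesis by (simp add: iw_x_def[abs_def] \<gamma>)
  qed
  have dw: "((\<lambda>s. iw_w (\<gamma> s)) has_vector_derivative \<i> * of_real (a s / 2) * iw_w (\<gamma> s)) (at s)" for s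
  proof -
    have u: "((\<lambda>s. of_real (D s) + \<i> * of_real (C s)) has_vector_derivative of_real (D1 s) + \<i> * of_real (C1 s)) (at s)"
      using d(1,2) by (intro has_vector_derivative_add has_vector_derivative_mult_right has_vector_derivative_of_real)
        (simp_all add: has_real_derivative_iff_has_vector_derivative)
    have "((\<lambda>s. exp (iw_v (\<gamma> s) / 2)) has_real_derivative exp (iw_v (\<gamma> s) / 2) * (b s / 2)) (at s)"
      by (rule DERIV_chain2[OF DERIV_exp DERIV_cdivide[OF dv]])
    then have e: "((\<lambda>s. complex_of_real (exp (iw_v (\<gamma> s) / 2))) has_vector_derivative of_real (exp (iw_v (\<gamma> s) / 2) * (b s / 2))) (at s)"
      by (intro has_vector_derivative_of_real) (simp add: has_real_derivative_iff_has_vector_derivative)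
    have iw_w: "iw_w (\<gamma> s) = (of_real (D s) + \<i> * of_real (C s)) * of_real (exp (iw_v (\<gamma> s) / 2))" for s
      using iw_w_exp[OF qp] by (simp add: \<gamma> Complex_eq)
    have D1: "D1 s = - (a s * C s + b s * D s) / 2" and C1: "C1 s = (a s * D s - b s * C s) / 2"
      using rel(1,2)[of s] by (simp_all add: field_simps)
    show ?thesis unfolding iw_w
      by (rule has_vector_derivative_eq_rhs[OF has_vector_derivative_mult[OF u e]])
         (simp add: D1 C1 complex_eq_iff field_simps)
  qed
  have w0: "iw_w (\<gamma> s) \<noteq> 0" for s using norm_iw_w[OF qp[of s]] by auto
  have F': "(F has_field_derivative deriv F (of_real t)) (at (of_real t))"
           "(deriv F has_field_derivative deriv (deriv F) (of_real t)) (at (of_real t))" for t :: real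
    using F open_strip of_real_strip by (auto intro!: holomorphic_derivI holomorphic_deriv)
  define E where "E s = cis (p * iw_x (\<gamma> s)) * iw_w (\<gamma> s) powi m" for s
  define QQ where "QQ s = of_real p * exp (complex_of_real (iw_v (\<gamma> s))) + of_int m / 2" for s
  define H1 where "H1 s = E s * (\<i> * QQ s * of_real (a s) * F (of_real (iw_v (\<gamma> s))) + of_real (b s) * deriv F (of_real (iw_v (\<gamma> s))))" for s
  define H2 where "H2 s = E s * (- (QQ s)\<^sup>2 * of_real ((a s)\<^sup>2) * F (of_real (iw_v (\<gamma> s)))
               + 2 * \<i> * QQ s * of_real (a s * b s) * deriv F (of_real (iw_v (\<gamma> s)))
               + \<i> * (of_real p * exp (of_real (iw_v (\<gamma> s))) + QQ s) * of_real (a s * b s) * F (of_real (iw_v (\<gamma> s)))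
               - of_real ((a s)\<^sup>2) * deriv F (of_real (iw_v (\<gamma> s))) + of_real ((b s)\<^sup>2) * deriv (deriv F) (of_real (iw_v (\<gamma> s))))" for s
  note cs = curve_second[where x="\<lambda>s. iw_x (\<gamma> s)" and v="\<lambda>s. iw_v (\<gamma> s)" and w="\<lambda>s. iw_w (\<gamma> s)" and a=a and b=b
     and F=F and ?F1.0="deriv F" and ?F2.0="deriv (deriv F)" and p=p and m=m, OF dx dv dw w0 d(4,5) F']
  have dH: "((\<lambda>s. wave p m F (\<gamma> s)) has_vector_derivative H1 s) (at s)" for s
    using cs(1)[of s] unfolding wave_def H1_def E_def QQ_def .
  have dH1: "(H1 has_vector_derivative H2 s) (at s)" for s
    using cs(2)[of s] unfolding H1_def[abs_def] H2_def E_def QQ_def .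
  have dh: "((\<lambda>s. Re (wave p m F (\<gamma> s))) has_real_derivative Re (H1 s)) (at s)" for s
    using bounded_linear.has_vector_derivative[OF bounded_linear_Re dH]
    by (simp add: has_real_derivative_iff_has_vector_derivative)
  have dh1: "((\<lambda>s. Re (H1 s)) has_real_derivative Re (H2 s)) (at s)" for s
    using bounded_linear.has_vector_derivative[OF bounded_linear_Re dH1]
    by (simp add: has_real_derivative_iff_has_vector_derivative)
  obtain c1 c2 where c: "\<And>s. ((\<lambda>s. pos_cube (1 - (ln (1 + sq_norm (\<gamma> s)) / R)\<^sup>2)) has_real_derivative c1 s) (at s)"
     "\<And>s. (c1 has_real_derivative c2 s) (at s)" "\<And>s. \<bar>c1 s\<bar> \<le> 6 / R \<and> \<bar>c2 s\<bar> \<le> 36 / R"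
    using cutoff_curve[OF d(6,7) N1 R] by blast
  have cut_arg: "cut_arg R (\<gamma> s) = 1 - (ln (1 + sq_norm (\<gamma> s)) / R)\<^sup>2" for s
    by (simp add: cut_arg_def det)
  have eq: "(deriv ^^ 2) (\<lambda>s. cut_wave R p m F (\<gamma> s)) 0 =
      c2 0 * Re (wave p m F (\<gamma> 0)) + 2 * c1 0 * Re (H1 0) + pos_cube (cut_arg R (\<gamma> 0)) * Re (H2 0)"
    using has_derivative_second_product[OF c(1,2) dh dh1] by (simp add: cut_wave_def cut_arg)
  have E0: "norm (E 0) = 1"
    using norm_iw_w[OF qp] by (simp add: E_def norm_mult norm_power_int)
  have bF: "\<bar>Re (wave p m F (\<gamma> 0))\<bar> \<le> norm (F v)"
    using abs_Re_le_cmod[of "wave p m F (\<gamma> 0)"] E0 by (simp add: wave_def E_def norm_mult v_def)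
  have bH1: "\<bar>Re (H1 0)\<bar> \<le> norm (Q * F v) + norm (deriv F v)"
  proof -
    have "\<bar>Re (H1 0)\<bar> \<le> norm (\<i> * Q * of_real (a 0) * F v + of_real (b 0) * deriv F v)"
      using abs_Re_le_cmod[of "H1 0"] E0 by (simp add: H1_def norm_mult v_def Q_def QQ_def)
    also have "\<dots> \<le> \<bar>a 0\<bar> * norm (Q * F v) + \<bar>b 0\<bar> * norm (deriv F v)"
      by (rule order_trans[OF norm_triangle_ineq]) (simp add: norm_mult)
    also have "\<dots> \<le> 1 * norm (Q * F v) + 1 * norm (deriv F v)"
      using ab by (intro add_mono mult_mono) auto
    finally show ?thesis by simp
  qed
  have "\<bar>c2 0 * Re (wave p m F (\<gamma> 0)) + 2 * c1 0 * Re (H1 0)\<bar> \<le>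
      \<bar>c2 0\<bar> * \<bar>Re (wave p m F (\<gamma> 0))\<bar> + 2 * \<bar>c1 0\<bar> * \<bar>Re (H1 0)\<bar>"
    by (rule order_trans[OF abs_triangle_ineq]) (simp add: abs_mult)
  also have "\<dots> \<le> 36 / R * norm (F v) + 2 * (6 / R) * (norm (Q * F v) + norm (deriv F v))"
    using c(3)[of 0] bF bH1 R by (intro add_mono mult_mono) auto
  also have "\<dots> \<le> 36 / R * norm (F v) + 36 / R * (norm (Q * F v) + norm (deriv F v))"
    using R by (intro add_mono mult_right_mono) (auto simp: divide_right_mono)
  also have "\<dots> = 36 / R * (norm (F v) + norm (Q * F v) + norm (deriv F v))" by (simp add: algebra_simps)
  also have "\<dots> \<le> 36 / R * B" using B R by (intro mult_left_mono) auto
  finally have fin: "\<bar>c2 0 * Re (wave p m F (\<gamma> 0)) + 2 * c1 0 * Re (H1 0)\<bar> \<le> 36 * B / R" by simp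
  show ?thesis
    using fin unfolding eq H2_def E_def v_def Q_def QQ_def by simp
qed

lemma quotient_deriv:
  assumes "(u has_real_derivative u1) (at s)" "(q has_real_derivative - b * q s) (at s)" "q s > 0"
  shows "((\<lambda>s. u s / q s) has_real_derivative u1 / q s + u s / q s * b) (at s)"
proof -
  have "((\<lambda>s. u s / q s) has_real_derivative (u1 * q s - u s * (- b * q s)) / (q s * q s)) (at s)"
    using assms(3) by (intro DERIV_divide assms) simp
  then show ?thesis by (rule DERIV_cong) (use assms(3) in \<open>simp add: field_simps\<close>)
qed

lemma sq_pos_of_det: "A * D - B * C = 1 \<Longrightarrow> C\<^sup>2 + D\<^sup>2 > (0::real)"
  by (metis diff_zero mult_zero_right sum_power2_gt_zero_iff zero_neq_one)

text \<open>The two quotients are the cosine and the sine of twice the argument of the complex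
  number \<open>D + i C\<close>, that is, of twice the fibre angle.\<close>

lemma cos_sin_double_id:
  fixes C D :: real
  assumes "C\<^sup>2 + D\<^sup>2 > 0"
  shows "((D\<^sup>2 - C\<^sup>2) / (C\<^sup>2 + D\<^sup>2))\<^sup>2 + (2 * C * D / (C\<^sup>2 + D\<^sup>2))\<^sup>2 = 1"
proof -
  have "(D\<^sup>2 - C\<^sup>2)\<^sup>2 + (2 * C * D)\<^sup>2 = (C\<^sup>2 + D\<^sup>2)\<^sup>2"
    by (simp add: power2_eq_square algebra_simps)
  then show ?thesis using assms by (auto simp: power_divide add_divide_distrib[symmetric])
qed

text \<open>Second derivative of the wave along an integral curve of a horizontal field whose components in the
  \<open>x\<close> and \<open>v\<close> directions are \<open>e\<^sup>v a\<close> and \<open>b\<close>.\<close>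

definition wave_second :: "real \<Rightarrow> int \<Rightarrow> (complex \<Rightarrow> complex) \<Rightarrow> mat2 \<Rightarrow> real \<Rightarrow> real \<Rightarrow> complex" where
  "wave_second p m F g a b = (let v = complex_of_real (iw_v g); Q = of_real p * exp v + of_int m / 2 in
     cis (p * iw_x g) * iw_w g powi m *
            (- Q\<^sup>2 * of_real (a\<^sup>2) * F v
               + 2 * \<i> * Q * of_real (a * b) * deriv F v
               + \<i> * (of_real p * exp v + Q) * of_real (a * b) * F v
               - of_real (a\<^sup>2) * deriv F v + of_real (b\<^sup>2) * deriv (deriv F) v))"

text \<open>The curves are integral curves of the left-invariant field of \<open>\<sigma>X + \<tau>Y\<close>.\<close>

lemma horizontal_curve_direction:
  fixes \<gamma> :: "real \<Rightarrow> mat2" and A B C D :: "real \<Rightarrow> real"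
    and p \<sigma> \<tau> :: real and m :: int and F :: "complex \<Rightarrow> complex"
  assumes \<gamma>: "\<And>s. \<gamma> s$1$1 = A s" "\<And>s. \<gamma> s$1$2 = B s" "\<And>s. \<gamma> s$2$1 = C s" "\<And>s. \<gamma> s$2$2 = D s"
    and \<sigma>\<tau>: "\<sigma>\<^sup>2 + \<tau>\<^sup>2 = 1"
    and d: "\<And>s. (A has_real_derivative (\<sigma> * A s + \<tau> * B s) / 2) (at s)" "\<And>s. (B has_real_derivative (\<tau> * A s - \<sigma> * B s) / 2) (at s)"
     "\<And>s. (C has_real_derivative (\<sigma> * C s + \<tau> * D s) / 2) (at s)" "\<And>s. (D has_real_derivative (\<tau> * C s - \<sigma> * D s) / 2) (at s)"
    and det1: "\<And>s. A s * D s - B s * C s = 1"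
    and F: "F holomorphic_on strip r" "r > 0" and R: "R \<ge> 1"
    and B: "norm (F (of_real (iw_v (\<gamma> 0)))) + norm ((of_real p * exp (of_real (iw_v (\<gamma> 0))) + of_int m / 2) * F (of_real (iw_v (\<gamma> 0))))
      + norm (deriv F (of_real (iw_v (\<gamma> 0)))) \<le> Bd"
  shows "\<bar>(deriv ^^ 2) (\<lambda>s. cut_wave R p m F (\<gamma> s)) 0 - pos_cube (cut_arg R (\<gamma> 0)) *
     Re (wave_second p m F (\<gamma> 0) ((\<sigma> * (2 * C 0 * D 0) + \<tau> * ((D 0)\<^sup>2 - (C 0)\<^sup>2)) / ((C 0)\<^sup>2 + (D 0)\<^sup>2))
       ((\<sigma> * ((D 0)\<^sup>2 - (C 0)\<^sup>2) - \<tau> * (2 * C 0 * D 0)) / ((C 0)\<^sup>2 + (D 0)\<^sup>2)))\<bar> \<le> 36 * Bd / R"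
proof -
  define q where "q s = (C s)\<^sup>2 + (D s)\<^sup>2" for s
  \<comment> \<open>The isotropy group acts on horizontal directions through the double angle:
    \<open>(b s, a s)\<close> is \<open>(\<sigma>, \<tau>)\<close> rotated by twice the argument of
    \<open>D s + i C s\<close>.\<close>
  define a where "a s = (\<sigma> * (2 * C s * D s) + \<tau> * ((D s)\<^sup>2 - (C s)\<^sup>2)) / q s" for s
  define b where "b s = (\<sigma> * ((D s)\<^sup>2 - (C s)\<^sup>2) - \<tau> * (2 * C s * D s)) / q s" for s
  define n where "n s = A s * C s + B s * D s" for s
  have q: "q s > 0" for s unfolding q_def by (rule sq_pos_of_det[OF det1])
  then have qn: "q s \<noteq> 0" for s by (metis less_irrefl)
  have bq: "b s * q s = \<sigma> * ((D s)\<^sup>2 - (C s)\<^sup>2) - \<tau> * (2 * C s * D s)" for s using qn[of s] by (simp add: b_def)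
  have aq: "a s * q s = \<sigma> * (2 * C s * D s) + \<tau> * ((D s)\<^sup>2 - (C s)\<^sup>2)" for s using qn[of s] by (simp add: a_def)
  have rot: "(\<sigma> * x - \<tau> * y)\<^sup>2 + (\<sigma> * y + \<tau> * x)\<^sup>2 = x\<^sup>2 + y\<^sup>2" for x y
  proof -
    have "(\<sigma> * x - \<tau> * y)\<^sup>2 + (\<sigma> * y + \<tau> * x)\<^sup>2 = (\<sigma>\<^sup>2 + \<tau>\<^sup>2) * (x\<^sup>2 + y\<^sup>2)"
      by (simp add: power2_eq_square algebra_simps)
    then show ?thesis by (simp only: \<sigma>\<tau> mult_1_left)
  qed
  have ab: "(b s)\<^sup>2 + (a s)\<^sup>2 = 1" for s
  proof -
    have "b s = \<sigma> * (((D s)\<^sup>2 - (C s)\<^sup>2) / q s) - \<tau> * (2 * C s * D s / q s)"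
      unfolding b_def by (subst diff_divide_distrib) (simp only: times_divide_eq_right)
    moreover have "a s = \<sigma> * (2 * C s * D s / q s) + \<tau> * (((D s)\<^sup>2 - (C s)\<^sup>2) / q s)"
      unfolding a_def by (subst add_divide_distrib) (simp only: times_divide_eq_right)
    ultimately show ?thesis using cos_sin_double_id[OF q[of s, unfolded q_def]] by (simp only: rot q_def)
  qed
  have dq: "(q has_real_derivative - b s * q s) (at s)" for s
  proof -
    have "(q has_real_derivative 2 * C s * ((\<sigma> * C s + \<tau> * D s) / 2) + 2 * D s * ((\<tau> * C s - \<sigma> * D s) / 2)) (at s)"
      unfolding q_def by (rule derivative_eq_intros d refl | simp)+
    then show ?thesis
      by (rule DERIV_cong) (simp only: mult_minus_left bq, simp add: power2_eq_square field_simps)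
  qed
  have da: "(a has_real_derivative a s * b s) (at s)" for s
  proof -
    have "((\<lambda>s. \<sigma> * (2 * C s * D s) + \<tau> * ((D s)\<^sup>2 - (C s)\<^sup>2)) has_real_derivative 0) (at s)"
      by (rule derivative_eq_intros d refl)+ (simp add: power2_eq_square field_simps)
    from quotient_deriv[OF this dq q] show ?thesis by (simp add: a_def[abs_def])
  qed
  have db: "(b has_real_derivative - (a s)\<^sup>2) (at s)" for s
  proof -
    have "((\<lambda>s. \<sigma> * ((D s)\<^sup>2 - (C s)\<^sup>2) - \<tau> * (2 * C s * D s)) has_real_derivative - ((\<sigma>\<^sup>2 + \<tau>\<^sup>2) * q s)) (at s)"
      unfolding q_def by (rule derivative_eq_intros d refl)+ (simp add: power2_eq_square field_simps)
    then have "((\<lambda>s. \<sigma> * ((D s)\<^sup>2 - (C s)\<^sup>2) - \<tau> * (2 * C s * D s)) has_real_derivative - q s) (at s)" by (simp only: \<sigma>\<tau> mult_1_left)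
    from quotient_deriv[OF this dq q]
    have "(b has_real_derivative - q s / q s + b s * b s) (at s)" by (simp add: b_def[abs_def])
    moreover have "- q s / q s + b s * b s = - (a s)\<^sup>2" using q[of s] ab[of s] by (simp add: power2_eq_square)
    ultimately show ?thesis by simp
  qed
  have dn: "(n has_real_derivative \<sigma> * (A s * C s - B s * D s) + \<tau> * (A s * D s + B s * C s)) (at s)" for s
    unfolding n_def by (rule derivative_eq_intros d refl)+ (simp add: field_simps)
  have rel: "b s * D s + 2 * ((\<tau> * C s - \<sigma> * D s) / 2) = - a s * C s" "b s * C s + 2 * ((\<sigma> * C s + \<tau> * D s) / 2) = a s * D s"
    "(\<sigma> * (A s * C s - B s * D s) + \<tau> * (A s * D s + B s * C s)) + n s * b s = a s" for s
  proof -
    have half: "2 * (z / 2) = z" for z :: real by simp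
    have "(b s * D s + (\<tau> * C s - \<sigma> * D s)) * q s = (- a s * C s) * q s"
      using bq[of s] aq[of s] unfolding q_def by algebra
    then show "b s * D s + 2 * ((\<tau> * C s - \<sigma> * D s) / 2) = - a s * C s" by (simp only: mult_right_cancel[OF qn] half)
    have "(b s * C s + (\<sigma> * C s + \<tau> * D s)) * q s = (a s * D s) * q s"
      using bq[of s] aq[of s] unfolding q_def by algebra
    then show "b s * C s + 2 * ((\<sigma> * C s + \<tau> * D s) / 2) = a s * D s" by (simp only: mult_right_cancel[OF qn] half)
    have "((\<sigma> * (A s * C s - B s * D s) + \<tau> * (A s * D s + B s * C s)) + n s * b s) * q s = a s * q s"
      using bq[of s] aq[of s] det1[of s] unfolding q_def n_def by algebra
    then show "(\<sigma> * (A s * C s - B s * D s) + \<tau> * (A s * D s + B s * C s)) + n s * b s = a s"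
      by (simp only: mult_right_cancel[OF qn])
  qed
  have sq_norm: "sq_norm (\<gamma> s) = ((A s)\<^sup>2 + (B s)\<^sup>2) + ((C s)\<^sup>2 + (D s)\<^sup>2)" for s by (simp add: sq_norm_def \<gamma>)
  define N1 where "N1 s = (\<sigma> * ((A s)\<^sup>2 - (B s)\<^sup>2) + \<tau> * (2 * A s * B s)) + (\<sigma> * ((C s)\<^sup>2 - (D s)\<^sup>2) + \<tau> * (2 * C s * D s))" for s
  have dN: "((\<lambda>s. sq_norm (\<gamma> s)) has_real_derivative N1 s) (at s)" for s
    unfolding N1_def sq_norm by (rule derivative_eq_intros d refl)+ (simp add: power2_eq_square field_simps)
  have dN1: "(N1 has_real_derivative sq_norm (\<gamma> s)) (at s)" for s
  proof -
    have "(N1 has_real_derivative (\<sigma>\<^sup>2 + \<tau>\<^sup>2) * (((A s)\<^sup>2 + (B s)\<^sup>2) + ((C s)\<^sup>2 + (D s)\<^sup>2))) (at s)"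
      unfolding N1_def by (rule derivative_eq_intros d refl)+ (simp add: power2_eq_square field_simps)
    then show ?thesis by (simp only: \<sigma>\<tau> mult_1_left sq_norm)
  qed
  have rotb: "\<bar>\<sigma> * (x\<^sup>2 - y\<^sup>2) + \<tau> * (2 * x * y)\<bar> \<le> x\<^sup>2 + y\<^sup>2" for x y
  proof (rule power2_le_imp_le)
    have "(\<sigma> * (x\<^sup>2 - y\<^sup>2) + \<tau> * (2 * x * y))\<^sup>2 \<le> (2 * x * y)\<^sup>2 + (x\<^sup>2 - y\<^sup>2)\<^sup>2"
      using rot[of "2 * x * y" "x\<^sup>2 - y\<^sup>2"] by (smt (verit) zero_le_power2)
    also have "\<dots> = (x\<^sup>2 + y\<^sup>2)\<^sup>2" by (simp add: power2_eq_square algebra_simps)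
    finally show "\<bar>\<sigma> * (x\<^sup>2 - y\<^sup>2) + \<tau> * (2 * x * y)\<bar>\<^sup>2 \<le> (x\<^sup>2 + y\<^sup>2)\<^sup>2" by simp
  qed simp
  have N1b: "\<bar>N1 s\<bar> \<le> sq_norm (\<gamma> s)" for s
    unfolding N1_def sq_norm using rotb[of "A s" "B s"] rotb[of "C s" "D s"] by linarith
  have ab0: "\<bar>a 0\<bar> \<le> 1" "\<bar>b 0\<bar> \<le> 1"
    using ab[of 0] by (auto simp flip: abs_square_le_1) (smt (verit) zero_le_power2)+
  have "\<gamma> s$1$1 * C s + \<gamma> s$1$2 * D s = n s" for s by (simp add: \<gamma> n_def)
  moreover have "det (\<gamma> s) = 1" for s using det1[of s] by (simp add: det_2 \<gamma>)
  ultimately show ?thesis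
    using horizontal_curve[of \<gamma> C D n _ _ _ a b N1 F r R p m Bd,
       OF \<gamma>(3,4) _ _ _ d(3,4) dn da db dN dN1 rel N1b ab0 F R B] q
    unfolding wave_second_def Let_def by (simp only: q_def[of 0, symmetric] a_def[of 0, symmetric] b_def[of 0, symmetric]) (simp add: q_def)
qed

text \<open>The components \<open>(a, b)\<close> are \<open>(\<delta>, \<kappa>)\<close> for
  \<open>X\<close> and \<open>(\<kappa>, - \<delta>)\<close> for \<open>Y\<close>. In the sum of the
  two second derivatives the products \<open>a * b\<close> cancel and each of the two sums of
  squares is 1, which leaves twice \<open>gen_op\<close>.\<close>

lemma subLap_cut_wave:
  assumes g: "g \<in> SL2" and F: "F holomorphic_on strip r" "r > 0" and R: "R \<ge> 1"
    and B: "norm (F (of_real (iw_v g))) + norm ((of_real p * exp (of_real (iw_v g)) + of_int m / 2) * F (of_real (iw_v g)))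
      + norm (deriv F (of_real (iw_v g))) \<le> Bd"
  shows "\<bar>subLap (cut_wave R p m F) g / 2 - pos_cube (cut_arg R g) * Re (wave p m (gen_op p m F) g)\<bar> \<le> 36 * Bd / R"
proof -
  have det: "g$1$1 * g$2$2 - g$1$2 * g$2$1 = 1" using g by (simp add: SL2_def det_2)
  have g0: "g ** expX 0 = g" "g ** expY 0 = g"
    by (simp_all add: vec_eq_iff forall_2 matrix_matrix_mult_def sum_2 expX_def expY_def)
  define \<delta> where "\<delta> = 2 * g$2$1 * g$2$2 / ((g$2$1)\<^sup>2 + (g$2$2)\<^sup>2)"
  define \<kappa> where "\<kappa> = ((g$2$2)\<^sup>2 - (g$2$1)\<^sup>2) / ((g$2$1)\<^sup>2 + (g$2$2)\<^sup>2)"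
  have X: "\<bar>(deriv ^^ 2) (\<lambda>s. cut_wave R p m F (g ** expX s)) 0 - pos_cube (cut_arg R g) * Re (wave_second p m F g \<delta> \<kappa>)\<bar> \<le> 36 * Bd / R"
  proof -
    have det': "g$1$1 * exp (s/2) * (g$2$2 * exp (-(s/2))) - g$1$2 * exp (-(s/2)) * (g$2$1 * exp (s/2)) = 1" for s
    proof -
      have "exp (s/2) * exp (-(s/2)) = 1" by (simp add: exp_minus)
      then show ?thesis using det by algebra
    qed
    have ent: "(g ** expX s)$1$1 = g$1$1 * exp (s/2)" "(g ** expX s)$1$2 = g$1$2 * exp (-(s/2))"
      "(g ** expX s)$2$1 = g$2$1 * exp (s/2)" "(g ** expX s)$2$2 = g$2$2 * exp (-(s/2))" for s
      by (simp_all add: matrix_matrix_mult_def sum_2 expX_def)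
    have d: "((\<lambda>s. c * exp (s/2)) has_real_derivative (1 * (c * exp (s/2)) + 0 * y) / 2) (at s)"
      "((\<lambda>s. c * exp (-(s/2))) has_real_derivative (0 * y - 1 * (c * exp (-(s/2)))) / 2) (at s)" for c s y :: real
      by (auto intro!: derivative_eq_intros)
    show ?thesis
      using horizontal_curve_direction[where \<gamma>="\<lambda>s. g ** expX s" and \<sigma>=1 and \<tau>=0 and p=p and m=m and Bd=Bd, OF ent _ d(1) d(2) d(1) d(2) det' F R] B
      unfolding \<delta>_def \<kappa>_def by (simp add: g0)
  qed
  have Y: "\<bar>(deriv ^^ 2) (\<lambda>s. cut_wave R p m F (g ** expY s)) 0 - pos_cube (cut_arg R g) * Re (wave_second p m F g \<kappa> (- \<delta>))\<bar> \<le> 36 * Bd / R"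
  proof -
    have det': "(g$1$1 * cosh (s/2) + g$1$2 * sinh (s/2)) * (g$2$1 * sinh (s/2) + g$2$2 * cosh (s/2))
       - (g$1$1 * sinh (s/2) + g$1$2 * cosh (s/2)) * (g$2$1 * cosh (s/2) + g$2$2 * sinh (s/2)) = 1" for s
    proof -
      have "(a * x + b * y) * (c * y + d * x) - (a * y + b * x) * (c * x + d * y) = (a * d - b * c) * (x\<^sup>2 - y\<^sup>2)"
        for a b c d x y :: real by (simp add: power2_eq_square algebra_simps)
      then show ?thesis by (simp only: det hyperbolic_pythagoras)
    qed
    have ent: "(g ** expY s)$1$1 = g$1$1 * cosh (s/2) + g$1$2 * sinh (s/2)"
      "(g ** expY s)$1$2 = g$1$1 * sinh (s/2) + g$1$2 * cosh (s/2)"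
      "(g ** expY s)$2$1 = g$2$1 * cosh (s/2) + g$2$2 * sinh (s/2)"
      "(g ** expY s)$2$2 = g$2$1 * sinh (s/2) + g$2$2 * cosh (s/2)" for s
      by (simp_all add: matrix_matrix_mult_def sum_2 expY_def)
    have d: "((\<lambda>s. c * cosh (s/2) + d * sinh (s/2)) has_real_derivative (0 * y + 1 * (c * sinh (s/2) + d * cosh (s/2))) / 2) (at s)"
      "((\<lambda>s. c * sinh (s/2) + d * cosh (s/2)) has_real_derivative (1 * (c * cosh (s/2) + d * sinh (s/2)) - 0 * y) / 2) (at s)" for c d s y :: real
      by (auto intro!: derivative_eq_intros)
    show ?thesis
      using horizontal_curve_direction[where \<gamma>="\<lambda>s. g ** expY s" and \<sigma>=0 and \<tau>=1 and p=p and m=m and Bd=Bd, OF ent _ d(1) d(2) d(1) d(2) det' F R] B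
      unfolding \<delta>_def \<kappa>_def by (simp add: g0)
  qed
  have k: "\<kappa>\<^sup>2 = 1 - \<delta>\<^sup>2"
    using cos_sin_double_id[OF sq_pos_of_det[OF det]] by (simp add: \<delta>_def \<kappa>_def)
  have "wave_second p m F g \<delta> \<kappa> + wave_second p m F g \<kappa> (- \<delta>) = 2 * wave p m (gen_op p m F) g"
    unfolding wave_second_def Let_def wave_def gen_op_def power2_minus k
    by (simp add: of_real_diff field_simps)
  from arg_cong[OF this, of Re]
  have re: "Re (wave_second p m F g \<delta> \<kappa>) + Re (wave_second p m F g \<kappa> (- \<delta>)) = 2 * Re (wave p m (gen_op p m F) g)"
    by simp
  have *: "pos_cube (cut_arg R g) * Re (wave_second p m F g \<delta> \<kappa>) + pos_cube (cut_arg R g) * Re (wave_second p m F g \<kappa> (- \<delta>)) =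
      2 * (pos_cube (cut_arg R g) * Re (wave p m (gen_op p m F) g))"
    unfolding distrib_left[symmetric] re by simp
  have aux: "\<bar>x - a\<bar> \<le> e \<Longrightarrow> \<bar>y - b\<bar> \<le> e \<Longrightarrow> a + b = 2 * c \<Longrightarrow> \<bar>(x + y) / 2 - c\<bar> \<le> e"
    for x y a b c e :: real by argo
  show ?thesis unfolding subLap_def by (rule aux[OF X Y *])
qed

section \<open>Amplitudes bounded in a strip and the one-step operator\<close>

text \<open>The exponential weights absorb the factors \<open>e\<^sup>v\<close> in the coefficients of \<open>gen_op\<close>, two of them for each application.\<close>

definition strip_bd :: "real \<Rightarrow> nat \<Rightarrow> real \<Rightarrow> (complex \<Rightarrow> complex) \<Rightarrow> bool" where
  "strip_bd r A B F \<longleftrightarrow> F holomorphic_on strip r \<and> (\<forall>z\<in>strip r. \<forall>j\<le>A. norm (F z) * exp (real j * Re z) \<le> B)"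

lemma strip_bdI:
  assumes "F holomorphic_on strip r" "\<And>z j. z \<in> strip r \<Longrightarrow> j \<le> A \<Longrightarrow> norm (F z) * exp (real j * Re z) \<le> B"
  shows "strip_bd r A B F"
  using assms by (auto simp: strip_bd_def)

lemma strip_bdD:
  assumes "strip_bd r A B F"
  shows "F holomorphic_on strip r" "z \<in> strip r \<Longrightarrow> j \<le> A \<Longrightarrow> norm (F z) * exp (real j * Re z) \<le> B"
  using assms by (auto simp: strip_bd_def)

lemma strip_bd_nonneg: "strip_bd r A B F \<Longrightarrow> r > 0 \<Longrightarrow> B \<ge> 0"
  using strip_bdD(2)[of r A B F 0 0] by (auto simp: strip_def intro: order_trans[OF norm_ge_zero])

lemma strip_bd_bound: "strip_bd r A B F \<Longrightarrow> z \<in> strip r \<Longrightarrow> j \<le> A \<Longrightarrow> norm (F z) \<le> B * exp (- (real j * Re z))"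
  using strip_bdD(2)[of r A B F z j] by (simp add: exp_minus field_simps)

lemma strip_bd_mono: "strip_bd r A B F \<Longrightarrow> r' \<le> r \<Longrightarrow> A' \<le> A \<Longrightarrow> B \<le> B' \<Longrightarrow> strip_bd r' A' B' F"
  unfolding strip_bd_def strip_def
  by (auto elim!: holomorphic_on_subset) (meson le_trans order_less_le_trans order_trans)

lemma strip_bd_cmult: "strip_bd r A B F \<Longrightarrow> strip_bd r A (norm c * B) (\<lambda>z. c * F z)"
  by (rule strip_bdI) (auto intro!: holomorphic_intros mult_left_mono simp: strip_bd_def norm_mult mult.assoc)

lemma strip_bd_add: "strip_bd r A B F \<Longrightarrow> strip_bd r A B' G \<Longrightarrow> strip_bd r A (B + B') (\<lambda>z. F z + G z)"
proof (rule strip_bdI)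
  fix z j assume *: "strip_bd r A B F" "strip_bd r A B' G" "z \<in> strip r" "j \<le> A"
  have "norm (F z + G z) * exp (real j * Re z) \<le> (norm (F z) + norm (G z)) * exp (real j * Re z)"
    by (intro mult_right_mono norm_triangle_ineq) simp
  also have "\<dots> \<le> B + B'"
    using strip_bdD(2)[OF *(1,3,4)] strip_bdD(2)[OF *(2,3,4)] by (simp add: algebra_simps)
  finally show "norm (F z + G z) * exp (real j * Re z) \<le> B + B'" .
qed (auto intro!: holomorphic_intros simp: strip_bd_def)

lemma strip_bd_exp_mult:
  assumes "strip_bd r (Suc A) B F"
  shows "strip_bd r A B (\<lambda>z. exp z * F z)"
proof (rule strip_bdI)
  fix z j assume *: "z \<in> strip r" "j \<le> A"
  have "norm (F z) * exp (real (Suc j) * Re z) \<le> B" using strip_bdD(2)[OF assms, of z "Suc j"] * by simp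
  moreover have "norm (exp z * F z) * exp (real j * Re z) = norm (F z) * exp (real (Suc j) * Re z)"
    by (simp add: norm_mult exp_add algebra_simps)
  ultimately show "norm (exp z * F z) * exp (real j * Re z) \<le> B" by simp
qed (use assms in \<open>auto intro!: holomorphic_intros simp: strip_bd_def\<close>)

lemma cball_strip:
  assumes "z \<in> strip r'" "r' + d \<le> r"
  shows "ball z d \<subseteq> strip r" "r' + d < r \<Longrightarrow> cball z d \<subseteq> strip r"
proof -
  have *: "\<bar>Im w\<bar> \<le> \<bar>Im z\<bar> + dist z w" for w
    using abs_Im_le_cmod[of "z - w"] unfolding dist_norm minus_complex.simps by linarith
  have z: "\<bar>Im z\<bar> < r'" using assms(1) by (simp add: strip_def)
  show "ball z d \<subseteq> strip r"
  proof
    fix w assume "w \<in> ball z d"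
    then show "w \<in> strip r" using *[of w] z assms(2) by (simp add: strip_def)
  qed
  show "cball z d \<subseteq> strip r" if "r' + d < r"
  proof
    fix w assume "w \<in> cball z d"
    then show "w \<in> strip r" using *[of w] z that by (simp add: strip_def)
  qed
qed

text \<open>Cauchy's inequality on the circle of radius \<open>d\<close>; over this distance the
  weights change at most by the factor \<open>exp (real A * d)\<close>.\<close>

lemma strip_bd_higher_deriv:
  assumes F: "strip_bd r A B F" and d: "0 < d" "r' + d < r" and z: "z \<in> strip r'" and j: "j \<le> A"
  shows "norm ((deriv ^^ n) F z) * exp (real j * Re z) \<le> fact n * exp (real A * d) / d ^ n * B"
proof -
  have B: "B \<ge> 0" using d z by (intro strip_bd_nonneg[OF F]) (auto simp: strip_def)
  have "norm ((deriv ^^ n) F z) \<le> fact n * (B * exp (real A * d) * exp (- (real j * Re z))) / d ^ n"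
  proof (rule Cauchy_inequality)
    show "F holomorphic_on ball z d"
      by (rule holomorphic_on_subset[OF strip_bdD(1)[OF F]]) (rule cball_strip[OF z], use d in simp)
    show "continuous_on (cball z d) F"
      by (rule continuous_on_subset[OF holomorphic_on_imp_continuous_on[OF strip_bdD(1)[OF F]]])
         (rule cball_strip(2)[OF z], use d in simp_all)
    fix w assume w: "cmod (z - w) = d"
    have "w \<in> strip r" using cball_strip(2)[OF z, of d r] d w by (auto simp: dist_norm)
    then have "norm (F w) \<le> B * exp (- (real j * Re w))" using j by (intro strip_bd_bound[OF F])
    also have "\<dots> \<le> B * (exp (real A * d) * exp (- (real j * Re z)))"
    proof (intro mult_left_mono B)
      have "Re z - Re w \<le> d" using abs_Re_le_cmod[of "z - w"] w by simp
      then have "real j * (Re z - Re w) \<le> real j * d" by (intro mult_left_mono) auto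
      also have "\<dots> \<le> real A * d" using j d by (intro mult_right_mono) auto
      finally have "real j * (Re z - Re w) \<le> real A * d" .
      then show "exp (- (real j * Re w)) \<le> exp (real A * d) * exp (- (real j * Re z))"
        unfolding exp_add[symmetric] by (simp add: algebra_simps)
    qed
    finally show "norm (F w) \<le> B * exp (real A * d) * exp (- (real j * Re z))" by (simp add: mult.assoc)
  qed (use d in auto)
  then have "norm ((deriv ^^ n) F z) * exp (real j * Re z) \<le>
     fact n * (B * exp (real A * d) * exp (- (real j * Re z))) / d ^ n * exp (real j * Re z)"
    by (intro mult_right_mono) auto
  also have "\<dots> = fact n * exp (real A * d) / d ^ n * B"
    by (simp add: exp_minus field_simps)
  finally show ?thesis .
qed

lemma strip_bd_deriv:
  assumes "0 < r'" "r' < r"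
  shows "\<exists>K\<ge>0. \<forall>B F. strip_bd r A B F \<longrightarrow> strip_bd r' A (K * B) (deriv F)"
proof (intro exI conjI allI impI)
  define d where "d = (r - r') / 2"
  have d: "0 < d" "r' + d < r" using assms by (auto simp: d_def field_simps)
  show "fact 1 * exp (real A * d) / d ^ 1 \<ge> 0" using d by simp
  fix B F assume F: "strip_bd r A B F"
  show "strip_bd r' A (fact 1 * exp (real A * d) / d ^ 1 * B) (deriv F)"
  proof (rule strip_bdI)
    show "deriv F holomorphic_on strip r'"
      using assms by (intro holomorphic_on_subset[OF holomorphic_deriv[OF strip_bdD(1)[OF F] open_strip]]) (auto simp: strip_def)
    show "norm (deriv F z) * exp (real j * Re z) \<le> fact 1 * exp (real A * d) / d ^ 1 * B" if "z \<in> strip r'" "j \<le> A" for z j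
      using strip_bd_higher_deriv[OF F d that, of 1] by simp
  qed
qed

lemma strip_bd_gen_op:
  assumes "0 < r'" "r' < r"
  shows "\<exists>K\<ge>0. \<forall>B F. strip_bd r (Suc (Suc A)) B F \<longrightarrow> strip_bd r' A (K * B) (gen_op p m F)"
proof -
  define r1 where "r1 = (r + r') / 2"
  have r1: "0 < r1" "r1 < r" "r' < r1" using assms by (auto simp: r1_def)
  obtain K1 where K1: "K1 \<ge> 0" "\<And>B F. strip_bd r A B F \<Longrightarrow> strip_bd r1 A (K1 * B) (deriv F)"
    using strip_bd_deriv[OF r1(1,2), of A] by blast
  obtain K2 where K2: "K2 \<ge> 0" "\<And>B F. strip_bd r1 A B F \<Longrightarrow> strip_bd r' A (K2 * B) (deriv F)"
    using strip_bd_deriv[OF assms(1) r1(3), of A] by blast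
  define q where "q = of_int m / (2::complex)"
  define K where "K = norm (1/2::complex) * (K2 * K1) + norm (-1/2::complex) * K1
     + norm (- (of_real p)\<^sup>2 / 2 :: complex) + norm (- of_real p * q) + norm (- q\<^sup>2 / 2)"
  have "strip_bd r' A (K * B) (gen_op p m F)" if F: "strip_bd r (Suc (Suc A)) B F" for B F
  proof -
    have B0: "B \<ge> 0" using assms F by (auto intro: strip_bd_nonneg)
    have F0: "strip_bd r A B F" by (rule strip_bd_mono[OF F]) auto
    have F1: "strip_bd r' A B (\<lambda>z. exp z * F z)"
      by (rule strip_bd_exp_mult, rule strip_bd_mono[OF F]) (use assms in auto)
    have F2: "strip_bd r' A B (\<lambda>z. exp z * (exp z * F z))"
      by (intro strip_bd_exp_mult, rule strip_bd_mono[OF F]) (use assms in auto)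
    have d1: "strip_bd r' A (K1 * B) (deriv F)" by (rule strip_bd_mono[OF K1(2)[OF F0]]) (use r1 in auto)
    have d2: "strip_bd r' A (K2 * (K1 * B)) (deriv (deriv F))" by (rule K2(2)[OF K1(2)[OF F0]])
    have F0': "strip_bd r' A B F" by (rule strip_bd_mono[OF F]) (use assms in auto)
    have "strip_bd r' A (norm (1/2::complex) * (K2 * (K1 * B)) + norm (-1/2::complex) * (K1 * B)
     + norm (- (of_real p)\<^sup>2 / 2 :: complex) * B + norm (- of_real p * q) * B + norm (- q\<^sup>2 / 2) * B)
      (\<lambda>z. 1/2 * deriv (deriv F) z + (-1/2) * deriv F z + (- (of_real p)\<^sup>2 / 2) * (exp z * (exp z * F z))
        + (- of_real p * q) * (exp z * F z) + (- q\<^sup>2 / 2) * F z)"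
      by (intro strip_bd_add strip_bd_cmult d1 d2 F2 F1 F0')
    moreover have "(\<lambda>z. 1/2 * deriv (deriv F) z + (-1/2) * deriv F z + (- (of_real p)\<^sup>2 / 2) * (exp z * (exp z * F z))
        + (- of_real p * q) * (exp z * F z) + (- q\<^sup>2 / 2) * F z) = gen_op p m F"
      by (rule ext) (simp add: gen_op_def q_def[symmetric] field_simps power2_eq_square)
    ultimately show ?thesis by (simp add: K_def algebra_simps)
  qed
  moreover have "K \<ge> 0" using K1 K2 by (auto simp: K_def)
  ultimately show ?thesis by blast
qed

text \<open>One step of the walk of duration \<open>\<epsilon>\<close>; the first factor is the characteristic function of the Gaussian
  increment \<open>\<zeta>\<close> of \<open>\<beta>\<close>, entering through \<open>p e\<^sup>v \<zeta> + m \<zeta> / 2\<close>.\<close>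

definition walk_op :: "real \<Rightarrow> int \<Rightarrow> real \<Rightarrow> (complex \<Rightarrow> complex) \<Rightarrow> complex \<Rightarrow> complex" where
  "walk_op p m \<epsilon> F z = exp (- of_real (\<epsilon> / 2) * (of_real p * exp z + of_int m / 2)\<^sup>2) *
     ((F (z + of_real (sqrt \<epsilon> - \<epsilon> / 2)) + F (z + of_real (- sqrt \<epsilon> - \<epsilon> / 2))) / 2)"

text \<open>In the strip of half-width 1/2 the sine of the imaginary part is at most 1/2 in modulus,
  so \<open>cos\<^sup>2 - sin\<^sup>2\<close> is at least \<open>cos\<^sup>2 / 2\<close> and the
  square can be completed. The Gaussian factor of \<open>walk_op\<close> is thus bounded on the
  strip although \<open>exp z\<close> is not.\<close>

lemma Re_square_strip:
  assumes "z \<in> strip (1/2)"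
  shows "Re ((of_real p * exp z + of_real \<mu>)\<^sup>2) \<ge> - \<mu>\<^sup>2"
proof -
  define P where "P = p * exp (Re z)"
  define c s where "c = cos (Im z)" and "s = sin (Im z)"
  have cs: "c\<^sup>2 + s\<^sup>2 = 1" by (simp add: c_def s_def)
  have "\<bar>s\<bar> \<le> 1/2" using abs_sin_x_le_abs_x[of "Im z"] assms by (simp add: s_def strip_def)
  then have "s\<^sup>2 \<le> (1/2)\<^sup>2" using abs_le_square_iff[of s "1/2"] by simp
  then have "c\<^sup>2 - s\<^sup>2 \<ge> c\<^sup>2 / 2" using cs by (simp add: power2_eq_square)
  then have "P\<^sup>2 * (c\<^sup>2 - s\<^sup>2) \<ge> P\<^sup>2 * (c\<^sup>2 / 2)" by (intro mult_left_mono) auto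
  moreover have "Re ((of_real p * exp z + of_real \<mu>)\<^sup>2) = P\<^sup>2 * (c\<^sup>2 - s\<^sup>2) + 2 * P * c * \<mu> + \<mu>\<^sup>2"
    by (simp add: P_def c_def s_def Re_power2 Re_exp Im_exp) (simp add: power2_eq_square algebra_simps)
  moreover have "P\<^sup>2 * (c\<^sup>2 / 2) + 2 * P * c * \<mu> + \<mu>\<^sup>2 = (P * c + 2 * \<mu>)\<^sup>2 / 2 - \<mu>\<^sup>2"
    by (simp add: power2_eq_square field_simps)
  moreover have "(P * c + 2 * \<mu>)\<^sup>2 \<ge> 0" by simp
  ultimately show ?thesis by linarith
qed

text \<open>The exponent is quadratic in \<open>x\<close>, so averaging an exponential weight over
  the two jumps of size \<open>sqrt \<epsilon>\<close> costs only a factor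
  \<open>exp (O(\<epsilon>))\<close>.\<close>

lemma cosh_bound:
  fixes x :: real
  assumes "\<bar>x\<bar> \<le> A"
  shows "(exp x + exp (- x)) / 2 \<le> exp (exp A * x\<^sup>2)"
proof -
  have e: "exp y \<le> 1 + y + exp A / 2 * y\<^sup>2" if "\<bar>y\<bar> \<le> A" for y :: real
  proof -
    obtain t where t: "\<bar>t\<bar> \<le> \<bar>y\<bar>" "exp y = (\<Sum>m<2. y ^ m / fact m) + exp t / fact 2 * y ^ 2"
      using Maclaurin_exp_le[of y 2] by blast
    have "exp t / 2 * y\<^sup>2 \<le> exp A / 2 * y\<^sup>2" using t(1) that by (intro mult_right_mono) auto
    then show ?thesis using t(2) by (simp add: numeral_2_eq_2)
  qed
  have "(exp x + exp (- x)) / 2 \<le> 1 + exp A / 2 * x\<^sup>2"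
    using e[of x] e[of "-x"] assms by simp
  also have "\<dots> \<le> 1 + exp A * x\<^sup>2" by simp
  also have "\<dots> \<le> exp (exp A * x\<^sup>2)" by (rule exp_ge_add_one_self)
  finally show ?thesis .
qed

text \<open>In contrast to \<open>gen_op\<close>, a step loses neither width nor weights, because
  its shifts are real and nothing is differentiated. The factor \<open>exp (K * \<epsilon>)\<close>
  stays bounded over \<open>t / \<epsilon>\<close> steps.\<close>

lemma strip_bd_walk_op:
  "\<exists>K\<ge>0. \<forall>B F \<epsilon>. strip_bd (1/2) A B F \<longrightarrow> 0 \<le> \<epsilon> \<longrightarrow> \<epsilon> \<le> 1 \<longrightarrow> strip_bd (1/2) A (exp (K * \<epsilon>) * B) (walk_op p m \<epsilon> F)"
proof (intro exI conjI allI impI)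
  define K where "K = (real_of_int m / 2)\<^sup>2 / 2 + real A / 2 + exp (real A) * (real A)\<^sup>2"
  show "K \<ge> 0" by (simp add: K_def)
  fix B F \<epsilon> assume F: "strip_bd (1/2) A B F" and e: "0 \<le> \<epsilon>" "\<epsilon> \<le> (1::real)"
  have B: "B \<ge> 0" by (rule strip_bd_nonneg[OF F]) simp
  have sh: "z + of_real x \<in> strip (1/2)" if "z \<in> strip (1/2)" for z x using that by (simp add: strip_def)
  show "strip_bd (1/2) A (exp (K * \<epsilon>) * B) (walk_op p m \<epsilon> F)"
  proof (rule strip_bdI)
    have "(\<lambda>z. F (z + of_real x)) holomorphic_on strip (1/2)" for x
    proof -
      have "(\<lambda>z. z + complex_of_real x) holomorphic_on strip (1/2)" by (intro holomorphic_intros)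
      from holomorphic_on_compose_gen[OF this strip_bdD(1)[OF F]] sh show ?thesis by (auto simp: o_def)
    qed
    note hol = this
    show "walk_op p m \<epsilon> F holomorphic_on strip (1/2)"
      unfolding walk_op_def[abs_def] by (intro holomorphic_intros hol) auto
    fix z :: complex and j assume z: "z \<in> strip (1/2)" and j: "j \<le> A"
    define mu where "mu = real_of_int m / 2"
    have n1: "norm (exp (- of_real (\<epsilon> / 2) * (of_real p * exp z + of_int m / 2)\<^sup>2)) \<le> exp (mu\<^sup>2 / 2 * \<epsilon>)"
    proof -
      have "- (\<epsilon> / 2) * Re ((of_real p * exp z + of_real mu)\<^sup>2) \<le> \<epsilon> / 2 * mu\<^sup>2"
        using mult_left_mono[OF Re_square_strip[OF z, of mu p], of "\<epsilon> / 2"] e by simp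
      then show ?thesis by (simp add: mu_def mult.commute)
    qed
    have Fb: "norm (F (z + of_real x)) * exp (real j * Re z) \<le> B * exp (- (real j * x))" for x
    proof -
      have e: "exp (- (real j * Re (z + of_real x))) * exp (real j * Re z) = exp (- (real j * x))"
        unfolding exp_add[symmetric] by (simp add: algebra_simps)
      show ?thesis
        using mult_right_mono[OF strip_bd_bound[OF F sh[OF z] j], of "exp (real j * Re z)" x]
        unfolding mult.assoc e by simp
    qed
    have "norm ((F (z + of_real (sqrt \<epsilon> - \<epsilon> / 2)) + F (z + of_real (- sqrt \<epsilon> - \<epsilon> / 2))) / 2) * exp (real j * Re z)
       \<le> (norm (F (z + of_real (sqrt \<epsilon> - \<epsilon> / 2))) + norm (F (z + of_real (- sqrt \<epsilon> - \<epsilon> / 2)))) / 2 * exp (real j * Re z)"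
      by (intro mult_right_mono) (auto intro: norm_triangle_ineq simp: norm_divide divide_right_mono)
    also have "\<dots> \<le> (B * exp (- (real j * (sqrt \<epsilon> - \<epsilon> / 2))) + B * exp (- (real j * (- sqrt \<epsilon> - \<epsilon> / 2)))) / 2"
      using Fb[of "sqrt \<epsilon> - \<epsilon> / 2"] Fb[of "- sqrt \<epsilon> - \<epsilon> / 2"] by (simp add: algebra_simps)
    also have "\<dots> = B * exp (real j * \<epsilon> / 2) * ((exp (real j * sqrt \<epsilon>) + exp (- (real j * sqrt \<epsilon>))) / 2)"
    proof -
      have 1: "exp (- (real j * (sqrt \<epsilon> - \<epsilon> / 2))) = exp (real j * \<epsilon> / 2) * exp (- (real j * sqrt \<epsilon>))"
        unfolding exp_add[symmetric] by (simp add: algebra_simps)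
      have 2: "exp (- (real j * (- sqrt \<epsilon> - \<epsilon> / 2))) = exp (real j * \<epsilon> / 2) * exp (real j * sqrt \<epsilon>)"
        unfolding exp_add[symmetric] by (simp add: algebra_simps)
      show ?thesis unfolding 1 2 by (simp add: algebra_simps)
    qed
    also have "\<dots> \<le> B * exp (real A * \<epsilon> / 2) * exp (exp (real A) * (real j * sqrt \<epsilon>)\<^sup>2)"
    proof (intro mult_mono cosh_bound mult_left_mono B)
      show "exp (real j * \<epsilon> / 2) \<le> exp (real A * \<epsilon> / 2)" using j e by (simp add: mult_right_mono)
      have "real j * sqrt \<epsilon> \<le> real A * 1" using j e by (intro mult_mono) auto
      then show "\<bar>real j * sqrt \<epsilon>\<bar> \<le> real A" using e by (simp add: abs_mult)
    qed (use B in auto)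
    also have "\<dots> \<le> B * exp (real A * \<epsilon> / 2) * exp (exp (real A) * ((real A)\<^sup>2 * \<epsilon>))"
      using j e B by (intro mult_left_mono) (auto simp: power_mult_distrib intro!: mult_right_mono)
    also have "\<dots> = B * exp (real A * \<epsilon> / 2 + exp (real A) * ((real A)\<^sup>2 * \<epsilon>))" by (simp add: exp_add)
    finally have n2: "norm ((F (z + of_real (sqrt \<epsilon> - \<epsilon> / 2)) + F (z + of_real (- sqrt \<epsilon> - \<epsilon> / 2))) / 2) * exp (real j * Re z)
      \<le> B * exp (real A * \<epsilon> / 2 + exp (real A) * ((real A)\<^sup>2 * \<epsilon>))" .
    have "norm (walk_op p m \<epsilon> F z) * exp (real j * Re z) \<le> exp (mu\<^sup>2 / 2 * \<epsilon>) * (B * exp (real A * \<epsilon> / 2 + exp (real A) * ((real A)\<^sup>2 * \<epsilon>)))"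
      unfolding walk_op_def norm_mult[of "exp _"] mult.assoc by (rule mult_mono[OF n1 n2]) auto
    also have "\<dots> = exp (K * \<epsilon>) * B"
    proof -
      have "K * \<epsilon> = mu\<^sup>2 / 2 * \<epsilon> + (real A * \<epsilon> / 2 + exp (real A) * ((real A)\<^sup>2 * \<epsilon>))"
        by (simp add: K_def mu_def algebra_simps)
      then show ?thesis by (simp only: exp_add) (simp add: mult_ac)
    qed
    finally show "norm (walk_op p m \<epsilon> F z) * exp (real j * Re z) \<le> exp (K * \<epsilon>) * B" .
  qed
qed

section \<open>Consistency of one step with the generator\<close>

lemma strip_bd_taylor:
  assumes F: "strip_bd (1/2) 4 B F" and \<eta>: "\<bar>\<eta>\<bar> \<le> 3/2" and j: "j \<le> 4"
  shows "norm (F (of_real (v + \<eta>)) - (\<Sum>i\<le>3. (deriv ^^ i) F (of_real v) * of_real \<eta> ^ i / fact i)) * exp (real j * v)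
     \<le> (fact 4 * exp 1 * 256 * exp 6) * B * \<bar>\<eta>\<bar> ^ 4"
proof -
  have B: "B \<ge> 0" by (rule strip_bd_nonneg[OF F]) simp
  define S where "S = closed_segment (complex_of_real v) (of_real (v + \<eta>))"
  have S: "\<exists>y. x = of_real y \<and> \<bar>y - v\<bar> \<le> 3/2" if x: "x \<in> S" for x
  proof -
    obtain u where u: "0 \<le> u" "u \<le> 1" "x = (1 - u) *\<^sub>R complex_of_real v + u *\<^sub>R of_real (v + \<eta>)"
      using x unfolding S_def in_segment by blast
    then have "x = of_real (v + u * \<eta>)" by (simp add: scaleR_conv_of_real algebra_simps)
    moreover have "\<bar>u * \<eta>\<bar> \<le> 1 * (3/2)" unfolding abs_mult using u \<eta> by (intro mult_mono) auto
    ultimately show ?thesis by (intro exI[of _ "v + u * \<eta>"]) simp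
  qed
  \<comment> \<open>The Cauchy estimate of order 4 on discs of radius 1/4 gives
    \<open>exp 1 * 256\<close>; \<open>exp 6\<close> compares weights of exponent at most 4 at
    points at distance at most 3/2.\<close>
  define M where "M = fact 4 * exp 1 * 256 * exp 6 * B * exp (- (real j * v))"
  have "norm ((deriv ^^ 0) F (of_real (v + \<eta>)) - (\<Sum>i\<le>3. (deriv ^^ i) F (of_real v) * (of_real (v + \<eta>) - of_real v) ^ i / fact i))
     \<le> M * norm (complex_of_real (v + \<eta>) - of_real v) ^ Suc 3 / fact 3"
  proof (rule field_Taylor[where S=S and f="\<lambda>i. (deriv ^^ i) F"])
    show "convex S" by (simp add: S_def)
    show "complex_of_real v \<in> S" "complex_of_real (v + \<eta>) \<in> S" by (simp_all add: S_def)
    fix x assume "x \<in> S"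
    then obtain y where y: "x = of_real y" "\<bar>y - v\<bar> \<le> 3/2" using S by blast
    show "((deriv ^^ i) F has_field_derivative (deriv ^^ Suc i) F x) (at x within S)" for i
      using holomorphic_derivI[OF holomorphic_higher_deriv[OF strip_bdD(1)[OF F] open_strip] open_strip, of x i]
      by (auto simp: y of_real_strip intro: has_field_derivative_at_within)
    have "norm ((deriv ^^ 4) F x) * exp (real j * y) \<le> fact 4 * exp (real 4 * (1/4)) / (1/4) ^ 4 * B"
      using strip_bd_higher_deriv[OF F, of "1/4" "1/8" x j 4] j by (simp add: y of_real_strip)
    also have "\<dots> = fact 4 * exp 1 * 256 * B" by (simp add: power_divide)
    finally have "norm ((deriv ^^ 4) F x) \<le> fact 4 * exp 1 * 256 * B * exp (- (real j * y))"
      by (simp add: exp_minus field_simps)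
    also have "\<dots> \<le> fact 4 * exp 1 * 256 * B * (exp 6 * exp (- (real j * v)))"
    proof (intro mult_left_mono)
      have "v - y \<le> 3/2" using y(2) by linarith
      then have "real j * (v - y) \<le> real j * (3/2)" by (intro mult_left_mono) auto
      also have "\<dots> \<le> real 4 * (3/2)" using j by (intro mult_right_mono) auto
      finally have "real j * (v - y) \<le> real 4 * (3/2)" .
      then show "exp (- (real j * y)) \<le> exp 6 * exp (- (real j * v))"
        unfolding exp_add[symmetric] by (simp add: algebra_simps)
    qed (use B in auto)
    finally show "norm ((deriv ^^ Suc 3) F x) \<le> M" by (simp add: M_def mult_ac)
  qed
  then have "norm (F (of_real (v + \<eta>)) - (\<Sum>i\<le>3. (deriv ^^ i) F (of_real v) * of_real \<eta> ^ i / fact i))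
     \<le> M * \<bar>\<eta>\<bar> ^ 4 / fact 3"
    by simp
  also have "\<dots> \<le> M * \<bar>\<eta>\<bar> ^ 4"
    using B by (simp add: M_def fact_numeral divide_le_eq mult_le_cancel_left1)
  finally have "norm (F (of_real (v + \<eta>)) - (\<Sum>i\<le>3. (deriv ^^ i) F (of_real v) * of_real \<eta> ^ i / fact i)) * exp (real j * v)
     \<le> M * \<bar>\<eta>\<bar> ^ 4 * exp (real j * v)" by (intro mult_right_mono) auto
  also have "\<dots> = (fact 4 * exp 1 * 256 * exp 6) * B * \<bar>\<eta>\<bar> ^ 4"
    by (simp add: M_def exp_minus field_simps)
  finally show ?thesis .
qed

lemma exp_minus_second_order:
  fixes x :: real
  assumes "x \<ge> 0"
  shows "\<bar>exp (- x) - 1 + x\<bar> \<le> x\<^sup>2"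
proof -
  have "exp (- x) \<ge> 1 - x" using exp_ge_add_one_self[of "-x"] by simp
  moreover have "exp (- x) \<le> 1 / (1 + x)"
    using exp_ge_add_one_self[of x] assms by (simp add: exp_minus divide_inverse)
  moreover have "1 / (1 + x) \<le> 1 - x + x\<^sup>2"
  proof -
    have "(1 - x + x\<^sup>2) * (1 + x) = 1 + x ^ 3" by (simp add: algebra_simps power2_eq_square power3_eq_cube)
    then have "1 \<le> (1 - x + x\<^sup>2) * (1 + x)" using assms by simp
    then show ?thesis using assms by (simp add: divide_le_eq)
  qed
  ultimately show ?thesis by linarith
qed

text \<open>Odd powers of \<open>h\<close> cancel. With \<open>h\<^sup>2 = \<epsilon>\<close> this
  is an Euler step for \<open>(D 2 - D 1) / 2\<close>, the drift coming from the common displacement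
  \<open>- h\<^sup>2 / 2\<close>, with an error of order \<open>\<epsilon>\<^sup>2\<close>.\<close>

lemma two_point_average:
  fixes D :: "nat \<Rightarrow> complex" and h :: real
  shows "((\<Sum>i\<le>3. D i * of_real (h - h\<^sup>2 / 2) ^ i / fact i) + (\<Sum>i\<le>3. D i * of_real (- h - h\<^sup>2 / 2) ^ i / fact i)) / 2
    = D 0 + of_real (h\<^sup>2) * ((D 2 - D 1) / 2) + of_real (h ^ 4) * (D 2 / 8 - D 3 * of_real (1/4 + h\<^sup>2 / 48))"
proof -
  have 1: "of_real (h - h\<^sup>2 / 2) + of_real (- h - h\<^sup>2 / 2) = (- of_real (h\<^sup>2) :: complex)" by simp
  have "(h - h\<^sup>2 / 2) ^ 2 + (- h - h\<^sup>2 / 2) ^ 2 = 2 * h\<^sup>2 + h ^ 4 / 2"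
    by (simp add: power2_eq_square power4_eq_xxxx algebra_simps)
  then have 2: "of_real (h - h\<^sup>2 / 2) ^ 2 + of_real (- h - h\<^sup>2 / 2) ^ 2 = (of_real (2 * h\<^sup>2 + h ^ 4 / 2) :: complex)"
    by (simp only: of_real_add[symmetric] of_real_power[symmetric])
  have "(h - h\<^sup>2 / 2) ^ 3 + (- h - h\<^sup>2 / 2) ^ 3 = - 3 * h ^ 4 - h ^ 6 / 4"
    by (simp add: power2_eq_square power3_eq_cube power4_eq_xxxx eval_nat_numeral field_simps)
  then have 3: "of_real (h - h\<^sup>2 / 2) ^ 3 + of_real (- h - h\<^sup>2 / 2) ^ 3 = (of_real (- 3 * h ^ 4 - h ^ 6 / 4) :: complex)"
    by (simp only: of_real_add[symmetric] of_real_power[symmetric])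
  have split: "(\<Sum>i\<le>3. D i * a ^ i / fact i) = D 0 + D 1 * a + D 2 * a\<^sup>2 / 2 + D 3 * a ^ 3 / 6" for a
    by (simp add: numeral_3_eq_3 fact_numeral numeral_2_eq_2)
  have "((\<Sum>i\<le>3. D i * of_real (h - h\<^sup>2 / 2) ^ i / fact i) + (\<Sum>i\<le>3. D i * of_real (- h - h\<^sup>2 / 2) ^ i / fact i)) / 2 =
     D 0 + D 1 * (of_real (h - h\<^sup>2 / 2) + of_real (- h - h\<^sup>2 / 2)) / 2
       + D 2 * (of_real (h - h\<^sup>2 / 2) ^ 2 + of_real (- h - h\<^sup>2 / 2) ^ 2) / 4
       + D 3 * (of_real (h - h\<^sup>2 / 2) ^ 3 + of_real (- h - h\<^sup>2 / 2) ^ 3) / 12"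
    unfolding split by (simp add: field_simps)
  also have "\<dots> = D 0 + of_real (h\<^sup>2) * ((D 2 - D 1) / 2) + of_real (h ^ 4) * (D 2 / 8 - D 3 * of_real (1/4 + h\<^sup>2 / 48))"
    unfolding 1 2 3 by (simp add: field_simps eval_nat_numeral)
  finally show ?thesis .
qed

text \<open>The second-order remainder of the exponential factor contains \<open>W\<^sup>2\<close>,
  which can grow like \<open>exp (4 * v)\<close>. Four weights absorb it, so the bound is uniform in
  \<open>v\<close>.\<close>

lemma walk_op_consistent:
  "\<exists>K\<ge>0. \<forall>B F \<epsilon> v. strip_bd (1/2) 4 B F \<longrightarrow> 0 \<le> \<epsilon> \<longrightarrow> \<epsilon> \<le> 1 \<longrightarrow>
     norm (walk_op p m \<epsilon> F (of_real v) - F (of_real v) - of_real \<epsilon> * gen_op p m F (of_real v)) \<le> K * \<epsilon>\<^sup>2 * B"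
proof -
  define K0 K1 K2 :: real where "K0 = fact 4 * exp 1 * 256" and "K1 = fact 4 * exp 1 * 256 * exp 6" and "K2 = K0 + 6 * K1"
  define \<mu> where "\<mu> = real_of_int m / 2"
  define K where "K = (2 * p ^ 4 + 2 * \<mu> ^ 4) * (2 * K0 + K2) + (p\<^sup>2 + \<mu>\<^sup>2) * (K0 + K2) + K2"
  have K0: "K0 \<ge> 0" "K1 \<ge> 0" "K2 \<ge> 0" by (auto simp: K0_def K1_def K2_def)
  then have K: "K \<ge> 0" unfolding K_def by simp
  have "norm (walk_op p m \<epsilon> F (of_real v) - F (of_real v) - of_real \<epsilon> * gen_op p m F (of_real v)) \<le> K * \<epsilon>\<^sup>2 * B"
    if F: "strip_bd (1/2) 4 B F" and e: "0 \<le> \<epsilon>" "\<epsilon> \<le> 1" for B F \<epsilon> v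
  proof -
    have B: "B \<ge> 0" by (rule strip_bd_nonneg[OF F]) simp
    define h where "h = sqrt \<epsilon>"
    have h: "0 \<le> h" "h \<le> 1" "h\<^sup>2 = \<epsilon>" using e by (auto simp: h_def)
    have h4: "h ^ 4 = \<epsilon>\<^sup>2" using h(3) by (metis mult_2 numeral_Bit0 power2_eq_square power_add)
    define D where "D i = (deriv ^^ i) F (of_real v)" for i
    have D: "norm (D n) * exp (real j * v) \<le> K0 * B" if "n \<le> 4" "j \<le> 4" for n j
    proof -
      have "norm (D n) * exp (real j * v) \<le> fact n * exp (real 4 * (1/4)) / (1/4) ^ n * B"
        using strip_bd_higher_deriv[OF F, of "1/4" "1/8" "of_real v" j n] that by (simp add: D_def of_real_strip)
      also have "\<dots> = fact n * exp 1 * 4 ^ n * B" by (simp add: power_divide)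
      also have "\<dots> \<le> fact 4 * exp 1 * 4 ^ 4 * B"
        using that B by (intro mult_right_mono mult_mono fact_mono power_increasing) auto
      finally show ?thesis by (simp add: K0_def)
    qed
    define f1 f2 where "f1 = F (of_real (v + (h - h\<^sup>2 / 2)))" and "f2 = F (of_real (v + (- h - h\<^sup>2 / 2)))"
    define avg where "avg = (f1 + f2) / 2"
    define G where "G = (D 2 - D 1) / 2"
    have hh: "h\<^sup>2 \<le> h" using h(1,2) by (simp add: power2_eq_square mult_left_le)
    have \<eta>: "\<bar>h - h\<^sup>2 / 2\<bar> \<le> 3/2 * h" "\<bar>- h - h\<^sup>2 / 2\<bar> \<le> 3/2 * h"
      unfolding abs_le_iff using h(1) hh zero_le_power2[of h] by linarith+
    have T: "norm (f - (\<Sum>i\<le>3. D i * of_real \<eta> ^ i / fact i)) * exp (real j * v) \<le> 6 * K1 * B * \<epsilon>\<^sup>2"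
      if "f = F (of_real (v + \<eta>))" "\<bar>\<eta>\<bar> \<le> 3/2 * h" "j \<le> 4" for f \<eta> j
    proof -
      have "\<bar>\<eta>\<bar> ^ 4 \<le> (3/2 * h) ^ 4" using that by (intro power_mono) auto
      also have "\<dots> \<le> 6 * \<epsilon>\<^sup>2" by (simp add: power_mult_distrib h4 power_divide)
      finally have "K1 * B * \<bar>\<eta>\<bar> ^ 4 \<le> K1 * B * (6 * \<epsilon>\<^sup>2)" using K0 B by (intro mult_left_mono) auto
      moreover have "norm (f - (\<Sum>i\<le>3. D i * of_real \<eta> ^ i / fact i)) * exp (real j * v) \<le> K1 * B * \<bar>\<eta>\<bar> ^ 4"
        using strip_bd_taylor[OF F, of \<eta> j v] that h by (simp add: K1_def D_def)
      ultimately show ?thesis by simp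
    qed
    have a: "norm (avg - D 0 - of_real \<epsilon> * G) * exp (real j * v) \<le> K2 * B * \<epsilon>\<^sup>2" if j: "j \<le> 4" for j
    proof -
      define r1 r2 where "r1 = f1 - (\<Sum>i\<le>3. D i * of_real (h - h\<^sup>2 / 2) ^ i / fact i)"
        and "r2 = f2 - (\<Sum>i\<le>3. D i * of_real (- h - h\<^sup>2 / 2) ^ i / fact i)"
      have "avg = (r1 + r2) / 2 + ((\<Sum>i\<le>3. D i * of_real (h - h\<^sup>2 / 2) ^ i / fact i) + (\<Sum>i\<le>3. D i * of_real (- h - h\<^sup>2 / 2) ^ i / fact i)) / 2"
        by (simp add: avg_def r1_def r2_def field_simps)
      then have eq0: "avg = (r1 + r2) / 2 + (D 0 + of_real (h\<^sup>2) * ((D 2 - D 1) / 2) + of_real (h ^ 4) * (D 2 / 8 - D 3 * of_real (1/4 + h\<^sup>2 / 48)))"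
        unfolding two_point_average .
      have eq: "avg - D 0 - of_real \<epsilon> * G = (r1 + r2) / 2 + of_real (\<epsilon>\<^sup>2) * (D 2 / 8 - D 3 * of_real (1/4 + h\<^sup>2 / 48))"
        unfolding eq0 G_def h(3) h4 by simp
      have r: "norm r1 * exp (real j * v) \<le> 6 * K1 * B * \<epsilon>\<^sup>2" "norm r2 * exp (real j * v) \<le> 6 * K1 * B * \<epsilon>\<^sup>2"
        unfolding r1_def r2_def by (intro T \<eta> j f1_def f2_def)+
      have "norm (avg - D 0 - of_real \<epsilon> * G) \<le> (norm r1 + norm r2) / 2 + \<epsilon>\<^sup>2 * (norm (D 2) / 8 + norm (D 3) * (1/4 + h\<^sup>2 / 48))"
        unfolding eq
      proof (rule order_trans[OF norm_triangle_ineq], intro add_mono)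
        show "norm ((r1 + r2) / 2) \<le> (norm r1 + norm r2) / 2"
          by (simp add: norm_divide norm_triangle_ineq divide_right_mono)
        have "norm (D 2 / 8 - D 3 * of_real (1/4 + h\<^sup>2 / 48)) \<le> norm (D 2 / 8) + norm (D 3 * of_real (1/4 + h\<^sup>2 / 48))"
          by (rule norm_triangle_ineq4)
        also have "\<dots> = norm (D 2) / 8 + norm (D 3) * (1/4 + h\<^sup>2 / 48)"
          unfolding norm_mult norm_divide norm_of_real by (simp add: add_nonneg_nonneg abs_of_nonneg)
        finally show "norm (of_real (\<epsilon>\<^sup>2) * (D 2 / 8 - D 3 * of_real (1/4 + h\<^sup>2 / 48))) \<le> \<epsilon>\<^sup>2 * (norm (D 2) / 8 + norm (D 3) * (1/4 + h\<^sup>2 / 48))"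
          unfolding norm_mult[of "complex_of_real _"] norm_of_real by (intro mult_mono) auto
      qed
      also have "\<dots> \<le> (norm r1 + norm r2) / 2 + \<epsilon>\<^sup>2 * (norm (D 2) / 2 + norm (D 3) * (1/2))"
        using h e by (intro add_mono mult_left_mono) auto
      finally have "norm (avg - D 0 - of_real \<epsilon> * G) * exp (real j * v)
         \<le> ((norm r1 + norm r2) / 2 + \<epsilon>\<^sup>2 * (norm (D 2) / 2 + norm (D 3) * (1/2))) * exp (real j * v)"
        by (intro mult_right_mono) auto
      also have "\<dots> = (norm r1 * exp (real j * v) + norm r2 * exp (real j * v)) / 2
         + \<epsilon>\<^sup>2 * (norm (D 2) * exp (real j * v) / 2 + norm (D 3) * exp (real j * v) * (1/2))"
        by (simp add: field_simps)
      also have "\<dots> \<le> (6 * K1 * B * \<epsilon>\<^sup>2 + 6 * K1 * B * \<epsilon>\<^sup>2) / 2 + \<epsilon>\<^sup>2 * (K0 * B / 2 + K0 * B * (1/2))"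
        using r D[of 2 j] D[of 3 j] j by (intro add_mono divide_right_mono mult_left_mono mult_right_mono) auto
      also have "\<dots> = K2 * B * \<epsilon>\<^sup>2" by (simp add: K2_def algebra_simps)
      finally show ?thesis .
    qed
    have b: "norm (avg - D 0) * exp (real j * v) \<le> (K0 + K2) * B * \<epsilon>" if j: "j \<le> 4" for j
    proof -
      have "norm G \<le> (norm (D 2) + norm (D 1)) / 2"
        unfolding G_def by (simp add: norm_divide norm_triangle_ineq4 divide_right_mono)
      from mult_left_mono[OF this e(1)] have "norm (of_real \<epsilon> * G) \<le> \<epsilon> * ((norm (D 2) + norm (D 1)) / 2)"
        using e(1) by (simp only: norm_mult norm_of_real abs_of_nonneg)
      moreover have "norm (avg - D 0) \<le> norm (avg - D 0 - of_real \<epsilon> * G) + norm (of_real \<epsilon> * G)"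
        by (metis diff_add_cancel norm_triangle_ineq)
      ultimately have "norm (avg - D 0) * exp (real j * v) \<le> (norm (avg - D 0 - of_real \<epsilon> * G) + \<epsilon> * ((norm (D 2) + norm (D 1)) / 2)) * exp (real j * v)"
        by (intro mult_right_mono) auto
      also have "\<dots> = norm (avg - D 0 - of_real \<epsilon> * G) * exp (real j * v) + \<epsilon> * ((norm (D 2) * exp (real j * v) + norm (D 1) * exp (real j * v)) / 2)"
        by (simp add: field_simps)
      also have "\<dots> \<le> K2 * B * \<epsilon>\<^sup>2 + \<epsilon> * ((K0 * B + K0 * B) / 2)"
        using a[OF j] D[of 2 j] D[of 1 j] j e by (intro add_mono divide_right_mono mult_left_mono) auto
      also have "\<dots> \<le> K2 * B * \<epsilon> + \<epsilon> * ((K0 * B + K0 * B) / 2)"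
        using e K0 B by (intro add_mono mult_left_mono) (auto simp: power2_eq_square mult_left_le)
      finally show ?thesis by (simp add: algebra_simps)
    qed
    have c: "norm avg * exp (real j * v) \<le> (2 * K0 + K2) * B" if j: "j \<le> 4" for j
    proof -
      have "norm avg * exp (real j * v) \<le> (norm (avg - D 0) + norm (D 0)) * exp (real j * v)"
        by (intro mult_right_mono) (metis diff_add_cancel norm_triangle_ineq, simp)
      also have "\<dots> = norm (avg - D 0) * exp (real j * v) + norm (D 0) * exp (real j * v)" by (simp add: algebra_simps)
      also have "\<dots> \<le> (K0 + K2) * B * \<epsilon> + K0 * B" using b[OF j] D[of 0 j] j by (intro add_mono) auto
      also have "\<dots> \<le> (K0 + K2) * B * 1 + K0 * B" using e K0 B by (intro add_mono mult_left_mono) auto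
      finally show ?thesis by (simp add: algebra_simps)
    qed
    define W where "W = (p * exp v + \<mu>)\<^sup>2 / 2"
    have W0: "W \<ge> 0" by (simp add: W_def)
    have W1: "W \<le> p\<^sup>2 * exp (real 2 * v) + \<mu>\<^sup>2"
    proof -
      have "(p * exp v + \<mu>)\<^sup>2 \<le> 2 * (p * exp v)\<^sup>2 + 2 * \<mu>\<^sup>2"
        using sum_squares_bound[of "p * exp v" \<mu>] by (simp add: power2_eq_square algebra_simps)
      then show ?thesis by (simp add: W_def power_mult_distrib exp_double[symmetric])
    qed
    have W2: "W\<^sup>2 \<le> 2 * p ^ 4 * exp (real 4 * v) + 2 * \<mu> ^ 4"
    proof -
      have "W\<^sup>2 \<le> (p\<^sup>2 * exp (real 2 * v) + \<mu>\<^sup>2)\<^sup>2" using W0 W1 by (intro power_mono) auto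
      also have "\<dots> \<le> 2 * (p\<^sup>2 * exp (real 2 * v))\<^sup>2 + 2 * (\<mu>\<^sup>2)\<^sup>2"
        using sum_squares_bound[of "p\<^sup>2 * exp (real 2 * v)" "\<mu>\<^sup>2"] by (simp add: power2_eq_square algebra_simps)
      also have "(p\<^sup>2 * exp (real 2 * v))\<^sup>2 = p ^ 4 * exp (real 4 * v)"
        by (simp add: power_mult_distrib exp_double[symmetric] power_mult[symmetric])
      finally show ?thesis by (simp add: power_mult[symmetric])
    qed
    have SSeq: "walk_op p m \<epsilon> F (of_real v) = of_real (exp (- (\<epsilon> * W))) * avg"
    proof -
      have "- complex_of_real (\<epsilon> / 2) * (of_real p * exp (of_real v) + of_int m / 2)\<^sup>2 = of_real (- (\<epsilon> * W))"
        by (simp add: W_def \<mu>_def exp_of_real)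
      then show ?thesis unfolding walk_op_def avg_def f1_def f2_def h_def[symmetric] h(3)
        by (simp only: exp_of_real of_real_add)
    qed
    have AAeq: "gen_op p m F (of_real v) = G - of_real W * D 0"
      by (simp add: gen_op_def G_def D_def W_def \<mu>_def exp_of_real numeral_2_eq_2 field_simps)
    \<comment> \<open>The three terms are the remainder of the exponential, a product of two
      first-order increments, and the Taylor error of the average; each is of order
      \<open>\<epsilon>\<^sup>2\<close>.\<close>
    have "walk_op p m \<epsilon> F (of_real v) - F (of_real v) - of_real \<epsilon> * gen_op p m F (of_real v)
      = of_real (exp (- (\<epsilon> * W)) - 1 + \<epsilon> * W) * avg - of_real (\<epsilon> * W) * (avg - D 0) + (avg - D 0 - of_real \<epsilon> * G)"
      unfolding SSeq AAeq by (simp add: D_def algebra_simps)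
    also have "norm \<dots> \<le> norm (of_real (exp (- (\<epsilon> * W)) - 1 + \<epsilon> * W) * avg) + norm (of_real (\<epsilon> * W) * (avg - D 0)) + norm (avg - D 0 - of_real \<epsilon> * G)"
      by (intro order_trans[OF norm_triangle_ineq] add_mono norm_triangle_ineq4 order_refl)
    also have "\<dots> \<le> (2 * p ^ 4 + 2 * \<mu> ^ 4) * ((2 * K0 + K2) * B) * \<epsilon>\<^sup>2 + (p\<^sup>2 + \<mu>\<^sup>2) * ((K0 + K2) * B * \<epsilon>) * \<epsilon> + K2 * B * \<epsilon>\<^sup>2"
    proof (intro add_mono)
      have "norm (of_real (exp (- (\<epsilon> * W)) - 1 + \<epsilon> * W) * avg) \<le> (\<epsilon> * W)\<^sup>2 * norm avg"
        unfolding norm_mult norm_of_real using exp_minus_second_order[of "\<epsilon> * W"] e W0 by (intro mult_right_mono) auto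
      also have "\<dots> = (W\<^sup>2 * norm avg) * \<epsilon>\<^sup>2" by (simp add: power_mult_distrib)
      also have "W\<^sup>2 * norm avg \<le> (2 * p ^ 4 * exp (real 4 * v) + 2 * \<mu> ^ 4) * norm avg"
        using W2 by (intro mult_right_mono) auto
      also have "\<dots> = 2 * p ^ 4 * (norm avg * exp (real 4 * v)) + 2 * \<mu> ^ 4 * (norm avg * exp (real 0 * v))"
        by (simp add: algebra_simps)
      also have "\<dots> \<le> 2 * p ^ 4 * ((2 * K0 + K2) * B) + 2 * \<mu> ^ 4 * ((2 * K0 + K2) * B)"
        by (intro add_mono mult_left_mono c) auto
      finally show "norm (of_real (exp (- (\<epsilon> * W)) - 1 + \<epsilon> * W) * avg) \<le> (2 * p ^ 4 + 2 * \<mu> ^ 4) * ((2 * K0 + K2) * B) * \<epsilon>\<^sup>2"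
        by (simp add: algebra_simps mult_right_mono)
      have "norm (of_real (\<epsilon> * W) * (avg - D 0)) = W * norm (avg - D 0) * \<epsilon>"
        unfolding norm_mult norm_of_real using e W0 by (simp add: abs_mult)
      also have "W * norm (avg - D 0) \<le> (p\<^sup>2 * exp (real 2 * v) + \<mu>\<^sup>2) * norm (avg - D 0)"
        using W1 by (intro mult_right_mono) auto
      also have "\<dots> = p\<^sup>2 * (norm (avg - D 0) * exp (real 2 * v)) + \<mu>\<^sup>2 * (norm (avg - D 0) * exp (real 0 * v))"
        by (simp add: algebra_simps)
      also have "\<dots> \<le> p\<^sup>2 * ((K0 + K2) * B * \<epsilon>) + \<mu>\<^sup>2 * ((K0 + K2) * B * \<epsilon>)"
        by (intro add_mono mult_left_mono b) auto
      finally show "norm (of_real (\<epsilon> * W) * (avg - D 0)) \<le> (p\<^sup>2 + \<mu>\<^sup>2) * ((K0 + K2) * B * \<epsilon>) * \<epsilon>"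
        using e by (simp add: algebra_simps mult_right_mono)
      show "norm (avg - D 0 - of_real \<epsilon> * G) \<le> K2 * B * \<epsilon>\<^sup>2" using a[of 0] by simp
    qed
    also have "\<dots> = K * \<epsilon>\<^sup>2 * B" by (simp add: K_def algebra_simps power2_eq_square)
    finally show ?thesis .
  qed
  then show ?thesis using K by blast
qed

section \<open>From the forward equation to the walk\<close>

lemma second_deriv_along_curve:
  fixes f :: "mat2 \<Rightarrow> real" and U V :: mat2
  assumes f: "\<And>x. (f has_derivative blinfun_apply (f' x)) (at x)"
             "\<And>x. (f' has_derivative blinfun_apply (f'' x)) (at x)"
    and a: "\<And>s. (a has_real_derivative a1 s) (at s)" "\<And>s. (a1 has_real_derivative a2 s) (at s)"
    and b: "\<And>s. (b has_real_derivative b1 s) (at s)" "\<And>s. (b1 has_real_derivative b2 s) (at s)"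
  shows "(deriv ^^ 2) (\<lambda>s. f (a s *\<^sub>R U + b s *\<^sub>R V)) 0
     = blinfun_apply (blinfun_apply (f'' (a 0 *\<^sub>R U + b 0 *\<^sub>R V)) (a1 0 *\<^sub>R U + b1 0 *\<^sub>R V)) (a1 0 *\<^sub>R U + b1 0 *\<^sub>R V)
       + blinfun_apply (f' (a 0 *\<^sub>R U + b 0 *\<^sub>R V)) (a2 0 *\<^sub>R U + b2 0 *\<^sub>R V)"
proof -
  define \<gamma> \<gamma>1 \<gamma>2 where "\<gamma> s = a s *\<^sub>R U + b s *\<^sub>R V" and "\<gamma>1 s = a1 s *\<^sub>R U + b1 s *\<^sub>R V"
    and "\<gamma>2 s = a2 s *\<^sub>R U + b2 s *\<^sub>R V" for s
  have \<gamma>: "(\<gamma> has_vector_derivative \<gamma>1 s) (at s)" "(\<gamma>1 has_vector_derivative \<gamma>2 s) (at s)" for s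
    unfolding \<gamma>_def \<gamma>1_def \<gamma>2_def
    by (auto intro!: derivative_eq_intros has_vector_derivative_scaleR[THEN has_vector_derivative_eq_rhs] a b)
  have 1: "((\<lambda>s. f (\<gamma> s)) has_real_derivative blinfun_apply (f' (\<gamma> s)) (\<gamma>1 s)) (at s)" for s
    unfolding has_field_derivative_def
    by (rule has_derivative_eq_rhs[OF has_derivative_compose[OF \<gamma>(1)[unfolded has_vector_derivative_def] f(1)]])
       (simp add: blinfun.scaleR_right fun_eq_iff)
  have 2: "((\<lambda>s. blinfun_apply (f' (\<gamma> s)) (\<gamma>1 s)) has_real_derivative
     blinfun_apply (blinfun_apply (f'' (\<gamma> s)) (\<gamma>1 s)) (\<gamma>1 s) + blinfun_apply (f' (\<gamma> s)) (\<gamma>2 s)) (at s)" for s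
  proof -
    have "((\<lambda>s. f' (\<gamma> s)) has_derivative (\<lambda>h. blinfun_apply (f'' (\<gamma> s)) (h *\<^sub>R \<gamma>1 s))) (at s)"
      using has_derivative_compose[OF \<gamma>(1)[unfolded has_vector_derivative_def] f(2), of s] .
    from blinfun.FDERIV[OF this \<gamma>(2)[unfolded has_vector_derivative_def]]
    show ?thesis unfolding has_field_derivative_def
      by (rule has_derivative_eq_rhs) (auto simp: blinfun.scaleR_right blinfun.scaleR_left algebra_simps)
  qed
  show ?thesis
    using second_deriv_eq[of "\<lambda>s. f (\<gamma> s)", OF 1 2] by (simp add: \<gamma>_def \<gamma>1_def \<gamma>2_def)
qed

text \<open>Needed for measurability under the laws. Iterated \<open>deriv\<close> hides the
  dependence on \<open>g\<close>, but both subgroups are scalar combinations of two fixed matrices,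
  so \<open>subLap f\<close> can be expressed through the continuous derivatives \<open>f'\<close>
  and \<open>f''\<close>.\<close>

lemma subLap_continuous:
  assumes "C2_fun f"
  shows "continuous_on UNIV (subLap f)"
proof -
  obtain f' f'' where f: "\<And>x. (f has_derivative blinfun_apply (f' x)) (at x)"
      "\<And>x. (f' has_derivative blinfun_apply (f'' x)) (at x)" "continuous_on UNIV f''"
    using assms unfolding C2_fun_def by blast
  have f': "continuous_on UNIV f'"
    using f(2) by (intro continuous_at_imp_continuous_on) (auto intro: has_derivative_continuous)
  define A1 A2 B1 B2 :: mat2 where "A1 = vector [vector [1, 0], vector [0, 0]]" and "A2 = vector [vector [0, 0], vector [0, 1]]"
    and "B1 = vector [vector [1, 0], vector [0, 1]]" and "B2 = vector [vector [0, 1], vector [1, 0]]"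
  have X: "g ** expX s = exp (s/2) *\<^sub>R (g ** A1) + exp (-(s/2)) *\<^sub>R (g ** A2)" for g s
    by (simp add: vec_eq_iff forall_2 matrix_matrix_mult_def sum_2 expX_def A1_def A2_def)
  have Y: "g ** expY s = cosh (s/2) *\<^sub>R (g ** B1) + sinh (s/2) *\<^sub>R (g ** B2)" for g s
    by (simp add: vec_eq_iff forall_2 matrix_matrix_mult_def sum_2 expY_def B1_def B2_def algebra_simps)
  have c: "continuous_on UNIV (\<lambda>g::mat2. g ** M)" for M
    unfolding matrix_matrix_mult_def by (intro continuous_intros)
  have D: "((\<lambda>s. exp (s/2)) has_real_derivative exp (s/2) / 2) (at s)"
    "((\<lambda>s. exp (s/2) / 2) has_real_derivative exp (s/2) / 4) (at s)"
    "((\<lambda>s. exp (-(s/2))) has_real_derivative - exp (-(s/2)) / 2) (at s)"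
    "((\<lambda>s. - exp (-(s/2)) / 2) has_real_derivative exp (-(s/2)) / 4) (at s)"
    "((\<lambda>s. cosh (s/2)) has_real_derivative sinh (s/2) / 2) (at s)"
    "((\<lambda>s. sinh (s/2) / 2) has_real_derivative cosh (s/2) / 4) (at s)"
    "((\<lambda>s. sinh (s/2)) has_real_derivative cosh (s/2) / 2) (at s)"
    "((\<lambda>s. cosh (s/2) / 2) has_real_derivative sinh (s/2) / 4) (at s)" for s :: real
    by (auto intro!: derivative_eq_intros)
  show ?thesis
    unfolding subLap_def X Y second_deriv_along_curve[OF f(1,2) D(1-4)] second_deriv_along_curve[OF f(1,2) D(5-8)]
    by (intro continuous_intros blinfun.continuous_on continuous_on_compose2[OF f(3)] continuous_on_compose2[OF f'] c) auto
qed

lemma C2_fun_continuous: "C2_fun f \<Longrightarrow> continuous_on UNIV f"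
  unfolding C2_fun_def
  by (intro continuous_at_imp_continuous_on ballI) (metis has_derivative_continuous)

section \<open>Means of waves under the laws\<close>

lemma SL2_iw_q: "x \<in> SL2 \<Longrightarrow> iw_q x > 0"
  unfolding iw_q_def by (rule sq_pos_of_det[of "x$1$1" _ "x$1$2"]) (simp add: SL2_def det_2)

lemma norm_wave: "x \<in> SL2 \<Longrightarrow> norm (wave p m F x) = norm (F (of_real (iw_v x)))"
  by (simp add: wave_def norm_mult norm_power_int norm_iw_w SL2_iw_q)

lemma pos_cube_cut_arg: "0 \<le> pos_cube (cut_arg R x)" "pos_cube (cut_arg R x) \<le> 1"
proof -
  have "cut_arg R x \<le> 1"
    unfolding cut_arg_def using zero_le_power2[of "ln (1 + sq_norm x) / R"] zero_le_power2[of "det x - 1"] by linarith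
  then show "0 \<le> pos_cube (cut_arg R x)" "pos_cube (cut_arg R x) \<le> 1" by (auto simp: pos_cube_def intro!: power_le_one)
qed

lemma closed_SL2: "closed SL2"
  unfolding SL2_def det_2 by (intro closed_Collect_eq continuous_intros)

lemma strip_bd_norm_wave: "strip_bd r A B F \<Longrightarrow> r > 0 \<Longrightarrow> x \<in> SL2 \<Longrightarrow> norm (wave p m F x) \<le> B"
  using strip_bd_bound[of r A B F "of_real (iw_v x)" 0] by (simp add: norm_wave of_real_strip)

lemma abs_cut_wave_le: "strip_bd r A B F \<Longrightarrow> r > 0 \<Longrightarrow> x \<in> SL2 \<Longrightarrow> \<bar>cut_wave R p m F x\<bar> \<le> B"
proof -
  assume *: "strip_bd r A B F" "r > 0" "x \<in> SL2"
  have "\<bar>cut_wave R p m F x\<bar> \<le> 1 * norm (wave p m F x)"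
    unfolding cut_wave_def abs_mult using pos_cube_cut_arg by (intro mult_mono abs_Re_le_cmod) auto
  then show ?thesis using strip_bd_norm_wave[OF *, of p m] by simp
qed

lemma cut_wave_tendsto:
  assumes "x \<in> SL2"
  shows "(\<lambda>n. cut_wave (real n) p m F x) \<longlonglongrightarrow> Re (wave p m F x)"
proof -
  have "(\<lambda>n. ln (1 + sq_norm x) / real n) \<longlonglongrightarrow> 0" by (rule lim_const_over_n)
  then have "(\<lambda>n. (max 0 (1 - (ln (1 + sq_norm x) / real n)\<^sup>2)) ^ 3 * Re (wave p m F x)) \<longlonglongrightarrow> (max 0 (1 - 0\<^sup>2)) ^ 3 * Re (wave p m F x)"
    by (intro tendsto_intros)
  then show ?thesis using assms by (simp add: cut_wave_def cut_arg_def pos_cube_def SL2_def)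
qed

lemma generator_bound:
  assumes "r > 0"
  shows "\<exists>K\<ge>0. \<forall>B F x R. strip_bd r 2 B F \<longrightarrow> x \<in> SL2 \<longrightarrow> R \<ge> 1 \<longrightarrow>
     \<bar>subLap (cut_wave R p m F) x / 2 - cut_wave R p m (gen_op p m F) x\<bar> \<le> K * B / R"
proof -
  obtain K1 where K1: "K1 \<ge> 0" "\<And>B F. strip_bd r 0 B F \<Longrightarrow> strip_bd (r/2) 0 (K1 * B) (deriv F)"
    using strip_bd_deriv[of "r/2" r 0] assms by auto
  define K where "K = 36 * (1 + (\<bar>p\<bar> + \<bar>of_int m / 2\<bar>) + K1)"
  have "\<bar>subLap (cut_wave R p m F) x / 2 - cut_wave R p m (gen_op p m F) x\<bar> \<le> K * B / R"
    if F: "strip_bd r 2 B F" and x: "x \<in> SL2" and R: "R \<ge> 1" for B F x R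
  proof -
    define v where "v = complex_of_real (iw_v x)"
    have v: "v \<in> strip r" "v \<in> strip (r/2)" using assms by (auto simp: v_def of_real_strip)
    have 1: "norm (F v) \<le> B" using strip_bd_bound[OF F v(1), of 0] by simp
    have "strip_bd r 0 B F" by (rule strip_bd_mono[OF F]) auto
    from strip_bd_bound[OF K1(2)[OF this] v(2), of 0] have 2: "norm (deriv F v) \<le> K1 * B" by simp
    have 3: "norm (F v) * exp (iw_v x) \<le> B" using strip_bdD(2)[OF F v(1), of 1] by (simp add: v_def)
    have "norm ((of_real p * exp v + of_int m / 2) * F v) = norm (of_real p * (exp v * F v) + of_real (of_int m / 2) * F v)"
      by (simp add: algebra_simps)
    also have "\<dots> \<le> \<bar>p\<bar> * (norm (F v) * exp (iw_v x)) + \<bar>of_int m / 2\<bar> * norm (F v)"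
      by (rule order_trans[OF norm_triangle_ineq]) (simp only: norm_mult norm_of_real norm_exp_eq_Re v_def Re_complex_of_real, simp)
    also have "\<dots> \<le> \<bar>p\<bar> * B + \<bar>of_int m / 2\<bar> * B" using 1 3 by (intro add_mono mult_left_mono) auto
    finally have "norm (F v) + norm ((of_real p * exp v + of_int m / 2) * F v) + norm (deriv F v) \<le> (1 + (\<bar>p\<bar> + \<bar>of_int m / 2\<bar>) + K1) * B"
      using 1 2 by (simp add: algebra_simps)
    from subLap_cut_wave[OF x strip_bdD(1)[OF F] assms R this[unfolded v_def]]
    show ?thesis unfolding K_def cut_wave_def by (simp only: mult.assoc)
  qed
  moreover have "K \<ge> 0" using K1 by (simp add: K_def)
  ultimately show ?thesis by blast
qed

text \<open>Off \<open>SL2\<close> the bottom row may vanish and the coordinates take default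
  values. The indicator discards these points, which the laws do not charge, and keeps the integrand
  bounded.\<close>

definition wave_mean :: "mat2 measure \<Rightarrow> real \<Rightarrow> int \<Rightarrow> (complex \<Rightarrow> complex) \<Rightarrow> real" where
  "wave_mean M p m F = integral\<^sup>L M (\<lambda>x. indicator SL2 x * Re (wave p m F x))"

locale SL2_prob = prob_space M for M :: "mat2 measure" +
  assumes sets_M: "sets M = sets borel" and SL2_M: "measure M SL2 = 1"
begin

lemma SL2_sets: "SL2 \<in> sets M"
  using closed_SL2 sets_M by simp

lemma AE_SL2: "AE x in M. x \<in> SL2"
  using SL2_M by (rule AE_prob_1)

lemma borel_continuous: "continuous_on UNIV f \<Longrightarrow> (f :: mat2 \<Rightarrow> real) \<in> borel_measurable M"
  by (simp add: borel_measurable_continuous_onI measurable_cong_sets[OF sets_M refl])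

lemma integrable_SL2:
  fixes f :: "mat2 \<Rightarrow> real"
  assumes "f \<in> borel_measurable M" "\<And>x. x \<in> SL2 \<Longrightarrow> \<bar>f x\<bar> \<le> B"
  shows "integrable M f"
  using AE_SL2 assms by (intro integrable_const_bound[where B=B]) (auto elim!: eventually_mono)

lemma integral_bound_SL2:
  fixes f :: "mat2 \<Rightarrow> real"
  assumes "f \<in> borel_measurable M" "\<And>x. x \<in> SL2 \<Longrightarrow> \<bar>f x\<bar> \<le> B"
  shows "\<bar>integral\<^sup>L M f\<bar> \<le> B"
proof -
  have i: "integrable M f" by (rule integrable_SL2[OF assms])
  have "B \<ge> 0"
  proof -
    obtain x where "x \<in> SL2" using SL2_M by fastforce
    then show ?thesis using assms(2)[of x] by linarith
  qed
  have "\<bar>integral\<^sup>L M f\<bar> \<le> integral\<^sup>L M (\<lambda>x. \<bar>f x\<bar>)" by (rule integral_abs_bound)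
  also have "\<dots> \<le> integral\<^sup>L M (\<lambda>x. B)"
    using i AE_SL2 assms by (intro integral_mono_AE) (auto elim!: eventually_mono)
  also have "\<dots> = B" by (simp add: prob_space)
  finally show ?thesis .
qed

lemma cut_wave_measurable: "F holomorphic_on strip r \<Longrightarrow> r > 0 \<Longrightarrow> R > 0 \<Longrightarrow> cut_wave R p m F \<in> borel_measurable M"
  using test_fun_cut_wave[of F r R p m] by (intro borel_continuous C2_fun_continuous) (simp add: test_fun_def)

lemma subLap_cut_wave_measurable: "F holomorphic_on strip r \<Longrightarrow> r > 0 \<Longrightarrow> R > 0 \<Longrightarrow> (\<lambda>x. subLap (cut_wave R p m F) x / 2) \<in> borel_measurable M"
  using test_fun_cut_wave[of F r R p m] by (intro borel_measurable_divide borel_continuous subLap_continuous) (simp_all add: test_fun_def)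

lemma wave_measurable:
  assumes "F holomorphic_on strip r" "r > 0"
  shows "(\<lambda>x. indicator SL2 x * Re (wave p m F x)) \<in> borel_measurable M"
proof (rule borel_measurable_LIMSEQ_real)
  fix x
  show "(\<lambda>n. indicator SL2 x * cut_wave (real (Suc n)) p m F x) \<longlonglongrightarrow> indicator SL2 x * Re (wave p m F x)"
    using LIMSEQ_Suc[OF cut_wave_tendsto[of x p m F]] by (cases "x \<in> SL2") auto
  show "(\<lambda>x. indicator SL2 x * cut_wave (real (Suc n)) p m F x) \<in> borel_measurable M" for n
    using SL2_sets by (intro borel_measurable_times borel_measurable_indicator cut_wave_measurable[OF assms]) auto
qed

lemma cut_wave_integral_tendsto:
  assumes "strip_bd r A B F" "r > 0"
  shows "(\<lambda>n. integral\<^sup>L M (cut_wave (real (Suc n)) p m F)) \<longlonglongrightarrow> wave_mean M p m F"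
  unfolding wave_mean_def
proof (rule integral_dominated_convergence[where w="\<lambda>x. B"])
  show "AE x in M. (\<lambda>n. cut_wave (real (Suc n)) p m F x) \<longlonglongrightarrow> indicator SL2 x * Re (wave p m F x)"
    using AE_SL2 by (rule eventually_mono) (use LIMSEQ_Suc[OF cut_wave_tendsto] in auto)
  show "AE x in M. norm (cut_wave (real (Suc n)) p m F x) \<le> B" for n
    using AE_SL2 by (rule eventually_mono) (use abs_cut_wave_le[OF assms] in auto)
qed (auto intro!: wave_measurable[OF strip_bdD(1)[OF assms(1)]] cut_wave_measurable[OF strip_bdD(1)[OF assms(1)]] assms)

end

lemma SL2_BM_prob: "SL2_BM_law g \<mu> \<Longrightarrow> t \<ge> 0 \<Longrightarrow> SL2_prob (\<mu> t)"
  unfolding SL2_BM_law_def SL2_prob_def SL2_prob_axioms_def by auto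

lemma SL2_BM_deriv:
  assumes "SL2_BM_law g \<mu>" "strip_bd r A B F" "r > 0" "R > 0" "t \<ge> 0"
  shows "((\<lambda>s. integral\<^sup>L (\<mu> s) (cut_wave R p m F)) has_real_derivative
     integral\<^sup>L (\<mu> t) (\<lambda>y. subLap (cut_wave R p m F) y / 2)) (at t within {0..})"
  using assms test_fun_cut_wave[OF strip_bdD(1)[OF assms(2)], of R p m] unfolding SL2_BM_law_def by auto

text \<open>The constants do not depend on the cut-off radius, which is sent to infinity only in the integrated inequality;
  in this way no differentiability of the limit in time is required.\<close>

lemma BM_step:
  "\<exists>K\<ge>0. \<forall>g \<mu> B F s \<epsilon>. SL2_BM_law g \<mu> \<longrightarrow> strip_bd (1/2) 4 B F \<longrightarrow> s \<ge> 0 \<longrightarrow> \<epsilon> \<ge> 0 \<longrightarrow>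
     \<bar>wave_mean (\<mu> (s + \<epsilon>)) p m F - wave_mean (\<mu> s) p m F - \<epsilon> * wave_mean (\<mu> s) p m (gen_op p m F)\<bar> \<le> K * \<epsilon>\<^sup>2 * B"
proof -
  obtain K1 where K1: "K1 \<ge> 0" "\<And>B F. strip_bd (1/2) 4 B F \<Longrightarrow> strip_bd (1/4) 2 (K1 * B) (gen_op p m F)"
    using strip_bd_gen_op[of "1/4" "1/2" 2 p m] by (auto simp: numeral_eq_Suc)
  obtain K2 where K2: "K2 \<ge> 0" "\<And>B F. strip_bd (1/4) 2 B F \<Longrightarrow> strip_bd (1/8) 0 (K2 * B) (gen_op p m F)"
    using strip_bd_gen_op[of "1/8" "1/4" 0 p m] by (auto simp: numeral_eq_Suc)
  obtain K3 where K3: "K3 \<ge> 0" "\<And>B F x R. strip_bd (1/4) 2 B F \<Longrightarrow> x \<in> SL2 \<Longrightarrow> R \<ge> 1 \<Longrightarrow>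
     \<bar>subLap (cut_wave R p m F) x / 2 - cut_wave R p m (gen_op p m F) x\<bar> \<le> K3 * B / R"
    using generator_bound[of "1/4" p m] by auto
  define K where "K = K3 * K1 + K2 * K1"
  have "\<bar>wave_mean (\<mu> (s + \<epsilon>)) p m F - wave_mean (\<mu> s) p m F - \<epsilon> * wave_mean (\<mu> s) p m (gen_op p m F)\<bar> \<le> K * \<epsilon>\<^sup>2 * B"
    if bm: "SL2_BM_law g \<mu>" and F: "strip_bd (1/2) 4 B F" and s: "s \<ge> 0" and e: "\<epsilon> \<ge> 0" for g \<mu> B F s \<epsilon>
  proof -
    define G where "G = gen_op p m F"
    have F': "strip_bd (1/4) 2 B F" by (rule strip_bd_mono[OF F]) auto
    have G: "strip_bd (1/4) 2 (K1 * B) G" unfolding G_def by (rule K1(2)[OF F])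
    have GG: "strip_bd (1/8) 0 (K2 * (K1 * B)) (gen_op p m G)" by (rule K2(2)[OF G])
    have B: "B \<ge> 0" by (rule strip_bd_nonneg[OF F]) simp
    have step: "\<bar>integral\<^sup>L (\<mu> (s + \<epsilon>)) (cut_wave R p m F) - integral\<^sup>L (\<mu> s) (cut_wave R p m F) - \<epsilon> * integral\<^sup>L (\<mu> s) (cut_wave R p m G)\<bar>
       \<le> (K3 * B / R + K * B * \<epsilon>) * \<epsilon>" if R: "R \<ge> 1" for R
    proof -
      have a: "\<bar>integral\<^sup>L (\<mu> u) (\<lambda>y. subLap (cut_wave R p m F) y / 2) - integral\<^sup>L (\<mu> u) (cut_wave R p m G)\<bar> \<le> K3 * B / R"
        if u: "u \<ge> 0" for u
      proof -
        interpret SL2_prob "\<mu> u" by (rule SL2_BM_prob[OF bm u])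
        have m: "(\<lambda>y. subLap (cut_wave R p m F) y / 2) \<in> borel_measurable (\<mu> u)" "cut_wave R p m G \<in> borel_measurable (\<mu> u)"
          using R by (auto intro!: subLap_cut_wave_measurable[OF strip_bdD(1)[OF F']] cut_wave_measurable[OF strip_bdD(1)[OF G]])
        have bG: "\<bar>cut_wave R p m G x\<bar> \<le> K1 * B" if "x \<in> SL2" for x using abs_cut_wave_le[OF G _ that] by simp
        have d: "\<bar>subLap (cut_wave R p m F) x / 2 - cut_wave R p m G x\<bar> \<le> K3 * B / R" if "x \<in> SL2" for x
          using K3(2)[OF F' that R] by (simp add: G_def)
        have i: "integrable (\<mu> u) (cut_wave R p m G)" by (rule integrable_SL2[OF m(2) bG])
        have "integrable (\<mu> u) (\<lambda>y. subLap (cut_wave R p m F) y / 2)"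
          by (rule integrable_SL2[OF m(1), of "K1 * B + K3 * B / R"]) (use bG d in \<open>smt (verit)\<close>)
        then have "integral\<^sup>L (\<mu> u) (\<lambda>y. subLap (cut_wave R p m F) y / 2) - integral\<^sup>L (\<mu> u) (cut_wave R p m G)
          = integral\<^sup>L (\<mu> u) (\<lambda>y. subLap (cut_wave R p m F) y / 2 - cut_wave R p m G y)" using i by simp
        then show ?thesis using integral_bound_SL2[OF borel_measurable_diff[OF m] d] by simp
      qed
      have b: "\<bar>integral\<^sup>L (\<mu> u) (\<lambda>y. subLap (cut_wave R p m G) y / 2)\<bar> \<le> K * B" if u: "u \<ge> 0" for u
      proof -
        interpret SL2_prob "\<mu> u" by (rule SL2_BM_prob[OF bm u])
        have m: "(\<lambda>y. subLap (cut_wave R p m G) y / 2) \<in> borel_measurable (\<mu> u)"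
          using R by (auto intro!: subLap_cut_wave_measurable[OF strip_bdD(1)[OF G]])
        show ?thesis
        proof (rule integral_bound_SL2[OF m])
          fix x assume x: "x \<in> SL2"
          have "\<bar>cut_wave R p m (gen_op p m G) x\<bar> \<le> K2 * (K1 * B)" using abs_cut_wave_le[OF GG _ x] by simp
          moreover have "\<bar>subLap (cut_wave R p m G) x / 2 - cut_wave R p m (gen_op p m G) x\<bar> \<le> K3 * (K1 * B) / R"
            by (rule K3(2)[OF G x R])
          moreover have "K3 * (K1 * B) / R \<le> K3 * (K1 * B) / 1"
            using K1(1) K3(1) B R by (intro divide_left_mono) auto
          ultimately have "\<bar>subLap (cut_wave R p m G) x / 2\<bar> \<le> K2 * (K1 * B) + K3 * (K1 * B)" by linarith
          then show "\<bar>subLap (cut_wave R p m G) x / 2\<bar> \<le> K * B" by (simp add: K_def algebra_simps)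
        qed
      qed
      \<comment> \<open>The forward equation is used a second time, now for the amplitude
        \<open>G\<close>; this is what requires the bound on \<open>gen_op p m G\<close>.\<close>
      have c: "\<bar>integral\<^sup>L (\<mu> u) (cut_wave R p m G) - integral\<^sup>L (\<mu> s) (cut_wave R p m G)\<bar> \<le> K * B * \<epsilon>" if u: "u \<in> {s..s+\<epsilon>}" for u
      proof -
        have "norm (integral\<^sup>L (\<mu> u) (cut_wave R p m G) - integral\<^sup>L (\<mu> s) (cut_wave R p m G)) \<le> K * B * norm (u - s)"
        proof (rule field_differentiable_bound[of "{0..}" _ "\<lambda>t. integral\<^sup>L (\<mu> t) (\<lambda>y. subLap (cut_wave R p m G) y / 2)"])
          show "((\<lambda>s. integral\<^sup>L (\<mu> s) (cut_wave R p m G)) has_real_derivative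
             integral\<^sup>L (\<mu> t) (\<lambda>y. subLap (cut_wave R p m G) y / 2)) (at t within {0..})" if "t \<in> {0..}" for t
            using SL2_BM_deriv[OF bm G] R that by auto
        qed (use b u s in auto)
        also have "\<dots> \<le> K * B * \<epsilon>"
          using u K1(1) K2(1) K3(1) B by (intro mult_left_mono) (auto simp: K_def)
        finally show ?thesis by simp
      qed
      \<comment> \<open>Removing the linear term turns the mean value inequality into a first-order
        Taylor estimate.\<close>
      define \<phi> where "\<phi> u = integral\<^sup>L (\<mu> u) (cut_wave R p m F) - u * integral\<^sup>L (\<mu> s) (cut_wave R p m G)" for u
      have "norm (\<phi> (s + \<epsilon>) - \<phi> s) \<le> (K3 * B / R + K * B * \<epsilon>) * norm ((s + \<epsilon>) - s)"
      proof (rule field_differentiable_bound[of "{s..s+\<epsilon>}" _ "\<lambda>t. integral\<^sup>L (\<mu> t) (\<lambda>y. subLap (cut_wave R p m F) y / 2) - integral\<^sup>L (\<mu> s) (cut_wave R p m G)"])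
        fix t assume t: "t \<in> {s..s+\<epsilon>}"
        have "((\<lambda>s. integral\<^sup>L (\<mu> s) (cut_wave R p m F)) has_real_derivative
             integral\<^sup>L (\<mu> t) (\<lambda>y. subLap (cut_wave R p m F) y / 2)) (at t within {0..})"
          using SL2_BM_deriv[OF bm F'] R t s by auto
        then have "((\<lambda>s. integral\<^sup>L (\<mu> s) (cut_wave R p m F)) has_real_derivative
             integral\<^sup>L (\<mu> t) (\<lambda>y. subLap (cut_wave R p m F) y / 2)) (at t within {s..s+\<epsilon>})"
          by (rule DERIV_subset) (use s in auto)
        then show "(\<phi> has_real_derivative integral\<^sup>L (\<mu> t) (\<lambda>y. subLap (cut_wave R p m F) y / 2) - integral\<^sup>L (\<mu> s) (cut_wave R p m G)) (at t within {s..s+\<epsilon>})"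
          unfolding \<phi>_def by (auto intro!: derivative_eq_intros)
        show "norm (integral\<^sup>L (\<mu> t) (\<lambda>y. subLap (cut_wave R p m F) y / 2) - integral\<^sup>L (\<mu> s) (cut_wave R p m G)) \<le> K3 * B / R + K * B * \<epsilon>"
          using a[of t] c[OF t] t s by (simp only: real_norm_def atLeastAtMost_iff) linarith
      qed (use e in auto)
      then show ?thesis using e by (simp add: \<phi>_def algebra_simps)
    qed
    have lim: "(\<lambda>n. integral\<^sup>L (\<mu> u) (cut_wave (real (Suc n)) p m H)) \<longlonglongrightarrow> wave_mean (\<mu> u) p m H"
      if "u \<ge> 0" "strip_bd (1/4) 2 B' H" for u B' H
    proof -
      interpret SL2_prob "\<mu> u" by (rule SL2_BM_prob[OF bm that(1)])
      show ?thesis by (rule cut_wave_integral_tendsto[OF that(2)]) simp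
    qed
    have "(\<lambda>n. \<bar>integral\<^sup>L (\<mu> (s + \<epsilon>)) (cut_wave (real (Suc n)) p m F) - integral\<^sup>L (\<mu> s) (cut_wave (real (Suc n)) p m F) - \<epsilon> * integral\<^sup>L (\<mu> s) (cut_wave (real (Suc n)) p m G)\<bar>)
        \<longlonglongrightarrow> \<bar>wave_mean (\<mu> (s + \<epsilon>)) p m F - wave_mean (\<mu> s) p m F - \<epsilon> * wave_mean (\<mu> s) p m G\<bar>"
      using s e by (intro tendsto_intros lim[OF _ F'] lim[OF _ G]) auto
    moreover have "(\<lambda>n. (K3 * B / real (Suc n) + K * B * \<epsilon>) * \<epsilon>) \<longlonglongrightarrow> (0 + K * B * \<epsilon>) * \<epsilon>"
      by (intro tendsto_intros LIMSEQ_Suc[OF lim_const_over_n])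
    ultimately have "\<bar>wave_mean (\<mu> (s + \<epsilon>)) p m F - wave_mean (\<mu> s) p m F - \<epsilon> * wave_mean (\<mu> s) p m G\<bar> \<le> (0 + K * B * \<epsilon>) * \<epsilon>"
      by (rule LIMSEQ_le) (use step in auto)
    then show ?thesis by (simp add: G_def power2_eq_square algebra_simps)
  qed
  moreover have "K \<ge> 0" using K1 K2 K3 by (simp add: K_def)
  ultimately show ?thesis by blast
qed

section \<open>Telescoping along the walk\<close>

lemma (in SL2_prob) wave_mean_walk_op_bound:
  assumes F: "strip_bd (1/2) 4 B F" and e: "\<And>v. norm (walk_op p m \<epsilon> F (of_real v) - F (of_real v) - of_real \<epsilon> * gen_op p m F (of_real v)) \<le> D"
    and S: "strip_bd (1/2) 4 B' (walk_op p m \<epsilon> F)"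
  shows "\<bar>wave_mean M p m (walk_op p m \<epsilon> F) - wave_mean M p m F - \<epsilon> * wave_mean M p m (gen_op p m F)\<bar> \<le> D"
proof -
  obtain K1 where K1: "strip_bd (1/4) 2 (K1 * B) (gen_op p m F)"
    using strip_bd_gen_op[of "1/4" "1/2" 2 p m] F by (auto simp: numeral_eq_Suc)
  define h where "h F x = indicator SL2 x * Re (wave p m F x)" for F x
  have hm: "h F \<in> borel_measurable M" "integrable M (h F)" if "strip_bd r A B F" "r > 0" for r A B F
  proof -
    show m: "h F \<in> borel_measurable M" unfolding h_def by (rule wave_measurable[OF strip_bdD(1)[OF that(1)] that(2)])
    show "integrable M (h F)"
    proof (rule integrable_SL2[OF m])
      fix x assume "x \<in> SL2"
      then show "\<bar>h F x\<bar> \<le> B" using abs_Re_le_cmod[of "wave p m F x"] strip_bd_norm_wave[OF that \<open>x \<in> SL2\<close>, of p m] by (simp add: h_def)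
    qed
  qed
  note i = hm(2)[OF S] hm(2)[OF F] hm(2)[OF K1]
  have "wave_mean M p m (walk_op p m \<epsilon> F) - wave_mean M p m F - \<epsilon> * wave_mean M p m (gen_op p m F) =
    integral\<^sup>L M (\<lambda>x. h (walk_op p m \<epsilon> F) x - h F x - \<epsilon> * h (gen_op p m F) x)"
    unfolding wave_mean_def h_def[symmetric] using i by simp
  also have "\<bar>\<dots>\<bar> \<le> D"
  proof (rule integral_bound_SL2)
    show "(\<lambda>x. h (walk_op p m \<epsilon> F) x - h F x - \<epsilon> * h (gen_op p m F) x) \<in> borel_measurable M"
      by (intro borel_measurable_diff borel_measurable_times borel_measurable_const hm(1)[OF S] hm(1)[OF F] hm(1)[OF K1]) auto
    fix x assume x: "x \<in> SL2"
    define E where "E = cis (p * iw_x x) * iw_w x powi m"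
    have HHE: "wave p m H x = E * H (of_real (iw_v x))" for H by (simp add: wave_def E_def)
    have E: "norm E = 1" by (simp add: E_def norm_mult norm_power_int norm_iw_w SL2_iw_q x)
    have "h (walk_op p m \<epsilon> F) x - h F x - \<epsilon> * h (gen_op p m F) x =
      Re (E * (walk_op p m \<epsilon> F (of_real (iw_v x)) - F (of_real (iw_v x)) - of_real \<epsilon> * gen_op p m F (of_real (iw_v x))))"
      using x by (simp add: h_def HHE algebra_simps)
    also have "\<bar>\<dots>\<bar> \<le> norm (E * (walk_op p m \<epsilon> F (of_real (iw_v x)) - F (of_real (iw_v x)) - of_real \<epsilon> * gen_op p m F (of_real (iw_v x))))"
      by (rule abs_Re_le_cmod)
    also have "\<dots> \<le> D" using e[of "iw_v x"] by (simp add: norm_mult E)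
    finally show "\<bar>h (walk_op p m \<epsilon> F) x - h F x - \<epsilon> * h (gen_op p m F) x\<bar> \<le> D" .
  qed
  finally show ?thesis .
qed

text \<open>After \<open>k\<close> steps of the walk on the amplitude the mean is taken under the
  law at time \<open>t - k * \<epsilon>\<close>. Consecutive values differ by
  \<open>O(\<epsilon>\<^sup>2)\<close>, and the last one is taken under the Dirac mass at
  \<open>g\<close>. The constant does not depend on \<open>g\<close>, so it serves both laws at
  once.\<close>

lemma BM_walk_limit:
  assumes F: "strip_bd (1/2) 4 B F" and t: "t > 0"
  shows "\<exists>K\<ge>0. \<forall>g \<mu> n. SL2_BM_law g \<mu> \<longrightarrow> g \<in> SL2 \<longrightarrow> real n \<ge> t \<longrightarrow>
     \<bar>wave_mean (\<mu> t) p m F - Re (wave p m ((walk_op p m (t / n) ^^ n) F) g)\<bar> \<le> K / n"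
proof -
  obtain K1 where K1: "K1 \<ge> 0" "\<And>g \<mu> B F s \<epsilon>. SL2_BM_law g \<mu> \<Longrightarrow> strip_bd (1/2) 4 B F \<Longrightarrow> s \<ge> 0 \<Longrightarrow> \<epsilon> \<ge> 0 \<Longrightarrow>
     \<bar>wave_mean (\<mu> (s + \<epsilon>)) p m F - wave_mean (\<mu> s) p m F - \<epsilon> * wave_mean (\<mu> s) p m (gen_op p m F)\<bar> \<le> K1 * \<epsilon>\<^sup>2 * B"
    using BM_step[of p m] by blast
  obtain K2 where K2: "K2 \<ge> 0" "\<And>B F \<epsilon> v. strip_bd (1/2) 4 B F \<Longrightarrow> 0 \<le> \<epsilon> \<Longrightarrow> \<epsilon> \<le> 1 \<Longrightarrow>
     norm (walk_op p m \<epsilon> F (of_real v) - F (of_real v) - of_real \<epsilon> * gen_op p m F (of_real v)) \<le> K2 * \<epsilon>\<^sup>2 * B"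
    using walk_op_consistent[of p m] by blast
  obtain K3 where K3: "K3 \<ge> 0" "\<And>B F \<epsilon>. strip_bd (1/2) 4 B F \<Longrightarrow> 0 \<le> \<epsilon> \<Longrightarrow> \<epsilon> \<le> 1 \<Longrightarrow> strip_bd (1/2) 4 (exp (K3 * \<epsilon>) * B) (walk_op p m \<epsilon> F)"
    using strip_bd_walk_op[of 4 p m] by blast
  define B' where "B' = exp (K3 * t) * B"
  define K where "K = (K1 + K2) * B' * t\<^sup>2"
  have B: "B \<ge> 0" by (rule strip_bd_nonneg[OF F]) simp
  have B': "B' \<ge> 0" using B by (simp add: B'_def)
  have "\<bar>wave_mean (\<mu> t) p m F - Re (wave p m ((walk_op p m (t / n) ^^ n) F) g)\<bar> \<le> K / n"
    if bm: "SL2_BM_law g \<mu>" and g: "g \<in> SL2" and n: "real n \<ge> t" for g \<mu> n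
  proof -
    have n0: "real n > 0" using n t by linarith
    define \<epsilon> where "\<epsilon> = t / n"
    have e: "0 \<le> \<epsilon>" "\<epsilon> \<le> 1" using n n0 t by (auto simp: \<epsilon>_def)
    have ne: "real n * \<epsilon> = t" using n0 by (simp add: \<epsilon>_def)
    define Fk where "Fk k = (walk_op p m \<epsilon> ^^ k) F" for k
    have cl0: "strip_bd (1/2) 4 (exp (K3 * (real k * \<epsilon>)) * B) (Fk k)" for k
    proof (induction k)
      case 0
      then show ?case using F by (simp add: Fk_def)
    next
      case (Suc k)
      have "K3 * (real (Suc k) * \<epsilon>) = K3 * \<epsilon> + K3 * (real k * \<epsilon>)" by (simp add: algebra_simps)
      then have "exp (K3 * \<epsilon>) * (exp (K3 * (real k * \<epsilon>)) * B) = exp (K3 * (real (Suc k) * \<epsilon>)) * B"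
        by (simp only: exp_add mult.assoc)
      then show ?case using K3(2)[OF Suc e] by (simp only: Fk_def funpow.simps o_apply)
    qed
    have cl: "strip_bd (1/2) 4 B' (Fk k)" if "k \<le> n" for k
    proof (rule strip_bd_mono[OF cl0])
      have "real k * \<epsilon> \<le> real n * \<epsilon>" using that e by (intro mult_right_mono) auto
      then have "K3 * (real k * \<epsilon>) \<le> K3 * t" using K3(1) ne by (intro mult_left_mono) auto
      then show "exp (K3 * (real k * \<epsilon>)) * B \<le> B'" unfolding B'_def using B by (intro mult_right_mono) auto
    qed auto
    define a where "a k = wave_mean (\<mu> (t - real k * \<epsilon>)) p m (Fk k)" for k
    have st: "\<bar>a k - a (Suc k)\<bar> \<le> (K1 + K2) * \<epsilon>\<^sup>2 * B'" if k: "k < n" for k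
    proof -
      define s where "s = t - real (Suc k) * \<epsilon>"
      have "real (Suc k) * \<epsilon> \<le> real n * \<epsilon>" using k e by (intro mult_right_mono) auto
      then have s: "s \<ge> 0" using ne by (simp add: s_def)
      have s1: "t - real k * \<epsilon> = s + \<epsilon>" by (simp add: s_def algebra_simps)
      interpret SL2_prob "\<mu> s" by (rule SL2_BM_prob[OF bm s])
      have c: "strip_bd (1/2) 4 B' (Fk k)" "strip_bd (1/2) 4 B' (Fk (Suc k))" using cl k by auto
      have "\<bar>wave_mean (\<mu> (s + \<epsilon>)) p m (Fk k) - wave_mean (\<mu> s) p m (Fk k) - \<epsilon> * wave_mean (\<mu> s) p m (gen_op p m (Fk k))\<bar> \<le> K1 * \<epsilon>\<^sup>2 * B'"
        by (rule K1(2)[OF bm c(1) s e(1)])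
      moreover have "\<bar>wave_mean (\<mu> s) p m (walk_op p m \<epsilon> (Fk k)) - wave_mean (\<mu> s) p m (Fk k) - \<epsilon> * wave_mean (\<mu> s) p m (gen_op p m (Fk k))\<bar> \<le> K2 * \<epsilon>\<^sup>2 * B'"
        using c(2) by (intro wave_mean_walk_op_bound[OF c(1)] K2(2)[OF c(1) e]) (auto simp: Fk_def)
      ultimately have "\<bar>wave_mean (\<mu> (s + \<epsilon>)) p m (Fk k) - wave_mean (\<mu> s) p m (walk_op p m \<epsilon> (Fk k))\<bar> \<le> K1 * \<epsilon>\<^sup>2 * B' + K2 * \<epsilon>\<^sup>2 * B'"
        by linarith
      then show ?thesis unfolding a_def s1 s_def[symmetric] by (simp add: Fk_def algebra_simps)
    qed
    have tel: "\<bar>a 0 - a k\<bar> \<le> real k * ((K1 + K2) * \<epsilon>\<^sup>2 * B')" if "k \<le> n" for k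
      using that
    proof (induction k)
      case (Suc k)
      then have "\<bar>a 0 - a k\<bar> \<le> real k * ((K1 + K2) * \<epsilon>\<^sup>2 * B')" "k < n" by auto
      then have "\<bar>a 0 - a (Suc k)\<bar> \<le> real k * ((K1 + K2) * \<epsilon>\<^sup>2 * B') + (K1 + K2) * \<epsilon>\<^sup>2 * B'"
        using st[of k] by linarith
      then show ?case unfolding of_nat_Suc distrib_right by simp
    qed simp
    have "a n = Re (wave p m (Fk n) g)"
    proof -
      have "\<mu> 0 = return borel g" using bm by (simp add: SL2_BM_law_def)
      moreover interpret SL2_prob "\<mu> 0" by (rule SL2_BM_prob[OF bm]) simp
      have "(\<lambda>x. indicator SL2 x * Re (wave p m (Fk n) x)) \<in> borel_measurable (\<mu> 0)"
        by (rule wave_measurable[OF strip_bdD(1)[OF cl[of n]]]) auto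
      ultimately show ?thesis
        using g ne by (simp add: a_def wave_mean_def integral_return measurable_cong_sets[OF sets_return refl])
    qed
    moreover have "a 0 = wave_mean (\<mu> t) p m F" by (simp add: a_def Fk_def)
    moreover have "real n * ((K1 + K2) * \<epsilon>\<^sup>2 * B') = K / n"
      using n0 by (simp add: K_def \<epsilon>_def power2_eq_square field_simps)
    ultimately show ?thesis using tel[of n] by (simp add: Fk_def \<epsilon>_def)
  qed
  moreover have "K \<ge> 0" using K1 K2 B' by (simp add: K_def)
  ultimately show ?thesis by blast
qed

section \<open>Coin tossing paths\<close>

text \<open>The expectation over fair coin tosses. Conditioning on the first toss is also the
  recursion of \<open>walk_op\<close>, so no product measure is needed; the general field allows
  real and complex integrands.\<close>

fun coin_mean :: "nat \<Rightarrow> (bool list \<Rightarrow> 'a::real_normed_field) \<Rightarrow> 'a" where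
  "coin_mean 0 \<phi> = \<phi> []"
| "coin_mean (Suc n) \<phi> = (coin_mean n (\<lambda>xs. \<phi> (True # xs)) + coin_mean n (\<lambda>xs. \<phi> (False # xs))) / 2"

lemma coin_mean_cong: "(\<And>xs. length xs = n \<Longrightarrow> \<phi> xs = \<psi> xs) \<Longrightarrow> coin_mean n \<phi> = coin_mean n \<psi>"
proof (induction n arbitrary: \<phi> \<psi>)
  case (Suc n)
  have "coin_mean n (\<lambda>xs. \<phi> (b # xs)) = coin_mean n (\<lambda>xs. \<psi> (b # xs))" for b
    by (rule Suc(1)) (simp add: Suc(2))
  then show ?case by simp
qed simp

lemma coin_mean_const: "coin_mean n (\<lambda>xs. c) = c"
  by (induction n) auto

lemma coin_mean_cmult: "coin_mean n (\<lambda>xs. c * \<phi> xs) = c * coin_mean n \<phi>"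
  by (induction n arbitrary: \<phi>) (auto simp: algebra_simps)

lemma coin_mean_add: "coin_mean n (\<lambda>xs. \<phi> xs + \<psi> xs) = coin_mean n \<phi> + coin_mean n \<psi>"
  by (induction n arbitrary: \<phi> \<psi>) (auto simp: add_divide_distrib)

lemma coin_mean_sum: "finite I \<Longrightarrow> coin_mean n (\<lambda>xs. \<Sum>i\<in>I. \<phi> i xs) = (\<Sum>i\<in>I. coin_mean n (\<phi> i))"
  by (induction I rule: finite_induct) (auto simp: coin_mean_const coin_mean_add)

lemma coin_mean_append: "coin_mean (n + k) \<phi> = coin_mean n (\<lambda>xs. coin_mean k (\<lambda>ys. \<phi> (xs @ ys)))"
  by (induction n arbitrary: \<phi>) auto

lemma coin_mean_mono:
  fixes \<phi> \<psi> :: "bool list \<Rightarrow> real"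
  shows "(\<And>xs. length xs = n \<Longrightarrow> \<phi> xs \<le> \<psi> xs) \<Longrightarrow> coin_mean n \<phi> \<le> coin_mean n \<psi>"
proof (induction n arbitrary: \<phi> \<psi>)
  case (Suc n)
  have "coin_mean n (\<lambda>xs. \<phi> (b # xs)) \<le> coin_mean n (\<lambda>xs. \<psi> (b # xs))" for b
    by (rule Suc(1)) (simp add: Suc(2))
  from this[of True] this[of False] show ?case by simp
qed simp

lemma coin_mean_norm: "norm (coin_mean n \<phi>) \<le> coin_mean n (\<lambda>xs. norm (\<phi> xs))"
proof (induction n arbitrary: \<phi>)
  case (Suc n)
  have "norm (coin_mean (Suc n) \<phi>) \<le> (norm (coin_mean n (\<lambda>xs. \<phi> (True # xs))) + norm (coin_mean n (\<lambda>xs. \<phi> (False # xs)))) / 2"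
    by (simp add: norm_divide norm_triangle_ineq divide_right_mono)
  also have "\<dots> \<le> coin_mean (Suc n) (\<lambda>xs. norm (\<phi> xs))"
    using Suc[of "\<lambda>xs. \<phi> (True # xs)"] Suc[of "\<lambda>xs. \<phi> (False # xs)"] by simp
  finally show ?case .
qed simp

lemma coin_mean_nonneg: "(\<And>xs. \<phi> xs \<ge> (0::real)) \<Longrightarrow> coin_mean n \<phi> \<ge> 0"
  using coin_mean_mono[of n "\<lambda>xs. 0" \<phi>] by (simp add: coin_mean_const)

section \<open>Positions and sums along a path\<close>

definition step :: "real \<Rightarrow> bool \<Rightarrow> real" where
  "step \<epsilon> b = (if b then sqrt \<epsilon> else - sqrt \<epsilon>) - \<epsilon> / 2"

definition pos :: "real \<Rightarrow> bool list \<Rightarrow> real" where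
  "pos \<epsilon> xs = sum_list (map (step \<epsilon>) xs)"

lemma pos_simps [simp]: "pos \<epsilon> [] = 0" "pos \<epsilon> (b # xs) = step \<epsilon> b + pos \<epsilon> xs" "pos \<epsilon> (xs @ ys) = pos \<epsilon> xs + pos \<epsilon> ys"
  by (simp_all add: pos_def)

text \<open>A left Riemann sum without the factor \<open>\<epsilon>\<close>: the starting point is
  sampled and the end point is not.\<close>

fun path_sum :: "real \<Rightarrow> (real \<Rightarrow> real) \<Rightarrow> bool list \<Rightarrow> real \<Rightarrow> real" where
  "path_sum \<epsilon> f [] v = 0"
| "path_sum \<epsilon> f (b # xs) v = f v + path_sum \<epsilon> f xs (v + step \<epsilon> b)"

text \<open>A discrete Feynman-Kac formula: the Gaussian factors of the successive steps multiply to
  an exponential of a sum along the path, and the amplitude is evaluated at its end.\<close>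

lemma walk_op_paths:
  "(walk_op p m \<epsilon> ^^ n) F (of_real v) = coin_mean n (\<lambda>xs.
     of_real (exp (- (\<epsilon> / 2) * path_sum \<epsilon> (\<lambda>v. (p * exp v + of_int m / 2)\<^sup>2) xs v)) * F (of_real (v + pos \<epsilon> xs)))"
proof (induction n arbitrary: v)
  case (Suc n)
  define f where "f = (\<lambda>v. (p * exp v + of_int m / 2)\<^sup>2)"
  define \<phi> where "\<phi> xs v = complex_of_real (exp (- (\<epsilon> / 2) * path_sum \<epsilon> f xs v)) * F (of_real (v + pos \<epsilon> xs))" for xs v
  have IH: "(walk_op p m \<epsilon> ^^ n) F (of_real v) = coin_mean n (\<lambda>xs. \<phi> xs v)" for v
    using Suc unfolding \<phi>_def f_def .
  have \<phi>: "\<phi> (b # xs) v = of_real (exp (- (\<epsilon> / 2) * f v)) * \<phi> xs (v + step \<epsilon> b)" for b xs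
    unfolding \<phi>_def path_sum.simps pos_simps distrib_left exp_add of_real_mult by (simp add: add_ac)
  have e: "exp (- of_real (\<epsilon> / 2) * (of_real p * exp (of_real v) + of_int m / 2)\<^sup>2) = complex_of_real (exp (- (\<epsilon> / 2) * f v))"
    unfolding exp_of_real[symmetric] by (simp add: f_def exp_of_real)
  have "(walk_op p m \<epsilon> ^^ Suc n) F (of_real v) = walk_op p m \<epsilon> ((walk_op p m \<epsilon> ^^ n) F) (of_real v)" by simp
  also have "\<dots> = complex_of_real (exp (- (\<epsilon> / 2) * f v)) * ((coin_mean n (\<lambda>xs. \<phi> xs (v + step \<epsilon> True)) + coin_mean n (\<lambda>xs. \<phi> xs (v + step \<epsilon> False))) / 2)"
    unfolding walk_op_def e IH[symmetric] by (simp add: step_def)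
  also have "\<dots> = coin_mean (Suc n) (\<lambda>xs. \<phi> xs v)"
    by (simp only: coin_mean.simps \<phi> coin_mean_cmult distrib_left[symmetric] times_divide_eq_right)
  finally show ?case unfolding \<phi>_def f_def .
qed simp

lemma path_sum_sum: "path_sum \<epsilon> f xs v = (\<Sum>j<length xs. f (v + pos \<epsilon> (take j xs)))"
  by (induction xs arbitrary: v) (simp_all add: sum.lessThan_Suc_shift add.assoc del: sum.lessThan_Suc)

text \<open>The squared distance from \<open>(1, 1)\<close> to the line spanned by
  \<open>(1, exp d)\<close>. It is the minimum over \<open>l\<close> of the right-hand side of
  \<open>pair_gap_pair\<close> when \<open>y\<close> is nonzero, and it does not depend on
  \<open>y\<close>.\<close>

definition pair_gap :: "real \<Rightarrow> real" where "pair_gap d = 1 - 1 / cosh d"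

lemma pair_gap_bounds: "0 \<le> pair_gap d" "pair_gap d \<le> 1"
  using cosh_real_ge_1[of d] by (auto simp: pair_gap_def)

text \<open>Cauchy-Schwarz for \<open>(A, B)\<close> against \<open>(e, - 1)\<close>: in the
  combination \<open>e * A - B\<close> the parameter \<open>l\<close> cancels.\<close>

lemma pair_gap_pair: "pair_gap d \<le> (1 - l * y)\<^sup>2 + (1 - l * (y * exp d))\<^sup>2"
proof -
  define e A B where "e = exp d" and "A = 1 - l * y" and "B = 1 - l * (y * exp d)"
  have e: "e > 0" by (simp add: e_def)
  have "(e * A - B)\<^sup>2 + (A + e * B)\<^sup>2 = (e\<^sup>2 + 1) * (A\<^sup>2 + B\<^sup>2)"
    by (simp add: power2_eq_square algebra_simps)
  moreover have "e * A - B = e - 1" by (simp add: e_def A_def B_def algebra_simps)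
  ultimately have "(e - 1)\<^sup>2 \<le> (e\<^sup>2 + 1) * (A\<^sup>2 + B\<^sup>2)"
    by (metis le_add_same_cancel1 zero_le_power2)
  moreover have "pair_gap d * (e\<^sup>2 + 1) = (e - 1)\<^sup>2"
  proof -
    have "cosh d = (e\<^sup>2 + 1) / (2 * e)" using e
      by (simp add: cosh_field_def exp_minus e_def[symmetric] field_simps power2_eq_square)
    moreover have "e\<^sup>2 + 1 > 0" by (simp add: add_nonneg_pos)
    ultimately show ?thesis using e by (simp add: pair_gap_def field_simps power2_eq_square)
  qed
  ultimately have "pair_gap d * (e\<^sup>2 + 1) \<le> (A\<^sup>2 + B\<^sup>2) * (e\<^sup>2 + 1)" by (simp add: mult.commute)
  then show ?thesis unfolding A_def B_def by (rule mult_right_le_imp_le) (simp add: add_nonneg_pos)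
qed

text \<open>Pairing times at distance \<open>M\<close> in a block of \<open>2 M\<close> steps bounds the conditional variance from below by
  a quantity in which \<open>l\<close> no longer appears, which makes different blocks independent.\<close>

definition block_sum :: "real \<Rightarrow> nat \<Rightarrow> bool list \<Rightarrow> real" where
  "block_sum \<epsilon> M xs = (\<Sum>k<M. pair_gap (pos \<epsilon> (take M (drop k xs))))"

fun blocks_sum :: "real \<Rightarrow> nat \<Rightarrow> nat \<Rightarrow> bool list \<Rightarrow> real" where
  "blocks_sum \<epsilon> M 0 xs = 0"
| "blocks_sum \<epsilon> M (Suc J) xs = block_sum \<epsilon> M (take (2 * M) xs) + blocks_sum \<epsilon> M J (drop (2 * M) xs)"

lemma path_sum_append: "path_sum \<epsilon> f (xs @ ys) v = path_sum \<epsilon> f xs v + path_sum \<epsilon> f ys (v + pos \<epsilon> xs)"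
  by (induction xs arbitrary: v) (auto simp: add_ac)

lemma block_sum_le_path_sum:
  assumes "length xs = 2 * M"
  shows "block_sum \<epsilon> M xs \<le> path_sum \<epsilon> (\<lambda>v. (1 - l * exp v)\<^sup>2) xs v"
proof -
  define f where "f = (\<lambda>v::real. (1 - l * exp v)\<^sup>2)"
  define P where "P j = v + pos \<epsilon> (take j xs)" for j
  have "path_sum \<epsilon> f xs v = (\<Sum>j<M + M. f (P j))" unfolding path_sum_sum P_def using assms by (simp add: mult_2)
  also have "\<dots> = (\<Sum>k<M. f (P k) + f (P (k + M)))"
    by (simp add: lessThan_atLeast0 sum.atLeastLessThan_concat[symmetric, of 0 M "M + M"] sum.distrib
        sum.shift_bounds_nat_ivl[of _ 0 M M, simplified])
  also have "\<dots> \<ge> (\<Sum>k<M. pair_gap (pos \<epsilon> (take M (drop k xs))))"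
  proof (rule sum_mono)
    fix k
    have "P (k + M) = P k + pos \<epsilon> (take M (drop k xs))" by (simp add: P_def take_add)
    then show "pair_gap (pos \<epsilon> (take M (drop k xs))) \<le> f (P k) + f (P (k + M))"
      using pair_gap_pair[of "pos \<epsilon> (take M (drop k xs))" l "exp (P k)"] by (simp add: f_def exp_add)
  qed
  finally show ?thesis by (simp add: block_sum_def f_def)
qed

lemma blocks_sum_le_path_sum:
  "length xs = J * (2 * M) \<Longrightarrow> blocks_sum \<epsilon> M J xs \<le> path_sum \<epsilon> (\<lambda>v. (1 - l * exp v)\<^sup>2) xs v"
proof (induction J arbitrary: xs v)
  case (Suc J)
  have "block_sum \<epsilon> M (take (2 * M) xs) \<le> path_sum \<epsilon> (\<lambda>v. (1 - l * exp v)\<^sup>2) (take (2 * M) xs) v"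
    using Suc(2) by (intro block_sum_le_path_sum) simp
  moreover have "blocks_sum \<epsilon> M J (drop (2 * M) xs) \<le> path_sum \<epsilon> (\<lambda>v. (1 - l * exp v)\<^sup>2) (drop (2 * M) xs) (v + pos \<epsilon> (take (2 * M) xs))"
    using Suc(2) by (intro Suc(1)) simp
  moreover have "path_sum \<epsilon> (\<lambda>v. (1 - l * exp v)\<^sup>2) xs v = path_sum \<epsilon> (\<lambda>v. (1 - l * exp v)\<^sup>2) (take (2 * M) xs) v
     + path_sum \<epsilon> (\<lambda>v. (1 - l * exp v)\<^sup>2) (drop (2 * M) xs) (v + pos \<epsilon> (take (2 * M) xs))"
    unfolding path_sum_append[symmetric] by simp
  ultimately show ?case by simp
qed simp

lemma coin_mean_blocks_sum: "coin_mean (J * (2 * M)) (\<lambda>xs. exp (- c * blocks_sum \<epsilon> M J xs)) = (coin_mean (2 * M) (\<lambda>xs. exp (- c * block_sum \<epsilon> M xs))) ^ J"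
proof (induction J)
  case (Suc J)
  have "coin_mean (Suc J * (2 * M)) (\<lambda>xs. exp (- c * blocks_sum \<epsilon> M (Suc J) xs))
    = coin_mean (2 * M) (\<lambda>xs. coin_mean (J * (2 * M)) (\<lambda>ys. exp (- c * blocks_sum \<epsilon> M (Suc J) (xs @ ys))))"
    by (simp only: mult_Suc coin_mean_append)
  also have "\<dots> = coin_mean (2 * M) (\<lambda>xs. coin_mean (J * (2 * M)) (\<lambda>ys. exp (- c * block_sum \<epsilon> M xs) * exp (- c * blocks_sum \<epsilon> M J ys)))"
    by (rule coin_mean_cong) (simp add: exp_add[symmetric] algebra_simps)
  also have "\<dots> = (coin_mean (2 * M) (\<lambda>xs. exp (- c * block_sum \<epsilon> M xs))) ^ Suc J"
    unfolding coin_mean_cmult Suc by (subst mult.commute, subst coin_mean_cmult) simp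
  finally show ?case .
qed simp

lemma coin_mean_window:
  assumes "k + M \<le> n"
  shows "coin_mean n (\<lambda>xs. h (pos \<epsilon> (take M (drop k xs)))) = coin_mean M (\<lambda>xs. h (pos \<epsilon> xs))"
proof -
  obtain r where n: "n = k + (M + r)" using assms by (metis add.assoc le_iff_add)
  have "coin_mean n (\<lambda>xs. h (pos \<epsilon> (take M (drop k xs)))) =
    coin_mean k (\<lambda>xs. coin_mean M (\<lambda>ys. coin_mean r (\<lambda>zs. h (pos \<epsilon> (take M (drop k (xs @ ys @ zs)))))))"
    unfolding n coin_mean_append ..
  also have "\<dots> = coin_mean k (\<lambda>xs. coin_mean M (\<lambda>ys. coin_mean r (\<lambda>zs. h (pos \<epsilon> ys))))"
    by (intro coin_mean_cong) simp
  finally show ?thesis by (simp add: coin_mean_const)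
qed

text \<open>Jensen's inequality, and stationarity of the increments.\<close>

lemma coin_mean_block_sum_le:
  assumes "M > 0"
  shows "coin_mean (2 * M) (\<lambda>xs. exp (- c * block_sum \<epsilon> M xs)) \<le> coin_mean M (\<lambda>xs. exp (- (c * real M) * pair_gap (pos \<epsilon> xs)))"
proof -
  have "exp (- c * block_sum \<epsilon> M xs) \<le> (\<Sum>k<M. (1 / real M) * exp (- (c * real M) * pair_gap (pos \<epsilon> (take M (drop k xs)))))" for xs
  proof -
    have "exp (\<Sum>k<M. (1 / real M) *\<^sub>R (- (c * real M) * pair_gap (pos \<epsilon> (take M (drop k xs)))))
       \<le> (\<Sum>k<M. (1 / real M) * exp (- (c * real M) * pair_gap (pos \<epsilon> (take M (drop k xs)))))"
      using assms by (intro convex_on_sum[OF _ _ exp_convex]) auto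
    moreover have "(\<Sum>k<M. (1 / real M) *\<^sub>R (- (c * real M) * pair_gap (pos \<epsilon> (take M (drop k xs))))) = - c * block_sum \<epsilon> M xs"
      using assms by (simp add: block_sum_def sum_distrib_left sum_negf)
    ultimately show ?thesis by simp
  qed
  then have "coin_mean (2 * M) (\<lambda>xs. exp (- c * block_sum \<epsilon> M xs)) \<le>
     coin_mean (2 * M) (\<lambda>xs. \<Sum>k<M. (1 / real M) * exp (- (c * real M) * pair_gap (pos \<epsilon> (take M (drop k xs)))))"
    by (intro coin_mean_mono)
  also have "\<dots> = (\<Sum>k<M. (1 / real M) * coin_mean (2 * M) (\<lambda>xs. exp (- (c * real M) * pair_gap (pos \<epsilon> (take M (drop k xs))))))"
    by (simp only: coin_mean_sum[OF finite_lessThan] coin_mean_cmult)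
  also have "\<dots> = (\<Sum>k<M. (1 / real M) * coin_mean M (\<lambda>xs. exp (- (c * real M) * pair_gap (pos \<epsilon> xs))))"
    by (intro sum.cong refl arg_cong2[where f="(*)"] coin_mean_window[where h="\<lambda>x. exp (- (c * real M) * pair_gap x)"]) auto
  also have "\<dots> = coin_mean M (\<lambda>xs. exp (- (c * real M) * pair_gap (pos \<epsilon> xs)))" using assms by simp
  finally show ?thesis .
qed

section \<open>Anti-concentration of the binomial distribution\<close>

lemma pos_count:
  "pos \<epsilon> xs = sqrt \<epsilon> * (2 * real (count_list xs True) - real (length xs)) - real (length xs) * \<epsilon> / 2"
  by (induction xs) (auto simp: step_def algebra_simps add_divide_distrib)

lemma coin_mean_count: "coin_mean n (\<lambda>xs. h (count_list xs True)) = (\<Sum>k\<le>n. of_nat (n choose k) * h k) / 2 ^ n"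
proof (induction n arbitrary: h)
  case (Suc n)
  have "(\<Sum>k\<le>Suc n. of_nat (Suc n choose k) * h k) = h 0 + (\<Sum>k\<le>n. of_nat (Suc n choose Suc k) * h (Suc k))"
    by (simp add: sum.atMost_Suc_shift del: sum.atMost_Suc)
  also have "\<dots> = (\<Sum>k\<le>n. of_nat (n choose k) * h (Suc k)) + (h 0 + (\<Sum>k\<le>n. of_nat (n choose Suc k) * h (Suc k)))"
    by (simp add: sum.distrib algebra_simps)
  also have "h 0 + (\<Sum>k\<le>n. of_nat (n choose Suc k) * h (Suc k)) = (\<Sum>k\<le>Suc n. of_nat (n choose k) * h k)"
    by (simp add: sum.atMost_Suc_shift del: sum.atMost_Suc)
  also have "\<dots> = (\<Sum>k\<le>n. of_nat (n choose k) * h k)" by simp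
  finally have "(\<Sum>k\<le>Suc n. of_nat (Suc n choose k) * h k) = (\<Sum>k\<le>n. of_nat (n choose k) * h (Suc k)) + (\<Sum>k\<le>n. of_nat (n choose k) * h k)" .
  note binom = this
  have "coin_mean (Suc n) (\<lambda>xs. h (count_list xs True)) =
    (coin_mean n (\<lambda>xs. h (Suc (count_list xs True))) + coin_mean n (\<lambda>xs. h (count_list xs True))) / 2" by simp
  also have "\<dots> = ((\<Sum>k\<le>n. of_nat (n choose k) * h (Suc k)) + (\<Sum>k\<le>n. of_nat (n choose k) * h k)) / 2 ^ Suc n"
    unfolding Suc[of h] Suc[of "\<lambda>k. h (Suc k)"] add_divide_distrib[symmetric] by simp
  finally show ?case unfolding binom .
qed simp

text \<open>The factor \<open>2 * real N + 1\<close> makes the left-hand side decreasing in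
  \<open>N\<close>: the normalized central coefficient changes by
  \<open>(2 N + 1) / (2 N + 2)\<close>, and \<open>(2 N + 1) (2 N + 3)\<close> is below
  \<open>(2 N + 2)\<^sup>2\<close>.\<close>

lemma central_binomial_bound: "(real (2 * N choose N) / 2 ^ (2 * N))\<^sup>2 * (2 * real N + 1) \<le> 1"
proof (induction N)
  case (Suc N)
  define c where "c = real (2 * N choose N) / 2 ^ (2 * N)"
  have "real (Suc N) * real (2 * Suc N choose Suc N) = 2 * (2 * real N + 1) * real (2 * N choose N)"
  proof -
    define X Y Z where "X = (Suc (Suc (2 * N)) choose Suc N)" and "Y = (Suc (2 * N) choose N)" and "Z = (2 * N choose N)"
    have a: "Suc (Suc (2 * N)) * Y = X * Suc N"
      unfolding X_def Y_def by (rule Suc_times_binomial_eq)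
    have "Y = (Suc (2 * N) choose Suc N)"
      unfolding Y_def using binomial_symmetric[of "Suc N" "Suc (2 * N)"] by (simp del: binomial_Suc_Suc)
    then have b: "Suc (2 * N) * Z = Y * Suc N"
      unfolding Z_def by (simp only: Suc_times_binomial_eq)
    have "Suc N * X = 2 * (Suc (2 * N) * Z)" using a b by (simp add: algebra_simps)
    then have "real (Suc N * X) = real (2 * (Suc (2 * N) * Z))" by (rule arg_cong)
    then have "real (Suc N) * real X = 2 * (2 * real N + 1) * real Z" by (simp only: of_nat_mult) simp
    moreover have "X = (2 * Suc N choose Suc N)" unfolding X_def by (simp del: binomial_Suc_Suc)
    ultimately show ?thesis by (simp only: Z_def)
  qed
  note rec = this
  have *: "X / 2 ^ (2 * Suc N) = Z / 2 ^ (2 * N) * ((2 * real N + 1) / (2 * (real N + 1)))"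
    if "real (Suc N) * X = 2 * (2 * real N + 1) * Z" for X Z :: real
  proof -
    define P :: real where "P = 2 ^ (2 * N)"
    have P: "P > 0" "2 ^ (2 * Suc N) = 4 * P" by (simp_all add: P_def)
    have "Z / P * ((2 * real N + 1) / (2 * (real N + 1))) = (2 * (2 * real N + 1) * Z) / (4 * P * (real N + 1))"
      using P(1) by (simp add: divide_simps) (simp add: algebra_simps)
    also have "\<dots> = (real (Suc N) * X) / (4 * P * (real N + 1))" by (simp only: that)
    also have "\<dots> = X / (4 * P)" using P(1) by (simp add: divide_simps)
    finally show ?thesis by (simp only: P P_def[symmetric])
  qed
  have eq: "real (2 * Suc N choose Suc N) / 2 ^ (2 * Suc N) = c * ((2 * real N + 1) / (2 * (real N + 1)))"
    unfolding c_def by (rule *[OF rec])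
  have "(c * ((2 * real N + 1) / (2 * (real N + 1))))\<^sup>2 * (2 * real (Suc N) + 1)
    = (c\<^sup>2 * (2 * real N + 1)) * ((2 * real N + 1) * (2 * real N + 3) / (2 * (real N + 1))\<^sup>2)"
    by (simp add: power2_eq_square field_simps)
  also have "\<dots> \<le> 1 * 1"
  proof (intro mult_mono)
    show "(2 * real N + 1) * (2 * real N + 3) / (2 * (real N + 1))\<^sup>2 \<le> 1"
    proof -
      have "(2 * real N + 1) * (2 * real N + 3) \<le> (2 * (real N + 1))\<^sup>2"
        by (simp add: power2_eq_square algebra_simps)
      moreover have "(2 * (real N + 1))\<^sup>2 > 0" by simp
      ultimately show ?thesis by (simp only: divide_le_eq_1_pos)
    qed
  qed (use Suc in \<open>auto simp: c_def\<close>)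
  finally show ?case unfolding eq by simp
qed simp

lemma binomial_atom_bound: "N > 0 \<Longrightarrow> real (2 * N choose k) / 2 ^ (2 * N) \<le> 1 / sqrt (real (2 * N))"
proof -
  assume N: "N > 0"
  define c where "c = real (2 * N choose N) / 2 ^ (2 * N)"
  have "(c * sqrt (real (2 * N)))\<^sup>2 \<le> c\<^sup>2 * (2 * real N + 1)" by (simp add: power_mult_distrib mult_left_mono)
  also have "\<dots> \<le> 1\<^sup>2" using central_binomial_bound[of N] by (simp add: c_def)
  finally have "c * sqrt (real (2 * N)) \<le> 1" by (rule power2_le_imp_le) simp
  then have "c \<le> 1 / sqrt (real (2 * N))" using N by (simp add: pos_le_divide_eq)
  moreover have "real (2 * N choose k) / 2 ^ (2 * N) \<le> c"
    unfolding c_def using binomial_maximum'[of N k] by (intro divide_right_mono) auto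
  ultimately show ?thesis by linarith
qed

lemma card_nat_interval:
  fixes a b :: real
  assumes "S \<subseteq> {k::nat. a \<le> real k \<and> real k \<le> b}" "a \<le> b"
  shows "real (card S) \<le> b - a + 1"
proof -
  have "int ` S \<subseteq> {\<lceil>a\<rceil>..\<lfloor>b\<rfloor>}" using assms(1) by (auto simp: ceiling_le_iff le_floor_iff)
  then have "card (int ` S) \<le> card {\<lceil>a\<rceil>..\<lfloor>b\<rfloor>}" by (intro card_mono) auto
  then have "real (card S) \<le> real (nat (\<lfloor>b\<rfloor> - \<lceil>a\<rceil> + 1))" by (simp add: card_image)
  also have "\<dots> \<le> b - a + 1"
  proof (cases "\<lfloor>b\<rfloor> - \<lceil>a\<rceil> + 1 \<ge> 0")
    case True
    then have "real (nat (\<lfloor>b\<rfloor> - \<lceil>a\<rceil> + 1)) = of_int \<lfloor>b\<rfloor> - of_int \<lceil>a\<rceil> + 1" by simp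
    then show ?thesis using of_int_floor_le[of b] le_of_int_ceiling[of a] by linarith
  qed (use assms(2) in auto)
  finally show ?thesis .
qed

text \<open>Possible positions are \<open>2 * sqrt \<epsilon>\<close> apart, so at most
  \<open>h / sqrt \<epsilon> + 1\<close> of them lie in the window, and each has mass at most
  \<open>1 / sqrt (real M)\<close>. The duration \<open>\<epsilon> * real M\<close> is bounded below
  so that the estimate is uniform in the step size.\<close>

lemma anti_concentration:
  assumes M: "M = 2 * N" "N > 0" and e: "\<epsilon> > 0" "\<epsilon> * real M \<ge> 1/2" and h: "h \<ge> 0"
  shows "coin_mean M (\<lambda>xs. if \<bar>pos \<epsilon> xs\<bar> \<le> h then 1 else 0 :: real) \<le> 2 * h + 1 / sqrt (real M)"
proof -
  define X where "X k = sqrt \<epsilon> * (2 * real k - real M) - real M * \<epsilon> / 2" for k :: nat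
  define S where "S = {k. k \<le> M \<and> \<bar>X k\<bar> \<le> h}"
  have "coin_mean M (\<lambda>xs. if \<bar>pos \<epsilon> xs\<bar> \<le> h then 1 else 0 :: real) = coin_mean M (\<lambda>xs. (\<lambda>k. if \<bar>X k\<bar> \<le> h then 1 else 0) (count_list xs True))"
    by (rule coin_mean_cong) (simp add: pos_count X_def)
  also have "\<dots> = (\<Sum>k\<le>M. real (M choose k) * (if \<bar>X k\<bar> \<le> h then 1 else 0)) / 2 ^ M"
    by (rule coin_mean_count)
  also have "(\<Sum>k\<le>M. real (M choose k) * (if \<bar>X k\<bar> \<le> h then 1 else 0)) = (\<Sum>k\<in>S. real (M choose k))"
    by (simp add: S_def if_distrib sum.If_cases Collect_conj_eq[symmetric] atMost_def cong: if_cong)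
  also have "(\<Sum>k\<in>S. real (M choose k)) / 2 ^ M = (\<Sum>k\<in>S. real (M choose k) / 2 ^ M)"
    by (rule sum_divide_distrib)
  also have "\<dots> \<le> (\<Sum>k\<in>S. 1 / sqrt (real M))"
    unfolding M(1) by (intro sum_mono binomial_atom_bound M)
  also have "\<dots> = real (card S) * (1 / sqrt (real M))" by simp
  also have "\<dots> \<le> (h / sqrt \<epsilon> + 1) * (1 / sqrt (real M))"
  proof (intro mult_right_mono)
    \<comment> \<open>The (real) number of heads at which the position would be zero.\<close>
    define cc where "cc = (real M + real M * \<epsilon> / (2 * sqrt \<epsilon>)) / 2"
    have se: "sqrt \<epsilon> > 0" using e by simp
    have "S \<subseteq> {k. cc - h / (2 * sqrt \<epsilon>) \<le> real k \<and> real k \<le> cc + h / (2 * sqrt \<epsilon>)}"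
    proof
      fix k assume "k \<in> S"
      then have k: "\<bar>X k\<bar> \<le> h" by (simp add: S_def)
      have "X k = 2 * sqrt \<epsilon> * (real k - cc)" using se by (simp add: X_def cc_def field_simps)
      then have "2 * sqrt \<epsilon> * \<bar>real k - cc\<bar> \<le> h" using k se by (simp add: abs_mult)
      then have "\<bar>real k - cc\<bar> \<le> h / (2 * sqrt \<epsilon>)" using se by (simp add: pos_le_divide_eq mult.commute)
      then show "k \<in> {k. cc - h / (2 * sqrt \<epsilon>) \<le> real k \<and> real k \<le> cc + h / (2 * sqrt \<epsilon>)}" by auto
    qed
    from card_nat_interval[OF this] show "real (card S) \<le> h / sqrt \<epsilon> + 1" using h se by simp
  qed simp
  also have "\<dots> = h * (1 / sqrt (\<epsilon> * real M)) + 1 / sqrt (real M)"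
    by (simp add: real_sqrt_mult algebra_simps)
  also have "\<dots> \<le> h * 2 + 1 / sqrt (real M)"
  proof (intro add_mono mult_left_mono h)
    have "sqrt (1/4) \<le> sqrt (\<epsilon> * real M)" using e by (intro real_sqrt_le_mono) simp
    then have "1/2 \<le> sqrt (\<epsilon> * real M)" by (simp add: real_sqrt_divide)
    moreover have "0 < \<epsilon> * real M" using e by linarith
    ultimately have "1 / sqrt (\<epsilon> * real M) \<le> 1 / (1/2)" by (intro divide_left_mono) auto
    then show "1 / sqrt (\<epsilon> * real M) \<le> 2" by simp
  qed simp
  finally show ?thesis by simp
qed

lemma pair_gap_lower:
  assumes "0 < h" "h \<le> 1" "\<bar>d\<bar> \<ge> h"
  shows "pair_gap d \<ge> h\<^sup>2 / 5"
proof -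
  have aux: "A \<ge> 1 + x + y / 2 \<Longrightarrow> B \<ge> 1 - x \<Longrightarrow> z \<le> y \<Longrightarrow> 1 + z / 4 \<le> (A + B) / 2" for A B x y z :: real
    by argo
  have "exp \<bar>d\<bar> \<ge> 1 + \<bar>d\<bar> + \<bar>d\<bar>\<^sup>2 / 2" by (rule exp_lower_Taylor_quadratic) simp
  moreover have "exp (- \<bar>d\<bar>) \<ge> 1 - \<bar>d\<bar>" using exp_ge_add_one_self[of "- \<bar>d\<bar>"] by simp
  moreover have "h\<^sup>2 \<le> \<bar>d\<bar>\<^sup>2" using assms by (intro power_mono) auto
  ultimately have "1 + h\<^sup>2 / 4 \<le> (exp \<bar>d\<bar> + exp (- \<bar>d\<bar>)) / 2" by (rule aux)
  also have "\<dots> = cosh d"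
    by (cases "d \<ge> 0") (simp_all add: cosh_field_def add.commute)
  finally have c: "cosh d \<ge> 1 + h\<^sup>2 / 4" .
  then have "1 / cosh d \<le> 1 / (1 + h\<^sup>2 / 4)" by (intro divide_left_mono) (auto simp: add_pos_nonneg)
  also have "\<dots> \<le> 1 - h\<^sup>2 / 5"
  proof -
    have "h\<^sup>2 \<le> 1" using assms by (simp add: power_le_one)
    then have "h\<^sup>2 * h\<^sup>2 \<le> h\<^sup>2 * 1" by (intro mult_left_mono) auto
    then have "1 \<le> (1 - h\<^sup>2 / 5) * (1 + h\<^sup>2 / 4)" by (simp add: algebra_simps)
    then show ?thesis by (simp add: divide_le_eq add_pos_nonneg)
  qed
  finally show ?thesis by (simp add: pair_gap_def)
qed

section \<open>Exponential decay of the angular modes\<close>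

text \<open>Outside the window of half-width \<open>h\<close> the exponential is at most
  \<open>E\<close>, inside it at most 1. The 80 is the product of 16 from the assumption on
  \<open>c\<close> and 5 from \<open>pair_gap_lower\<close>.\<close>

lemma coin_mean_exp_pair_gap:
  assumes M: "M = 2 * N" "N > 0" and e: "\<epsilon> > 0" "\<epsilon> * real M \<ge> 1/2"
    and h: "0 < h" "h \<le> 1" and c: "c \<ge> (real m)\<^sup>2 / 16"
    and E: "E = exp (- ((real m)\<^sup>2 * h\<^sup>2 / 80))"
  shows "coin_mean M (\<lambda>xs. exp (- c * pair_gap (pos \<epsilon> xs))) \<le> E + (1 - E) * (2 * h + 1 / sqrt (real M))"
proof -
  have E1: "E \<le> 1" unfolding E by simp
  have c0: "c \<ge> 0" using c zero_le_power2[of "real m"] by linarith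
  have "coin_mean M (\<lambda>xs. exp (- c * pair_gap (pos \<epsilon> xs))) \<le> coin_mean M (\<lambda>xs. E + (1 - E) * (if \<bar>pos \<epsilon> xs\<bar> \<le> h then 1 else 0))"
  proof (rule coin_mean_mono)
    fix xs :: "bool list"
    show "exp (- c * pair_gap (pos \<epsilon> xs)) \<le> E + (1 - E) * (if \<bar>pos \<epsilon> xs\<bar> \<le> h then 1 else 0)"
    proof (cases "\<bar>pos \<epsilon> xs\<bar> \<le> h")
      case True
      have "c * pair_gap (pos \<epsilon> xs) \<ge> 0" using pair_gap_bounds(1) c0 by (intro mult_nonneg_nonneg)
      then show ?thesis using True by simp
    next
      case False
      then have "pair_gap (pos \<epsilon> xs) \<ge> h\<^sup>2 / 5" using h by (intro pair_gap_lower) auto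
      then have "(real m)\<^sup>2 / 16 * (h\<^sup>2 / 5) \<le> c * pair_gap (pos \<epsilon> xs)"
        using c c0 by (intro mult_mono) auto
      then show ?thesis using False unfolding E by simp
    qed
  qed
  also have "\<dots> = E + (1 - E) * coin_mean M (\<lambda>xs. if \<bar>pos \<epsilon> xs\<bar> \<le> h then 1 else 0)"
    by (simp only: coin_mean_add coin_mean_const coin_mean_cmult)
  also have "\<dots> \<le> E + (1 - E) * (2 * h + 1 / sqrt (real M))"
    using E1 h by (intro add_left_mono mult_left_mono anti_concentration[OF M e]) auto
  finally show ?thesis .
qed

text \<open>The value of the bound in \<open>coin_mean_exp_pair_gap\<close> for \<open>h = 1/8\<close> and \<open>m = 1\<close>, with the probability replaced by \<open>1/2\<close>.\<close>

definition qrate :: real where "qrate = (1 + exp (- (1 / 5120))) / 2"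

lemma qrate: "0 < qrate" "qrate < 1"
  by (auto simp: qrate_def add_pos_pos)

text \<open>Two choices of the window. The fixed \<open>h = 1/8\<close> gives a rate below 1 for all
  frequencies, where \<open>M \<ge> 16\<close> makes the probability at most 1/2. The choice
  \<open>h = 1 / sqrt m\<close> gives decay in \<open>m\<close>: 80 from the exponential, 2 from the
  window and 1 from the atoms, for which \<open>m \<le> M\<close> is required.\<close>

lemma block_rate:
  assumes M: "M = 2 * N" "M \<ge> 16" and e: "\<epsilon> > 0" "\<epsilon> * real M \<ge> 1/2"
    and m: "m \<ge> 1" "m \<le> M" and c: "c \<ge> (real m)\<^sup>2 / 16"
  shows "coin_mean M (\<lambda>xs. exp (- c * pair_gap (pos \<epsilon> xs))) \<le> qrate"
    and "coin_mean M (\<lambda>xs. exp (- c * pair_gap (pos \<epsilon> xs))) \<le> 83 / sqrt (real m)"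
proof -
  have N: "N > 0" using M by simp
  define E where "E = exp (- ((real m)\<^sup>2 * (1/8)\<^sup>2 / 80))"
  define E1 :: real where "E1 = exp (- (1 / 5120))"
  have "coin_mean M (\<lambda>xs. exp (- c * pair_gap (pos \<epsilon> xs))) \<le> E + (1 - E) * (2 * (1/8) + 1 / sqrt (real M))"
    by (rule coin_mean_exp_pair_gap[OF M(1) N e _ _ c E_def]) auto
  also have "\<dots> \<le> E + (1 - E) * (1/2)"
  proof (intro add_left_mono mult_left_mono)
    have "sqrt 16 \<le> sqrt (real M)" using M by (intro real_sqrt_le_mono) simp
    moreover have "sqrt 16 = (4::real)" by (rule real_sqrt_unique) auto
    ultimately have "4 \<le> sqrt (real M)" by simp
    then have "1 / sqrt (real M) \<le> 1 / 4" using M by (intro divide_left_mono) auto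
    then show "2 * (1/8) + 1 / sqrt (real M) \<le> 1/2" by simp
  qed (simp add: E_def)
  also have "\<dots> = (1 + E) / 2" by (simp add: field_simps)
  also have "\<dots> \<le> (1 + E1) / 2"
  proof -
    have "1 \<le> (real m)\<^sup>2" using m by (simp add: one_le_power)
    then show ?thesis unfolding E_def E1_def by (simp add: power_divide)
  qed
  finally show "coin_mean M (\<lambda>xs. exp (- c * pair_gap (pos \<epsilon> xs))) \<le> qrate" by (simp add: qrate_def E1_def)
  define s where "s = sqrt (real m)"
  have s: "s \<ge> 1" "s\<^sup>2 = real m" using m by (auto simp: s_def)
  define F where "F = exp (- ((real m)\<^sup>2 * (1 / s)\<^sup>2 / 80))"
  have "coin_mean M (\<lambda>xs. exp (- c * pair_gap (pos \<epsilon> xs))) \<le> F + (1 - F) * (2 * (1 / s) + 1 / sqrt (real M))"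
    by (rule coin_mean_exp_pair_gap[OF M(1) N e _ _ c F_def]) (use s in auto)
  also have "\<dots> \<le> F + 1 * (2 * (1 / s) + 1 / sqrt (real M))"
    using s by (intro add_left_mono mult_right_mono) (auto simp: F_def)
  also have "\<dots> \<le> 80 / s + 1 * (2 * (1 / s) + 1 / s)"
  proof (intro add_mono mult_left_mono order_refl)
    have sm: "(real m)\<^sup>2 * (1 / s)\<^sup>2 = real m" using s m by (simp add: power_divide power2_eq_square)
    have "F = 1 / exp (real m / 80)" unfolding F_def sm exp_minus inverse_eq_divide ..
    also have "\<dots> \<le> 1 / (s / 80)"
    proof (intro divide_left_mono)
      have "real m / 80 \<le> exp (real m / 80)" using exp_ge_add_one_self[of "real m / 80"] by linarith
      moreover have "s * 1 \<le> s * s" using s(1) by (intro mult_left_mono) auto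
      then have "s \<le> real m" unfolding s(2)[symmetric] power2_eq_square by simp
      ultimately show "s / 80 \<le> exp (real m / 80)" by linarith
    qed (use s in auto)
    finally show "F \<le> 80 / s" by simp
    have "s \<le> sqrt (real M)" unfolding s_def using m by (intro real_sqrt_le_mono) simp
    then show "1 / sqrt (real M) \<le> 1 / s" using s(1) M by (intro divide_left_mono) auto
  qed auto
  also have "\<dots> = 83 / s" by simp
  finally show "coin_mean M (\<lambda>xs. exp (- c * pair_gap (pos \<epsilon> xs))) \<le> 83 / sqrt (real m)" by (simp add: s_def)
qed

text \<open>Four of the \<open>J\<close> equal factors are estimated by \<open>83 / sqrt m\<close>,
  which makes the result summable over frequencies, and the rest by \<open>qrate\<close>. From
  \<open>real J \<le> t\<close>, half a block lasts
  \<open>\<epsilon> * real M = t / (2 * real J)\<close>, at least 1/2.\<close>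

lemma walk_decay:
  assumes M: "M = 2 * N" "M \<ge> 16" and m: "m \<ge> 1" "m \<le> M" and J: "J \<ge> 4" "real J \<le> t"
    and n: "n = J * (2 * M)" and e: "\<epsilon> = t / real n"
  shows "coin_mean n (\<lambda>xs. exp (- ((real m)\<^sup>2 / 8 * \<epsilon>) * blocks_sum \<epsilon> M J xs)) \<le> qrate ^ (J - 4) * (83 ^ 4 / (real m)\<^sup>2)"
proof -
  have n0: "real n > 0" using n J M by simp
  have t: "t > 0" using J by linarith
  have e0: "\<epsilon> > 0" unfolding e using n0 t by simp
  have eM: "\<epsilon> * real M = t / (2 * real J)" using M J unfolding e n by (simp add: field_simps)
  also have "\<dots> \<ge> 1/2" using J by (simp add: field_simps)
  finally have e1: "\<epsilon> * real M \<ge> 1/2" .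
  define c where "c = (real m)\<^sup>2 / 8 * \<epsilon>"
  have "c * real M = (real m)\<^sup>2 / 8 * (\<epsilon> * real M)" by (simp add: c_def)
  also have "\<dots> \<ge> (real m)\<^sup>2 / 8 * (1/2)" using e1 by (intro mult_left_mono) auto
  finally have c: "c * real M \<ge> (real m)\<^sup>2 / 16" by simp
  define \<beta> where "\<beta> = coin_mean (2 * M) (\<lambda>xs. exp (- c * block_sum \<epsilon> M xs))"
  have \<beta>0: "\<beta> \<ge> 0" unfolding \<beta>_def by (rule coin_mean_nonneg) simp
  have "\<beta> \<le> coin_mean M (\<lambda>xs. exp (- (c * real M) * pair_gap (pos \<epsilon> xs)))"
    unfolding \<beta>_def using M by (intro coin_mean_block_sum_le) auto
  then have \<beta>: "\<beta> \<le> qrate" "\<beta> \<le> 83 / sqrt (real m)"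
    using block_rate[OF M e0 e1 m c] by linarith+
  have "coin_mean n (\<lambda>xs. exp (- c * blocks_sum \<epsilon> M J xs)) = \<beta> ^ J" unfolding n coin_mean_blocks_sum \<beta>_def ..
  also have "\<dots> = \<beta> ^ (J - 4) * \<beta> ^ 4" using J by (simp flip: power_add)
  also have "\<dots> \<le> qrate ^ (J - 4) * (83 / sqrt (real m)) ^ 4"
    using \<beta>0 \<beta> qrate by (intro mult_mono power_mono) auto
  also have "(83 / sqrt (real m)) ^ 4 = 83 ^ 4 / (real m)\<^sup>2"
  proof -
    have "sqrt (real m) ^ 4 = (sqrt (real m) ^ 2) ^ 2" by (simp only: power_mult[symmetric]) simp
    then have "sqrt (real m) ^ 4 = (real m)\<^sup>2" by simp
    then show ?thesis by (simp add: power_divide)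
  qed
  finally show ?thesis by (simp only: c_def)
qed

section \<open>Quadratic path sums and Gaussian averages\<close>

lemma path_sum_add: "path_sum \<epsilon> (\<lambda>v. f v + g v) xs v = path_sum \<epsilon> f xs v + path_sum \<epsilon> g xs v"
  by (induction xs arbitrary: v) auto

lemma path_sum_cmult: "path_sum \<epsilon> (\<lambda>v. c * f v) xs v = c * path_sum \<epsilon> f xs v"
  by (induction xs arbitrary: v) (auto simp: algebra_simps)

lemma path_sum_const: "path_sum \<epsilon> (\<lambda>v. c) xs v = c * real (length xs)"
  by (induction xs arbitrary: v) (auto simp: algebra_simps)

lemma path_sum_square:
  "path_sum \<epsilon> (\<lambda>v. (p * exp v + q)\<^sup>2) xs v = p\<^sup>2 * path_sum \<epsilon> (\<lambda>v. (exp v)\<^sup>2) xs v + 2 * p * q * path_sum \<epsilon> exp xs v + q\<^sup>2 * real (length xs)"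
proof -
  have "(\<lambda>v. (p * exp v + q)\<^sup>2) = (\<lambda>v. (p\<^sup>2 * (exp v)\<^sup>2 + (2 * p * q) * exp v) + q\<^sup>2)"
    by (rule ext) (simp add: power2_eq_square algebra_simps)
  then show ?thesis by (simp only: path_sum_add path_sum_cmult path_sum_const)
qed

lemma path_sum_pos: "(\<And>v. f v > 0) \<Longrightarrow> xs \<noteq> [] \<Longrightarrow> path_sum \<epsilon> f xs v > 0"
proof (induction xs arbitrary: v)
  case (Cons b xs)
  then show ?case by (cases "xs = []") (auto intro: add_pos_pos)
qed simp

text \<open>The characteristic function of the normal distribution turns the left-hand side into a Gaussian average of the sum.\<close>

lemma gaussian_average_bound:
  fixes c :: "'i \<Rightarrow> complex" and p :: "'i \<Rightarrow> real"
  assumes I: "finite I" and G: "\<And>x. norm (\<Sum>i\<in>I. c i * cis (p i * x)) \<le> G"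
  shows "norm (\<Sum>i\<in>I. c i * cis (p i * x0) * of_real (exp (- (p i * s + k)\<^sup>2 / 2))) \<le> G"
proof -
  interpret real_distribution std_normal_distribution by (rule real_dist_normal_dist)
  let ?M = std_normal_distribution
  have ch: "complex_of_real (exp (- (r\<^sup>2) / 2)) = (CLINT u|?M. cis (r * u))" for r
    using char_std_normal_distribution by (simp add: char_def fun_eq_iff cis_conv_exp)
  have int: "integrable ?M (\<lambda>u. cis (r * u))" for r
    using integrable_iexp[of "\<lambda>u. r * u"] by (simp add: cis_conv_exp)
  have "(\<Sum>i\<in>I. c i * cis (p i * x0) * of_real (exp (- (p i * s + k)\<^sup>2 / 2)))
    = (\<Sum>i\<in>I. (CLINT u|?M. c i * cis (p i * x0) * cis ((p i * s + k) * u)))"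
    by (simp only: ch) (simp add: int)
  also have "\<dots> = (CLINT u|?M. (\<Sum>i\<in>I. c i * cis (p i * x0) * cis ((p i * s + k) * u)))"
    by (rule Bochner_Integration.integral_sum[symmetric]) (simp add: int)
  also have "norm \<dots> \<le> (LINT u|?M. norm (\<Sum>i\<in>I. c i * cis (p i * x0) * cis ((p i * s + k) * u)))"
    by (rule integral_norm_bound)
  also have "\<dots> \<le> (LINT u|?M. G)"
  proof (rule integral_mono)
    show "integrable ?M (\<lambda>u. norm (\<Sum>i\<in>I. c i * cis (p i * x0) * cis ((p i * s + k) * u)))"
      by (intro integrable_norm Bochner_Integration.integrable_sum integrable_mult_right int)
    fix u
    \<comment> \<open>For fixed \<open>u\<close> every wave is translated by the same amount
      \<open>s * u\<close>, and \<open>k * u\<close> is a common phase; the hypothesis thus applies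
      at the single point \<open>x0 + s * u\<close>.\<close>
    have "(\<Sum>i\<in>I. c i * cis (p i * x0) * cis ((p i * s + k) * u)) = cis (k * u) * (\<Sum>i\<in>I. c i * cis (p i * (x0 + s * u)))"
      unfolding sum_distrib_left by (intro sum.cong refl) (simp add: cis_mult algebra_simps)
    then show "norm (\<Sum>i\<in>I. c i * cis (p i * x0) * cis ((p i * s + k) * u)) \<le> G"
      using G[of "x0 + s * u"] by (simp add: norm_mult)
  qed simp
  also have "\<dots> = G"
  proof -
    have "prob UNIV = 1" using prob_space by simp
    then show ?thesis by simp
  qed
  finally show ?thesis .
qed

text \<open>The exponent is completed to a square in \<open>p\<close>; what remains is \<open>m\<^sup>2 / 8\<close> times the conditional variance.\<close>

lemma path_weight_bound:
  fixes c :: "'i \<Rightarrow> complex" and p :: "'i \<Rightarrow> real"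
  assumes I: "finite I" and G: "\<And>x. norm (\<Sum>i\<in>I. c i * cis (p i * x)) \<le> G"
    and xs: "length xs = J * (2 * M)" "xs \<noteq> []" and e: "\<epsilon> > 0"
  shows "norm (\<Sum>i\<in>I. c i * cis (p i * x0) * of_real (exp (- (\<epsilon> / 2) * path_sum \<epsilon> (\<lambda>v. (p i * exp v + of_int m / 2)\<^sup>2) xs v)))
     \<le> exp (- ((of_int m)\<^sup>2 / 8 * \<epsilon>) * blocks_sum \<epsilon> M J xs) * G"
proof -
  define \<mu> where "\<mu> = real_of_int m / 2"
  define a b t where "a = \<epsilon> * path_sum \<epsilon> exp xs v" and "b = \<epsilon> * path_sum \<epsilon> (\<lambda>v. (exp v)\<^sup>2) xs v" and "t = \<epsilon> * real (length xs)"
  have b: "b > 0" unfolding b_def using e xs by (intro mult_pos_pos path_sum_pos) auto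
  have w: "\<epsilon> * path_sum \<epsilon> (\<lambda>v. (q * exp v + r)\<^sup>2) xs v = q\<^sup>2 * b + 2 * q * r * a + r\<^sup>2 * t" for q r
    unfolding path_sum_square a_def b_def t_def by (simp add: algebra_simps)
  define W where "W = t - a\<^sup>2 / b"
  \<comment> \<open>The minimizing \<open>l\<close> is \<open>a / b\<close>, the regression
    coefficient of \<open>2 \<phi>\<close> on \<open>x\<close> given the path of \<open>v\<close>;
    the minimum is the conditional variance \<open>W\<close>.\<close>
  have "\<epsilon> * blocks_sum \<epsilon> M J xs \<le> \<epsilon> * path_sum \<epsilon> (\<lambda>v. (1 - (a / b) * exp v)\<^sup>2) xs v"
    using e by (intro mult_left_mono blocks_sum_le_path_sum xs) auto
  also have "(\<lambda>v. (1 - (a / b) * exp v)\<^sup>2) = (\<lambda>v. (- (a / b) * exp v + 1)\<^sup>2)" by (simp add: algebra_simps)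
  also have "\<epsilon> * path_sum \<epsilon> \<dots> xs v = W"
    unfolding w W_def using b by (simp add: field_simps power2_eq_square)
  finally have W: "\<epsilon> * blocks_sum \<epsilon> M J xs \<le> W" .
  define s k where "s = sqrt b" and "k = \<mu> * a / sqrt b"
  have s: "s > 0" "s\<^sup>2 = b" using b by (auto simp: s_def)
  have k: "k = \<mu> * a / s" by (simp add: k_def s_def)
  have eq: "exp (- (\<epsilon> / 2) * path_sum \<epsilon> (\<lambda>v. (p i * exp v + of_int m / 2)\<^sup>2) xs v)
      = exp (- (\<mu>\<^sup>2 / 2) * W) * exp (- (p i * s + k)\<^sup>2 / 2)" for i
  proof -
    have "(p i * s + k)\<^sup>2 = (p i)\<^sup>2 * s\<^sup>2 + 2 * p i * (s * k) + k\<^sup>2" by (simp add: power2_eq_square algebra_simps)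
    also have "s * k = \<mu> * a" using s(1) by (simp add: k)
    also have "k\<^sup>2 = \<mu>\<^sup>2 * (a\<^sup>2 / b)" using s by (simp add: k power_divide power_mult_distrib)
    finally have "(p i * s + k)\<^sup>2 + \<mu>\<^sup>2 * W = \<epsilon> * path_sum \<epsilon> (\<lambda>v. (p i * exp v + \<mu>)\<^sup>2) xs v"
      unfolding w W_def s(2) by (simp add: algebra_simps)
    then have "- (\<epsilon> / 2) * path_sum \<epsilon> (\<lambda>v. (p i * exp v + of_int m / 2)\<^sup>2) xs v = - (\<mu>\<^sup>2 / 2) * W + - (p i * s + k)\<^sup>2 / 2"
      unfolding \<mu>_def by simp
    then show ?thesis by (simp only: exp_add)
  qed
  have G0: "G \<ge> 0" using G[of 0] by (meson norm_ge_zero order_trans)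
  have "norm (\<Sum>i\<in>I. c i * cis (p i * x0) * of_real (exp (- (\<epsilon> / 2) * path_sum \<epsilon> (\<lambda>v. (p i * exp v + of_int m / 2)\<^sup>2) xs v)))
     = norm (of_real (exp (- (\<mu>\<^sup>2 / 2) * W)) * (\<Sum>i\<in>I. c i * cis (p i * x0) * of_real (exp (- (p i * s + k)\<^sup>2 / 2))))"
    unfolding eq sum_distrib_left by (rule arg_cong[where f=norm], intro sum.cong refl) (simp only: of_real_mult mult_ac)
  also have "\<dots> = exp (- (\<mu>\<^sup>2 / 2) * W) * norm (\<Sum>i\<in>I. c i * cis (p i * x0) * of_real (exp (- (p i * s + k)\<^sup>2 / 2)))"
    by (simp only: norm_mult norm_of_real abs_exp_cancel)
  also have "\<dots> \<le> exp (- ((of_int m)\<^sup>2 / 8 * \<epsilon>) * blocks_sum \<epsilon> M J xs) * G"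
  proof (intro mult_mono gaussian_average_bound I G)
    have "(\<mu>\<^sup>2 / 2) * (\<epsilon> * blocks_sum \<epsilon> M J xs) \<le> (\<mu>\<^sup>2 / 2) * W" using W by (intro mult_left_mono) auto
    then show "exp (- (\<mu>\<^sup>2 / 2) * W) \<le> exp (- ((of_int m)\<^sup>2 / 8 * \<epsilon>) * blocks_sum \<epsilon> M J xs)"
      by (simp add: \<mu>_def power_divide)
  qed (use G0 in auto)
  finally show ?thesis .
qed

section \<open>Trigonometric polynomials and total variation\<close>

text \<open>A character of \<open>v\<close> with Gaussian damping, which is bounded in the strip
  even with the weights. The damping is removed at the end by sending \<open>\<kappa>\<close> to
  0.\<close>

definition gauss_wave :: "complex \<Rightarrow> real \<Rightarrow> real \<Rightarrow> complex \<Rightarrow> complex" where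
  "gauss_wave c q \<kappa> z = c * exp (\<i> * of_real q * z - of_real \<kappa> * z\<^sup>2)"

lemma strip_bd_gauss_wave:
  assumes "\<kappa> > 0"
  shows "\<exists>B. strip_bd (1/2) 4 B (gauss_wave c q \<kappa>)"
proof
  show "strip_bd (1/2) 4 (norm c * exp (\<bar>q\<bar> / 2 + \<kappa> / 4 + 4 / \<kappa>)) (gauss_wave c q \<kappa>)"
  proof (rule strip_bdI)
    show "gauss_wave c q \<kappa> holomorphic_on strip (1/2)"
      unfolding gauss_wave_def[abs_def] by (intro holomorphic_intros)
    fix z :: complex and j :: nat assume z: "z \<in> strip (1/2)" and j: "j \<le> 4"
    define x y where "x = Re z" and "y = Im z"
    have y: "\<bar>y\<bar> \<le> 1/2" using z by (simp add: strip_def y_def)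
    have "- (q * y) \<le> \<bar>q\<bar> / 2"
    proof -
      have "- (q * y) \<le> \<bar>q * y\<bar>" by simp
      also have "\<dots> \<le> \<bar>q\<bar> * (1/2)" unfolding abs_mult using y by (intro mult_left_mono) auto
      finally show ?thesis by simp
    qed
    moreover have "\<kappa> * y\<^sup>2 \<le> \<kappa> / 4"
    proof -
      have "\<bar>y\<bar>\<^sup>2 \<le> (1/2)\<^sup>2" using y by (intro power_mono) auto
      then have "\<kappa> * y\<^sup>2 \<le> \<kappa> * (1/4)" using assms by (intro mult_left_mono) (auto simp: power_divide)
      then show ?thesis by simp
    qed
    moreover have "real j * x \<le> \<kappa> * x\<^sup>2 + 4 / \<kappa>"
    proof -
      have "real j * x \<le> 4 * \<bar>x\<bar>" using j by (intro order_trans[OF mult_left_mono[of x "\<bar>x\<bar>"] mult_right_mono]) auto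
      moreover have "0 \<le> (sqrt \<kappa> * \<bar>x\<bar> - 2 / sqrt \<kappa>)\<^sup>2" by simp
      then have "4 * \<bar>x\<bar> \<le> \<kappa> * x\<^sup>2 + 4 / \<kappa>"
        using assms by (simp add: power2_diff power_mult_distrib power_divide)
      ultimately show ?thesis by linarith
    qed
    ultimately have le: "- (q * y) - \<kappa> * (x\<^sup>2 - y\<^sup>2) + real j * x \<le> \<bar>q\<bar> / 2 + \<kappa> / 4 + 4 / \<kappa>"
      by (simp add: algebra_simps)
    have "norm (gauss_wave c q \<kappa> z) * exp (real j * Re z) = norm c * exp (- (q * y) - \<kappa> * (x\<^sup>2 - y\<^sup>2) + real j * x)"
      by (simp add: gauss_wave_def norm_mult x_def y_def Re_power2 exp_add)
    also have "\<dots> \<le> norm c * exp (\<bar>q\<bar> / 2 + \<kappa> / 4 + 4 / \<kappa>)" using le by (intro mult_left_mono) auto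
    finally show "norm (gauss_wave c q \<kappa> z) * exp (real j * Re z) \<le> norm c * exp (\<bar>q\<bar> / 2 + \<kappa> / 4 + 4 / \<kappa>)" .
  qed
qed

lemma gauss_wave_real: "gauss_wave c q \<kappa> (of_real v) = c * cis (q * v) * of_real (exp (- \<kappa> * v\<^sup>2))"
  by (simp add: gauss_wave_def cis_conv_exp exp_of_real[symmetric] exp_diff exp_minus divide_inverse mult.assoc)

section \<open>Rotation along the fibre and angular Fourier coefficients\<close>

lemma coordinates_rotate:
  shows "iw_q (g ** expZ (2 * a)) = iw_q g" "iw_x (g ** expZ (2 * a)) = iw_x g" "iw_v (g ** expZ (2 * a)) = iw_v g"
    "iw_w (g ** expZ (2 * a)) = iw_w g * cis (- a)"
proof -
  have ent: "(g ** expZ (2 * a))$i$1 = g$i$1 * cos a - g$i$2 * sin a"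
    "(g ** expZ (2 * a))$i$2 = g$i$1 * sin a + g$i$2 * cos a" for i
    by (simp_all add: matrix_matrix_mult_def sum_2 expZ_def)
  have rot: "(x * cos a - y * sin a) * (z * cos a - w * sin a) + (x * sin a + y * cos a) * (z * sin a + w * cos a) = x * z + y * w"
    for x y z w :: real
  proof -
    have "(x * C - y * S) * (z * C - w * S) + (x * S + y * C) * (z * S + w * C) = (x * z + y * w) * (C * C + S * S)"
      for C S :: real by (simp add: algebra_simps)
    then show ?thesis by (simp only: sin_cos_squared_add3 mult_1_right)
  qed
  show q: "iw_q (g ** expZ (2 * a)) = iw_q g"
    unfolding iw_q_def ent power2_eq_square by (rule rot)
  show "iw_x (g ** expZ (2 * a)) = iw_x g" unfolding iw_x_def q unfolding ent rot ..
  show "iw_v (g ** expZ (2 * a)) = iw_v g" by (simp add: iw_v_def q)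
  show "iw_w (g ** expZ (2 * a)) = iw_w g * cis (- a)"
    unfolding iw_w_def q ent by (simp add: complex_eq_iff algebra_simps add_divide_distrib diff_divide_distrib)
qed

lemma expZ_SL2: "g \<in> SL2 \<Longrightarrow> g ** expZ s \<in> SL2"
proof -
  have "det (expZ s) = 1" by (simp add: det_2 expZ_def power2_eq_square[symmetric])
  moreover assume "g \<in> SL2"
  ultimately show ?thesis unfolding SL2_def mem_Collect_eq det_mul by simp
qed

text \<open>The displacement enters the estimates only through this phase. Since the phase has
  modulus 1, the final constants do not depend on \<open>a\<close>.\<close>

lemma wave_rotate: "wave p m F (g ** expZ (2 * a)) = cis (- (of_int m * a)) * wave p m F g"
  unfolding wave_def coordinates_rotate power_int_mult_distrib cis_power_int by simp

lemma sum_roots_of_unity: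
  assumes "j \<noteq> 0" "\<bar>j\<bar> < int N"
  shows "(\<Sum>k<N. cis (2 * pi * of_int j * real k / real N)) = 0"
proof -
  define z where "z = cis (2 * pi * of_int j / real N)"
  have N: "real N > 0" using assms by simp
  have "z \<noteq> 1"
  proof
    assume "z = 1"
    then obtain n :: int where "2 * pi * of_int j / real N = of_int (2 * n) * pi"
      unfolding z_def cis_conv_exp exp_eq_1 by auto
    then have "real_of_int j = of_int n * real N" using N by (simp add: field_simps)
    then have "j = n * int N" by (metis of_int_eq_iff of_int_mult of_int_of_nat_eq)
    then have "int N dvd j" by simp
    then show False using assms zdvd_imp_le[of "int N" "\<bar>j\<bar>"] by auto
  qed
  moreover have "z ^ N = 1"
  proof -
    have "z ^ N = cis (real N * (2 * pi * of_int j / real N))" unfolding z_def by (rule Complex.DeMoivre)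
    also have "real N * (2 * pi * of_int j / real N) = 2 * pi * of_int j" using N by simp
    finally show ?thesis by (metis cis_multiple_2pi Ints_of_int)
  qed
  ultimately have "(\<Sum>k<N. z ^ k) = 0" by (simp add: geometric_sum)
  moreover have "z ^ k = cis (2 * pi * of_int j * real k / real N)" for k
    by (simp add: z_def Complex.DeMoivre mult_ac)
  ultimately show ?thesis by simp
qed

text \<open>A finite average over the \<open>N\<close>-th roots of unity replaces the integral over
  the circle; \<open>N\<close> exceeds every \<open>\<bar>m i - \<mu>\<bar>\<close>, so no other
  frequency is aliased onto \<open>\<mu>\<close>. Only the supremum of the whole sum is used, never
  the size of the single \<open>a i\<close>.\<close>

lemma fourier_coefficient_bound:
  fixes a :: "'i \<Rightarrow> complex" and m :: "'i \<Rightarrow> int"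
  assumes I: "finite I" and G: "\<And>w. norm w = 1 \<Longrightarrow> norm (\<Sum>i\<in>I. a i * w powi m i) \<le> G"
  shows "norm (\<Sum>i\<in>{i\<in>I. m i = \<mu>}. a i) \<le> G"
proof -
  define N where "N = Suc (\<Sum>i\<in>I. nat \<bar>m i - \<mu>\<bar>)"
  have Nb: "\<bar>m i - \<mu>\<bar> < int N" if "i \<in> I" for i
  proof -
    have "nat \<bar>m i - \<mu>\<bar> \<le> (\<Sum>i\<in>I. nat \<bar>m i - \<mu>\<bar>)" using I that by (intro member_le_sum) auto
    then show ?thesis unfolding N_def by linarith
  qed
  have "N > 0" by (simp only: N_def zero_less_Suc)
  then have N: "real N > 0" by simp
  define w where "w k = cis (2 * pi * real k / real N)" for k
  have c: "w k powi (- \<mu>) * w k powi m i = cis (2 * pi * of_int (m i - \<mu>) * real k / real N)" for k i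
    unfolding w_def cis_power_int cis_mult by (rule arg_cong[where f=cis]) (simp add: field_simps diff_divide_distrib)
  have "(\<Sum>k<N. w k powi (- \<mu>) * (\<Sum>i\<in>I. a i * w k powi m i)) = (\<Sum>k<N. \<Sum>i\<in>I. a i * cis (2 * pi * of_int (m i - \<mu>) * real k / real N))"
    unfolding sum_distrib_left c[symmetric] by (intro sum.cong refl) (simp add: mult_ac)
  also have "\<dots> = (\<Sum>i\<in>I. a i * (\<Sum>k<N. cis (2 * pi * of_int (m i - \<mu>) * real k / real N)))"
    by (subst sum.swap) (simp add: sum_distrib_left)
  also have "\<dots> = (\<Sum>i\<in>I. if m i = \<mu> then of_nat N * a i else 0)"
  proof (intro sum.cong refl)
    fix i assume "i \<in> I"
    show "a i * (\<Sum>k<N. cis (2 * pi * of_int (m i - \<mu>) * real k / real N)) = (if m i = \<mu> then of_nat N * a i else 0)"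
    proof (cases "m i = \<mu>")
      case False
      then show ?thesis using sum_roots_of_unity[of "m i - \<mu>" N] Nb[OF \<open>i \<in> I\<close>] by (simp del: of_int_diff)
    qed simp
  qed
  also have "\<dots> = of_nat N * (\<Sum>i\<in>{i\<in>I. m i = \<mu>}. a i)"
    using I by (simp add: sum.If_cases sum_distrib_left Int_def)
  finally have eq: "of_nat N * (\<Sum>i\<in>{i\<in>I. m i = \<mu>}. a i) = (\<Sum>k<N. w k powi (- \<mu>) * (\<Sum>i\<in>I. a i * w k powi m i))" ..
  have "real N * norm (\<Sum>i\<in>{i\<in>I. m i = \<mu>}. a i) = norm (\<Sum>k<N. w k powi (- \<mu>) * (\<Sum>i\<in>I. a i * w k powi m i))"
    unfolding eq[symmetric] by (simp add: norm_mult)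
  also have "\<dots> \<le> (\<Sum>k<N. norm (w k powi (- \<mu>) * (\<Sum>i\<in>I. a i * w k powi m i)))" by (rule norm_sum)
  also have "\<dots> \<le> (\<Sum>k<N. G)"
    by (intro sum_mono) (use G in \<open>auto simp: norm_mult norm_power_int w_def\<close>)
  finally show ?thesis using N by simp
qed

lemma sum_inverse_squares_nat: "(\<Sum>k\<in>{1..n}. 1 / (real k)\<^sup>2) \<le> 2 - 1 / real n"
proof (induction n)
  case (Suc n)
  show ?case
  proof (cases "n = 0")
    case False
    then have "1 / (real (Suc n))\<^sup>2 \<le> 1 / real n - 1 / real (Suc n)"
      by (simp add: divide_simps power2_eq_square)
    moreover have "(\<Sum>k\<in>{1..Suc n}. 1 / (real k)\<^sup>2) = (\<Sum>k\<in>{1..n}. 1 / (real k)\<^sup>2) + 1 / (real (Suc n))\<^sup>2"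
      by simp
    ultimately show ?thesis using Suc by linarith
  qed simp
qed simp

lemma sum_inverse_squares_int:
  fixes S :: "int set"
  assumes "finite S" "0 \<notin> S"
  shows "(\<Sum>k\<in>S. 1 / (of_int k)\<^sup>2) \<le> (4 :: real)"
proof -
  define A B where "A = {k\<in>S. k > 0}" and "B = {k\<in>S. k < 0}"
  have half: "(\<Sum>k\<in>T. 1 / (of_int k)\<^sup>2) \<le> (2 :: real)" if T: "finite T" "inj_on (\<lambda>k. nat \<bar>k\<bar>) T" "0 \<notin> T" for T :: "int set"
  proof -
    define n where "n = Max (insert 0 ((\<lambda>k. nat \<bar>k\<bar>) ` T))"
    have "(\<Sum>k\<in>T. 1 / (of_int k)\<^sup>2) = (\<Sum>k\<in>T. 1 / (real (nat \<bar>k\<bar>))\<^sup>2)" by (intro sum.cong) auto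
    also have "\<dots> = (\<Sum>k\<in>(\<lambda>k. nat \<bar>k\<bar>) ` T. 1 / (real k)\<^sup>2)" using T by (simp add: sum.reindex)
    also have "\<dots> \<le> (\<Sum>k\<in>{1..n}. 1 / (real k)\<^sup>2)"
    proof (rule sum_mono2)
      show "(\<lambda>k. nat \<bar>k\<bar>) ` T \<subseteq> {1..n}"
      proof
        fix j assume j: "j \<in> (\<lambda>k. nat \<bar>k\<bar>) ` T"
        then have "j \<le> n" unfolding n_def using T by (intro Max_ge) auto
        moreover have "j \<ge> 1" using j T(3) by (auto simp: Suc_le_eq)
        ultimately show "j \<in> {1..n}" by simp
      qed
    qed auto
    also have "\<dots> \<le> 2 - 1 / real n" by (rule sum_inverse_squares_nat)
    also have "\<dots> \<le> 2" by simp
    finally show ?thesis .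
  qed
  have "x < 0 \<or> x > 0" if "x \<in> S" for x using assms(2) that by (cases "x = 0") auto
  then have "S = A \<union> B" "A \<inter> B = {}" by (auto simp: A_def B_def)
  then have "(\<Sum>k\<in>S. 1 / (of_int k)\<^sup>2) = (\<Sum>k\<in>A. 1 / (of_int k)\<^sup>2) + (\<Sum>k\<in>B. 1 / (of_int k)\<^sup>2 :: real)"
    using assms by (metis sum.union_disjoint finite_Un)
  also have "\<dots> \<le> 2 + 2"
    using assms by (intro add_mono half) (auto simp: A_def B_def inj_on_def)
  finally show ?thesis by simp
qed

text \<open>The terms are grouped by angular frequency before norms are taken, since only a whole
  group is controlled by \<open>G\<close>. The group of frequency 0 has the factor
  \<open>1 - cis 0\<close> and drops out. The 8 is 2, from the difference of two phases, times 4,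
  from the sum of inverse squares.\<close>

lemma walk_difference:
  fixes c :: "nat \<Rightarrow> complex" and p q :: "nat \<Rightarrow> real" and m :: "nat \<Rightarrow> int"
  assumes g: "g \<in> SL2" and \<kappa>: "\<kappa> \<ge> 0"
    and G: "\<And>x v w. norm w = 1 \<Longrightarrow> norm (\<Sum>i<L. c i * cis (p i * x) * cis (q i * v) * w powi m i) \<le> G"
    and M: "M = 2 * N" "M \<ge> 16" "\<And>i. i < L \<Longrightarrow> \<bar>m i\<bar> \<le> int M"
    and J: "J \<ge> 4" "real J \<le> t" and n: "n = J * (2 * M)"
  shows "norm ((\<Sum>i<L. wave (p i) (m i) ((walk_op (p i) (m i) (t / real n) ^^ n) (gauss_wave (c i) (q i) \<kappa>)) g)
      - (\<Sum>i<L. wave (p i) (m i) ((walk_op (p i) (m i) (t / real n) ^^ n) (gauss_wave (c i) (q i) \<kappa>)) (g ** expZ (2 * a))))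
     \<le> 8 * 83 ^ 4 * qrate ^ (J - 4) * G"
proof -
  define \<epsilon> where "\<epsilon> = t / real n"
  have n0: "n > 0" using n J M by simp
  have e: "\<epsilon> > 0" unfolding \<epsilon>_def using n0 J by simp
  have G0: "G \<ge> 0" using G[of 1 0 0] by (meson norm_ge_zero norm_one order_trans)
  define v where "v = iw_v g"
  define x where "x = iw_x g"
  define w where "w = iw_w g"
  have w: "norm w = 1" using g by (simp add: w_def norm_iw_w SL2_iw_q)
  define wt where "wt r \<mu> xs = exp (- (\<epsilon> / 2) * path_sum \<epsilon> (\<lambda>v. (r * exp v + of_int \<mu> / 2)\<^sup>2) xs v)" for r \<mu> xs
  define b where "b i xs = c i * cis (q i * (v + pos \<epsilon> xs)) * of_real (exp (- \<kappa> * (v + pos \<epsilon> xs)\<^sup>2))" for i xs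
  define C where "C \<mu> = coin_mean n (\<lambda>xs. \<Sum>i\<in>{i\<in>{..<L}. m i = \<mu>}. b i xs * cis (p i * x) * of_real (wt (p i) \<mu> xs))" for \<mu>
  have H: "wave (p i) (m i) ((walk_op (p i) (m i) \<epsilon> ^^ n) (gauss_wave (c i) (q i) \<kappa>)) g
      = w powi m i * coin_mean n (\<lambda>xs. b i xs * cis (p i * x) * of_real (wt (p i) (m i) xs))" for i
  proof -
    have "(walk_op (p i) (m i) \<epsilon> ^^ n) (gauss_wave (c i) (q i) \<kappa>) (of_real v) = coin_mean n (\<lambda>xs. of_real (wt (p i) (m i) xs) * b i xs)"
      unfolding walk_op_paths wt_def b_def gauss_wave_real ..
    then have "wave (p i) (m i) ((walk_op (p i) (m i) \<epsilon> ^^ n) (gauss_wave (c i) (q i) \<kappa>)) g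
      = w powi m i * (cis (p i * x) * coin_mean n (\<lambda>xs. of_real (wt (p i) (m i) xs) * b i xs))"
      by (simp add: wave_def w_def x_def v_def)
    also have "cis (p i * x) * coin_mean n (\<lambda>xs. of_real (wt (p i) (m i) xs) * b i xs) = coin_mean n (\<lambda>xs. b i xs * cis (p i * x) * of_real (wt (p i) (m i) xs))"
      unfolding coin_mean_cmult[symmetric] by (rule coin_mean_cong) (simp only: mult_ac)
    finally show ?thesis .
  qed
  define d where "d \<mu> = w powi \<mu> * (1 - cis (- (of_int \<mu> * a)))" for \<mu> :: int
  have "(\<Sum>i<L. wave (p i) (m i) ((walk_op (p i) (m i) \<epsilon> ^^ n) (gauss_wave (c i) (q i) \<kappa>)) g)
      - (\<Sum>i<L. wave (p i) (m i) ((walk_op (p i) (m i) \<epsilon> ^^ n) (gauss_wave (c i) (q i) \<kappa>)) (g ** expZ (2 * a)))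
     = (\<Sum>i<L. d (m i) * coin_mean n (\<lambda>xs. b i xs * cis (p i * x) * of_real (wt (p i) (m i) xs)))"
    unfolding wave_rotate sum_subtractf[symmetric] H d_def by (intro sum.cong refl) (simp add: algebra_simps)
  also have "\<dots> = (\<Sum>\<mu>\<in>m ` {..<L}. \<Sum>i\<in>{i\<in>{..<L}. m i = \<mu>}. d (m i) * coin_mean n (\<lambda>xs. b i xs * cis (p i * x) * of_real (wt (p i) (m i) xs)))"
    by (rule sum.group[symmetric]) auto
  also have "\<dots> = (\<Sum>\<mu>\<in>m ` {..<L}. d \<mu> * C \<mu>)"
    unfolding C_def by (intro sum.cong refl) (simp add: coin_mean_sum sum_distrib_left)
  also have "\<dots> = (\<Sum>\<mu>\<in>m ` {..<L} - {0}. d \<mu> * C \<mu>)"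
    by (rule sum.mono_neutral_right) (auto simp: d_def)
  finally have eq: "(\<Sum>i<L. wave (p i) (m i) ((walk_op (p i) (m i) \<epsilon> ^^ n) (gauss_wave (c i) (q i) \<kappa>)) g)
      - (\<Sum>i<L. wave (p i) (m i) ((walk_op (p i) (m i) \<epsilon> ^^ n) (gauss_wave (c i) (q i) \<kappa>)) (g ** expZ (2 * a)))
     = (\<Sum>\<mu>\<in>m ` {..<L} - {0}. d \<mu> * C \<mu>)" .
  have d2: "norm (d \<mu>) \<le> 2" for \<mu>
    unfolding d_def norm_mult using norm_triangle_ineq4[of 1 "cis (- (of_int \<mu> * a))"] by (simp add: norm_power_int w)
  have C: "norm (C \<mu>) \<le> qrate ^ (J - 4) * (83 ^ 4 / (of_int \<mu>)\<^sup>2) * G" if \<mu>: "\<mu> \<in> m ` {..<L} - {0}" for \<mu>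
  proof -
    have "norm (C \<mu>) \<le> coin_mean n (\<lambda>xs. norm (\<Sum>i\<in>{i\<in>{..<L}. m i = \<mu>}. b i xs * cis (p i * x) * of_real (wt (p i) \<mu> xs)))"
      unfolding C_def by (rule coin_mean_norm)
    also have "\<dots> \<le> coin_mean n (\<lambda>xs. exp (- ((of_int \<mu>)\<^sup>2 / 8 * \<epsilon>) * blocks_sum \<epsilon> M J xs) * G)"
    proof (rule coin_mean_mono)
      fix xs :: "bool list" assume xs: "length xs = n"
      \<comment> \<open>For a fixed path the end point \<open>V\<close> is common to all terms, so
        the Gaussian damping is a common factor of at most 1 and what remains is a trigonometric
        polynomial in \<open>y\<close>.\<close>
      define V where "V = v + pos \<epsilon> xs"
      show "norm (\<Sum>i\<in>{i\<in>{..<L}. m i = \<mu>}. b i xs * cis (p i * x) * of_real (wt (p i) \<mu> xs)) \<le> exp (- ((of_int \<mu>)\<^sup>2 / 8 * \<epsilon>) * blocks_sum \<epsilon> M J xs) * G"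
        unfolding wt_def
      proof (rule path_weight_bound)
        fix y
        have "norm (\<Sum>i\<in>{i\<in>{..<L}. m i = \<mu>}. c i * cis (p i * y) * cis (q i * V)) \<le> G"
          by (rule fourier_coefficient_bound) (use G in auto)
        then have "exp (- \<kappa> * V\<^sup>2) * norm (\<Sum>i\<in>{i\<in>{..<L}. m i = \<mu>}. c i * cis (p i * y) * cis (q i * V)) \<le> 1 * G"
          using \<kappa> by (intro mult_mono) auto
        moreover have "(\<Sum>i\<in>{i\<in>{..<L}. m i = \<mu>}. b i xs * cis (p i * y)) =
           of_real (exp (- \<kappa> * V\<^sup>2)) * (\<Sum>i\<in>{i\<in>{..<L}. m i = \<mu>}. c i * cis (p i * y) * cis (q i * V))"
          unfolding b_def V_def[symmetric] sum_distrib_left by (intro sum.cong refl) (simp only: mult_ac)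
        ultimately show "norm (\<Sum>i\<in>{i\<in>{..<L}. m i = \<mu>}. b i xs * cis (p i * y)) \<le> G"
          by (simp only: norm_mult norm_of_real abs_exp_cancel mult_1_left)
      qed (use xs n n0 e in auto)
    qed
    also have "\<dots> = G * coin_mean n (\<lambda>xs. exp (- ((real (nat \<bar>\<mu>\<bar>))\<^sup>2 / 8 * \<epsilon>) * blocks_sum \<epsilon> M J xs))"
      unfolding coin_mean_cmult[symmetric] by (rule coin_mean_cong) simp
    also have "\<dots> \<le> G * (qrate ^ (J - 4) * (83 ^ 4 / (real (nat \<bar>\<mu>\<bar>))\<^sup>2))"
      using \<mu> M(3) by (intro mult_left_mono G0 walk_decay[OF M(1,2) _ _ J n \<epsilon>_def]) (auto simp: nat_le_iff)
    also have "\<dots> = qrate ^ (J - 4) * (83 ^ 4 / (of_int \<mu>)\<^sup>2) * G" by simp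
    finally show ?thesis .
  qed
  have "norm (\<Sum>\<mu>\<in>m ` {..<L} - {0}. d \<mu> * C \<mu>) \<le> (\<Sum>\<mu>\<in>m ` {..<L} - {0}. 2 * (qrate ^ (J - 4) * (83 ^ 4 / (of_int \<mu>)\<^sup>2) * G))"
    by (intro order_trans[OF norm_sum] sum_mono) (unfold norm_mult, rule mult_mono[OF d2 C], auto)
  also have "\<dots> = 2 * 83 ^ 4 * qrate ^ (J - 4) * G * (\<Sum>\<mu>\<in>m ` {..<L} - {0}. 1 / (of_int \<mu>)\<^sup>2)"
    unfolding sum_distrib_left by (intro sum.cong refl) simp
  also have "\<dots> \<le> 2 * 83 ^ 4 * qrate ^ (J - 4) * G * 4"
    using G0 qrate by (intro mult_left_mono sum_inverse_squares_int) auto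
  finally show ?thesis unfolding eq[folded \<epsilon>_def] \<epsilon>_def[symmetric] by simp
qed

section \<open>Trigonometric polynomials in the coordinates\<close>

definition trig :: "(complex \<times> real \<times> real \<times> int) list \<Rightarrow> real \<Rightarrow> real \<Rightarrow> complex \<Rightarrow> complex" where
  "trig L x v w = (\<Sum>(c, p, q, m)\<leftarrow>L. c * cis (p * x) * cis (q * v) * w powi m)"

lemma trig_simps [simp]:
  "trig [] x v w = 0"
  "trig ((c, p, q, m) # L) x v w = c * cis (p * x) * cis (q * v) * w powi m + trig L x v w"
  "trig (L1 @ L2) x v w = trig L1 x v w + trig L2 x v w"
  by (simp_all add: trig_def)

lemma trig_term_mult:
  assumes "norm w = 1"
  shows "c * cis (p * x) * cis (q * v) * w powi m * trig L x v w
    = trig (map (\<lambda>(c', p', q', m'). (c * c', p + p', q + q', m + m')) L) x v w"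
proof -
  have "w \<noteq> 0" using assms by auto
  then show ?thesis
    by (induction L) (auto simp: distrib_left distrib_right cis_mult[symmetric] power_int_add mult_ac)
qed

lemma trig_mult: "\<exists>L. \<forall>x v w. norm w = 1 \<longrightarrow> trig L1 x v w * trig L2 x v w = trig L x v w"
proof (induction L1)
  case Nil
  then show ?case by (intro exI[of _ "[]"]) simp
next
  case (Cons t L1)
  obtain c p q m where t: "t = (c, p, q, m)" by (metis surj_pair)
  obtain L where L: "\<And>x v w. norm w = 1 \<Longrightarrow> trig L1 x v w * trig L2 x v w = trig L x v w" using Cons by blast
  show ?case
    by (rule exI[of _ "map (\<lambda>(c', p', q', m'). (c * c', p + p', q + q', m + m')) L2 @ L"])
       (simp add: t distrib_right trig_term_mult L)
qed

text \<open>On the unit circle \<open>Re z\<close> is \<open>(z + inverse z) / 2\<close> and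
  \<open>Im z\<close> is \<open>(z - inverse z) / (2 * \<i>)\<close>, so real linear functions
  become trigonometric; sums and products then stay in this class.\<close>

lemma real_polynomial_trig:
  fixes P :: "complex \<times> complex \<times> complex \<Rightarrow> real"
  assumes "real_polynomial_function P"
  shows "\<exists>L. \<forall>x v w. norm w = 1 \<longrightarrow> complex_of_real (P (cis (l * x), cis (l * v), w)) = trig L x v w"
  using assms
proof (induction P rule: real_polynomial_function.induct)
  case (linear f)
  interpret bounded_linear f by fact
  define A where "A = complex_of_real (f (1, 0, 0)) / 2"
  define B where "B = complex_of_real (f (\<i>, 0, 0)) / (2 * \<i>)"
  define C where "C = complex_of_real (f (0, 1, 0)) / 2"
  define D where "D = complex_of_real (f (0, \<i>, 0)) / (2 * \<i>)"
  define E where "E = complex_of_real (f (0, 0, 1)) / 2"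
  define F where "F = complex_of_real (f (0, 0, \<i>)) / (2 * \<i>)"
  have f: "f (X, V, w) = Re X * f (1, 0, 0) + Im X * f (\<i>, 0, 0) + Re V * f (0, 1, 0) + Im V * f (0, \<i>, 0)
     + Re w * f (0, 0, 1) + Im w * f (0, 0, \<i>)" for X V w
  proof -
    have "(X, V, w) = Re X *\<^sub>R (1, 0, 0) + Im X *\<^sub>R (\<i>, 0, 0) + Re V *\<^sub>R (0, 1, 0) + Im V *\<^sub>R (0, \<i>, 0)
      + Re w *\<^sub>R (0, 0, 1) + Im w *\<^sub>R (0, 0, \<i>)"
      by (simp add: complex_eq_iff)
    then have "f (X, V, w) = f (Re X *\<^sub>R (1, 0, 0) + Im X *\<^sub>R (\<i>, 0, 0) + Re V *\<^sub>R (0, 1, 0) + Im V *\<^sub>R (0, \<i>, 0)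
      + Re w *\<^sub>R (0, 0, 1) + Im w *\<^sub>R (0, 0, \<i>))" by (rule arg_cong)
    then show ?thesis unfolding add scaleR real_scaleR_def .
  qed
  have re: "complex_of_real (Re z) * y = y / 2 * z + y / 2 * inverse z"
    and im: "complex_of_real (Im z) * y = y / (2 * \<i>) * z - y / (2 * \<i>) * inverse z" if "norm z = 1" for z y
  proof -
    have "z * cnj z = 1" using complex_norm_square[of z] that by simp
    then have i: "inverse z = cnj z" by (rule inverse_unique)
    show "complex_of_real (Re z) * y = y / 2 * z + y / 2 * inverse z"
      unfolding i by (simp add: complex_eq_iff field_simps)
    show "complex_of_real (Im z) * y = y / (2 * \<i>) * z - y / (2 * \<i>) * inverse z"
      unfolding i right_diff_distrib[symmetric] complex_diff_cnj by (simp add: complex_eq_iff)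
  qed
  show ?case
  proof (intro exI allI impI)
    fix x v :: real and w :: complex assume w: "norm w = 1"
    have "complex_of_real (f (cis (l * x), cis (l * v), w)) =
      (A * cis (l * x) + A * inverse (cis (l * x))) + (B * cis (l * x) - B * inverse (cis (l * x)))
      + (C * cis (l * v) + C * inverse (cis (l * v))) + (D * cis (l * v) - D * inverse (cis (l * v)))
      + (E * w + E * inverse w) + (F * w - F * inverse w)"
      by (subst f) (simp only: of_real_add of_real_mult re[OF norm_cis] im[OF norm_cis] re[OF w] im[OF w] A_def B_def C_def D_def E_def F_def)
    also have "\<dots> = trig [(A, l, 0, 0), (A, - l, 0, 0), (B, l, 0, 0), (- B, - l, 0, 0), (C, 0, l, 0), (C, 0, - l, 0),
        (D, 0, l, 0), (- D, 0, - l, 0), (E, 0, 0, 1), (E, 0, 0, -1), (F, 0, 0, 1), (- F, 0, 0, -1)] x v w"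
      by (simp add: power_int_minus)
    finally show "complex_of_real (f (cis (l * x), cis (l * v), w)) = trig [(A, l, 0, 0), (A, - l, 0, 0), (B, l, 0, 0),
        (- B, - l, 0, 0), (C, 0, l, 0), (C, 0, - l, 0), (D, 0, l, 0), (- D, 0, - l, 0), (E, 0, 0, 1), (E, 0, 0, -1),
        (F, 0, 0, 1), (- F, 0, 0, -1)] x v w" .
  qed
next
  case (const c)
  show ?case by (rule exI[of _ "[(of_real c, 0, 0, 0)]"]) simp
next
  case (add f g)
  then obtain L1 L2 where "\<forall>x v w. norm w = 1 \<longrightarrow> complex_of_real (f (cis (l * x), cis (l * v), w)) = trig L1 x v w"
    "\<forall>x v w. norm w = 1 \<longrightarrow> complex_of_real (g (cis (l * x), cis (l * v), w)) = trig L2 x v w" by blast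
  then show ?case by (intro exI[of _ "L1 @ L2"]) simp
next
  case (mult f g)
  then obtain L1 L2 where 1: "\<forall>x v w. norm w = 1 \<longrightarrow> complex_of_real (f (cis (l * x), cis (l * v), w)) = trig L1 x v w"
    "\<forall>x v w. norm w = 1 \<longrightarrow> complex_of_real (g (cis (l * x), cis (l * v), w)) = trig L2 x v w" by blast
  obtain L where "\<forall>x v w. norm w = 1 \<longrightarrow> trig L1 x v w * trig L2 x v w = trig L x v w" using trig_mult by blast
  with 1 show ?case by (intro exI[of _ L]) simp
qed

text \<open>Only \<open>x\<close> and \<open>v\<close> need to be wrapped, with period
  \<open>2 * pi / l\<close>, as the fibre is already a circle. The compact range makes
  Stone-Weierstrass approximation uniform.\<close>

definition torus_coord :: "real \<Rightarrow> mat2 \<Rightarrow> complex \<times> complex \<times> complex" where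
  "torus_coord l g = (cis (l * iw_x g), cis (l * iw_v g), iw_w g)"

definition torus :: "(complex \<times> complex \<times> complex) set" where
  "torus = sphere 0 1 \<times> sphere 0 1 \<times> sphere 0 1"

lemma compact_torus: "compact torus"
  unfolding torus_def by (intro compact_Times compact_sphere)

definition damped :: "(complex \<times> real \<times> real \<times> int) list \<Rightarrow> real \<Rightarrow> mat2 \<Rightarrow> real" where
  "damped L \<kappa> g = indicator SL2 g * (exp (- \<kappa> * (iw_v g)\<^sup>2) * Re (trig L (iw_x g) (iw_v g) (iw_w g)))"

text \<open>The bound of \<open>walk_difference\<close> with \<open>G = 1\<close> and as many blocks
  as there are whole units in \<open>t\<close>.\<close>

definition tv_bound :: "real \<Rightarrow> real" where
  "tv_bound t = 8 * 83 ^ 4 * qrate ^ (nat \<lfloor>t\<rfloor> - 4)"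

lemma tv_bound_nonneg: "tv_bound t \<ge> 0"
  using qrate by (simp add: tv_bound_def)

lemma trig_nth:
  "trig L x v w = (\<Sum>i<length L. fst (L!i) * cis (fst (snd (L!i)) * x) * cis (fst (snd (snd (L!i))) * v) * w powi snd (snd (snd (L!i))))"
  by (simp add: trig_def sum_list_sum_nth atLeast0LessThan case_prod_unfold)

lemma damped_sum:
  "damped L \<kappa> g = (\<Sum>i<length L. indicator SL2 g * Re (wave (fst (snd (L!i))) (snd (snd (snd (L!i)))) (gauss_wave (fst (L!i)) (fst (snd (snd (L!i)))) \<kappa>) g))"
proof -
  have "of_real (exp (- \<kappa> * (iw_v g)\<^sup>2)) * trig L (iw_x g) (iw_v g) (iw_w g)
     = (\<Sum>i<length L. wave (fst (snd (L!i))) (snd (snd (snd (L!i)))) (gauss_wave (fst (L!i)) (fst (snd (snd (L!i)))) \<kappa>) g)"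
    unfolding trig_nth sum_distrib_left wave_def gauss_wave_real by (intro sum.cong refl) (simp only: mult_ac)
  from arg_cong[OF this, of Re] have "exp (- \<kappa> * (iw_v g)\<^sup>2) * Re (trig L (iw_x g) (iw_v g) (iw_w g))
     = (\<Sum>i<length L. Re (wave (fst (snd (L!i))) (snd (snd (snd (L!i)))) (gauss_wave (fst (L!i)) (fst (snd (snd (L!i)))) \<kappa>) g))"
    by (simp only: Re_sum) simp
  then show ?thesis unfolding damped_def sum_distrib_left[symmetric] by (rule arg_cong)
qed

lemma (in SL2_prob) damped_integral:
  assumes "\<kappa> > 0"
  shows "damped L \<kappa> \<in> borel_measurable M"
    and "integral\<^sup>L M (damped L \<kappa>) = (\<Sum>i<length L. wave_mean M (fst (snd (L!i))) (snd (snd (snd (L!i)))) (gauss_wave (fst (L!i)) (fst (snd (snd (L!i)))) \<kappa>))"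
proof -
  have m: "(\<lambda>g. indicator SL2 g * Re (wave p m (gauss_wave c q \<kappa>) g)) \<in> borel_measurable M"
    and i: "integrable M (\<lambda>g. indicator SL2 g * Re (wave p m (gauss_wave c q \<kappa>) g))" for p m c q
  proof -
    obtain B where B: "strip_bd (1/2) 4 B (gauss_wave c q \<kappa>)" using strip_bd_gauss_wave[OF assms] by blast
    show m: "(\<lambda>g. indicator SL2 g * Re (wave p m (gauss_wave c q \<kappa>) g)) \<in> borel_measurable M"
      by (rule wave_measurable[OF strip_bdD(1)[OF B]]) simp
    show "integrable M (\<lambda>g. indicator SL2 g * Re (wave p m (gauss_wave c q \<kappa>) g))"
    proof (rule integrable_SL2[OF m])
      fix x assume x: "x \<in> SL2"
      show "\<bar>indicator SL2 x * Re (wave p m (gauss_wave c q \<kappa>) x)\<bar> \<le> B"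
        using abs_Re_le_cmod[of "wave p m (gauss_wave c q \<kappa>) x"] strip_bd_norm_wave[OF B _ x, of p m] x by simp
    qed
  qed
  have eq: "damped L \<kappa> = (\<lambda>g. \<Sum>i<length L. indicator SL2 g * Re (wave (fst (snd (L!i))) (snd (snd (snd (L!i)))) (gauss_wave (fst (L!i)) (fst (snd (snd (L!i)))) \<kappa>) g))"
    by (rule ext) (rule damped_sum)
  show "damped L \<kappa> \<in> borel_measurable M" unfolding eq by (intro borel_measurable_sum m)
  show "integral\<^sup>L M (damped L \<kappa>) = (\<Sum>i<length L. wave_mean M (fst (snd (L!i))) (snd (snd (snd (L!i)))) (gauss_wave (fst (L!i)) (fst (snd (snd (L!i)))) \<kappa>))"
    unfolding eq wave_mean_def by (rule Bochner_Integration.integral_sum) (rule i)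
qed

text \<open>The error of \<open>BM_walk_limit\<close> depends on the polynomial and on
  \<open>\<kappa>\<close>, but it vanishes as the number of steps grows. The limiting bound sees the
  polynomial only through \<open>G\<close>.\<close>

lemma damped_difference:
  assumes g: "g \<in> SL2" and bm: "SL2_BM_law g \<mu>" "SL2_BM_law (g ** expZ (2 * a)) \<nu>" and t: "t > 4" and \<kappa>: "\<kappa> > 0"
    and G: "\<And>x v w. norm w = 1 \<Longrightarrow> norm (trig L x v w) \<le> G"
  shows "\<bar>integral\<^sup>L (\<mu> t) (damped L \<kappa>) - integral\<^sup>L (\<nu> t) (damped L \<kappa>)\<bar> \<le> tv_bound t * G"
proof -
  define g' where "g' = g ** expZ (2 * a)"
  have g': "g' \<in> SL2" unfolding g'_def by (rule expZ_SL2[OF g])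
  interpret m: SL2_prob "\<mu> t" by (rule SL2_BM_prob[OF bm(1)]) (use t in simp)
  interpret n: SL2_prob "\<nu> t" by (rule SL2_BM_prob[OF bm(2)]) (use t in simp)
  define c where "c i = fst (L!i)" for i
  define p where "p i = fst (snd (L!i))" for i
  define q where "q i = fst (snd (snd (L!i)))" for i
  define m where "m i = snd (snd (snd (L!i)))" for i
  define l where "l = length L"
  define Wk where "Wk n h = (\<Sum>i<l. wave (p i) (m i) ((walk_op (p i) (m i) (t / real n) ^^ n) (gauss_wave (c i) (q i) \<kappa>)) h)" for n h
  have Im: "integral\<^sup>L (\<mu> t) (damped L \<kappa>) = (\<Sum>i<l. wave_mean (\<mu> t) (p i) (m i) (gauss_wave (c i) (q i) \<kappa>))"
    unfolding p_def q_def m_def c_def l_def by (rule m.damped_integral(2)[OF \<kappa>])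
  have In: "integral\<^sup>L (\<nu> t) (damped L \<kappa>) = (\<Sum>i<l. wave_mean (\<nu> t) (p i) (m i) (gauss_wave (c i) (q i) \<kappa>))"
    unfolding p_def q_def m_def c_def l_def by (rule n.damped_integral(2)[OF \<kappa>])
  have "\<exists>K\<ge>0. \<forall>g \<mu> n. SL2_BM_law g \<mu> \<longrightarrow> g \<in> SL2 \<longrightarrow> real n \<ge> t \<longrightarrow>
     \<bar>wave_mean (\<mu> t) (p i) (m i) (gauss_wave (c i) (q i) \<kappa>) - Re (wave (p i) (m i) ((walk_op (p i) (m i) (t / n) ^^ n) (gauss_wave (c i) (q i) \<kappa>)) g)\<bar> \<le> K / n" for i
  proof -
    obtain B where B: "strip_bd (1/2) 4 B (gauss_wave (c i) (q i) \<kappa>)" using strip_bd_gauss_wave[OF \<kappa>] by blast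
    show ?thesis by (rule BM_walk_limit[OF B]) (use t in simp)
  qed
  then obtain K where K0: "\<And>i. K i \<ge> 0" and K: "\<And>i g \<mu> n. SL2_BM_law g \<mu> \<Longrightarrow> g \<in> SL2 \<Longrightarrow> real n \<ge> t \<Longrightarrow>
     \<bar>wave_mean (\<mu> t) (p i) (m i) (gauss_wave (c i) (q i) \<kappa>) - Re (wave (p i) (m i) ((walk_op (p i) (m i) (t / n) ^^ n) (gauss_wave (c i) (q i) \<kappa>)) g)\<bar> \<le> K i / n"
    by metis
  define KK where "KK = (\<Sum>i<l. K i)"
  have KK0: "KK \<ge> 0" unfolding KK_def by (intro sum_nonneg K0)
  have approx: "\<bar>(\<Sum>i<l. wave_mean (\<mu> t) (p i) (m i) (gauss_wave (c i) (q i) \<kappa>)) - Re (Wk n h)\<bar> \<le> KK / n"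
    if "SL2_BM_law h \<mu>" "h \<in> SL2" "real n \<ge> t" for h \<mu> n
  proof -
    have "\<bar>(\<Sum>i<l. wave_mean (\<mu> t) (p i) (m i) (gauss_wave (c i) (q i) \<kappa>)) - Re (Wk n h)\<bar>
      = \<bar>\<Sum>i<l. wave_mean (\<mu> t) (p i) (m i) (gauss_wave (c i) (q i) \<kappa>) - Re (wave (p i) (m i) ((walk_op (p i) (m i) (t / n) ^^ n) (gauss_wave (c i) (q i) \<kappa>)) h)\<bar>"
      unfolding Wk_def Re_sum sum_subtractf ..
    also have "\<dots> \<le> (\<Sum>i<l. K i / n)" by (intro order_trans[OF sum_abs] sum_mono K[OF that])
    also have "\<dots> = KK / n" unfolding KK_def sum_divide_distrib ..
    finally show ?thesis .
  qed
  define J where "J = nat \<lfloor>t\<rfloor>"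
  have J: "J \<ge> 4" "real J \<le> t" "t < real J + 1" using t unfolding J_def by linarith+
  define D where "D = (\<Sum>i<l. nat \<bar>m i\<bar>)"
  have "\<bar>integral\<^sup>L (\<mu> t) (damped L \<kappa>) - integral\<^sup>L (\<nu> t) (damped L \<kappa>)\<bar> \<le> 2 * KK / real (Suc k) + tv_bound t * G" for k
  proof -
    \<comment> \<open>The 8 ensures \<open>M \<ge> 16\<close>, \<open>D\<close> dominates all
      angular frequencies, and \<open>k\<close> sends the number of steps to infinity.\<close>
    define N where "N = 8 + D + k"
    define M where "M = 2 * N"
    define n where "n = J * (2 * M)"
    have "1 * N \<le> J * (4 * N)" using J by (intro mult_mono) auto
    then have nk: "n \<ge> Suc k" by (simp add: n_def M_def N_def)
    have "J * 2 \<le> J * (2 * M)" unfolding M_def N_def by (intro mult_left_mono) auto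
    then have "2 * real J \<le> real n" unfolding n_def by (metis mult.commute of_nat_le_iff of_nat_mult of_nat_numeral)
    then have nt: "real n \<ge> t" using J by linarith
    have mM: "\<bar>m i\<bar> \<le> int M" if "i < l" for i
    proof -
      have "nat \<bar>m i\<bar> \<le> D" unfolding D_def using that by (intro member_le_sum) auto
      then show ?thesis by (simp add: M_def N_def)
    qed
    have "norm (Wk n g - Wk n g') \<le> 8 * 83 ^ 4 * qrate ^ (J - 4) * G"
      unfolding Wk_def g'_def
    proof (rule walk_difference[OF g _ _ M_def _ mM J(1,2) n_def])
      show "norm (\<Sum>i<l. c i * cis (p i * x) * cis (q i * v) * w powi m i) \<le> G" if "norm w = 1" for x v w
        using G[OF that, of x v] unfolding trig_nth c_def p_def q_def m_def l_def .
    qed (use \<kappa> in \<open>auto simp: M_def N_def\<close>)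
    then have "\<bar>Re (Wk n g) - Re (Wk n g')\<bar> \<le> tv_bound t * G"
      using abs_Re_le_cmod[of "Wk n g - Wk n g'"] by (simp add: tv_bound_def J_def)
    moreover have "KK / n \<le> KK / Suc k" using nk KK0 by (intro divide_left_mono) auto
    ultimately show ?thesis
      using approx[OF bm(1) g nt] approx[OF bm(2)[folded g'_def] g' nt] unfolding Im In by simp
  qed
  moreover have "(\<lambda>k. 2 * KK / real (Suc k) + tv_bound t * G) \<longlonglongrightarrow> 0 + tv_bound t * G"
    by (intro tendsto_intros LIMSEQ_Suc[OF lim_const_over_n])
  ultimately show ?thesis by (intro LIMSEQ_le_const[where X="\<lambda>k. 2 * KK / real (Suc k) + tv_bound t * G"]) auto
qed

text \<open>Passes a bound on differences of means to a pointwise limit; used for the polynomials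
  together with their damping, for continuous functions on the torus, and for the period.\<close>

lemma bounded_limit_difference:
  assumes "SL2_prob M" "SL2_prob N"
    and meas: "\<And>k. h k \<in> borel_measurable M" "\<And>k. h k \<in> borel_measurable N"
    and lim: "\<And>x. (\<lambda>k. h k x) \<longlonglongrightarrow> f x" and bd: "\<And>k x. \<bar>h k x\<bar> \<le> (B::real)"
    and diff: "\<And>k::nat. \<bar>integral\<^sup>L M (h k) - integral\<^sup>L N (h k)\<bar> \<le> b k" and b: "b \<longlonglongrightarrow> b'"
  shows "f \<in> borel_measurable M" "f \<in> borel_measurable N" "\<bar>integral\<^sup>L M f - integral\<^sup>L N f\<bar> \<le> b'"
proof -
  interpret M: SL2_prob M by fact
  interpret N: SL2_prob N by fact
  show f: "f \<in> borel_measurable M" "f \<in> borel_measurable N"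
    using borel_measurable_LIMSEQ_real[OF lim meas(1)] borel_measurable_LIMSEQ_real[OF lim meas(2)] by auto
  have "(\<lambda>k. integral\<^sup>L M (h k)) \<longlonglongrightarrow> integral\<^sup>L M f" "(\<lambda>k. integral\<^sup>L N (h k)) \<longlonglongrightarrow> integral\<^sup>L N f"
    by (rule integral_dominated_convergence[where w="\<lambda>x. B"]; use f meas lim bd in simp)+
  then have "(\<lambda>k. \<bar>integral\<^sup>L M (h k) - integral\<^sup>L N (h k)\<bar>) \<longlonglongrightarrow> \<bar>integral\<^sup>L M f - integral\<^sup>L N f\<bar>"
    by (intro tendsto_intros)
  from LIMSEQ_le[OF this b] show "\<bar>integral\<^sup>L M f - integral\<^sup>L N f\<bar> \<le> b'" using diff by auto
qed

text \<open>The approximating polynomials have supremum norm at most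
  \<open>1 + 1 / real (Suc k)\<close>, so their degrees and coefficients leave no trace in the
  limit. The damping is removed simultaneously, by
  \<open>\<kappa> = 1 / real (Suc k)\<close>.\<close>

lemma torus_difference:
  fixes l :: real
  assumes g: "g \<in> SL2" and bm: "SL2_BM_law g \<mu>" "SL2_BM_law (g ** expZ (2 * a)) \<nu>" and t: "t > 4"
    and \<phi>: "continuous_on torus \<phi>" "\<And>y. y \<in> torus \<Longrightarrow> \<bar>\<phi> y\<bar> \<le> (1::real)"
  defines "f \<equiv> \<lambda>x. indicator SL2 x * \<phi> (torus_coord l x)"
  shows "f \<in> borel_measurable (\<mu> t)" "f \<in> borel_measurable (\<nu> t)" "\<bar>integral\<^sup>L (\<mu> t) f - integral\<^sup>L (\<nu> t) f\<bar> \<le> tv_bound t"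
proof -
  have pm: "SL2_prob (\<mu> t)" by (rule SL2_BM_prob[OF bm(1)]) (use t in simp)
  have pn: "SL2_prob (\<nu> t)" by (rule SL2_BM_prob[OF bm(2)]) (use t in simp)
  have "\<exists>L. \<forall>x v w. norm w = 1 \<longrightarrow> trig L x v w \<in> \<real> \<and> \<bar>Re (trig L x v w) - \<phi> (cis (l * x), cis (l * v), w)\<bar> \<le> 1 / real (Suc k)" for k
  proof -
    obtain P where P: "real_polynomial_function P" "\<And>y. y \<in> torus \<Longrightarrow> \<bar>\<phi> y - P y\<bar> < 1 / real (Suc k)"
      using Stone_Weierstrass_real_polynomial_function[OF compact_torus \<phi>(1), of "1 / real (Suc k)"] by auto
    obtain L where L: "\<forall>x v w. norm w = 1 \<longrightarrow> complex_of_real (P (cis (l * x), cis (l * v), w)) = trig L x v w"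
      using real_polynomial_trig[OF P(1)] by blast
    have "trig L x v w \<in> \<real> \<and> \<bar>Re (trig L x v w) - \<phi> (cis (l * x), cis (l * v), w)\<bar> \<le> 1 / real (Suc k)" if w: "norm w = 1" for x v w
      using L[rule_format, OF w, of x v, symmetric] P(2)[of "(cis (l * x), cis (l * v), w)"] w
      by (simp add: torus_def abs_minus_commute less_imp_le)
    then show ?thesis by blast
  qed
  then obtain L where L: "\<And>k x v w. norm w = 1 \<Longrightarrow> trig (L k) x v w \<in> \<real>"
    "\<And>k x v w. norm w = 1 \<Longrightarrow> \<bar>Re (trig (L k) x v w) - \<phi> (cis (l * x), cis (l * v), w)\<bar> \<le> 1 / real (Suc k)"
    by metis
  have LR: "\<bar>Re (trig (L k) x v w)\<bar> \<le> 1 + 1 / real (Suc k)" if "norm w = 1" for k x v w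
  proof -
    have "\<bar>\<phi> (cis (l * x), cis (l * v), w)\<bar> \<le> 1" using that by (intro \<phi>(2)) (simp add: torus_def)
    then show ?thesis using L(2)[OF that, of k x v] by linarith
  qed
  have LG: "norm (trig (L k) x v w) \<le> 1 + 1 / real (Suc k)" if "norm w = 1" for k x v w
    using LR[OF that, of k x v] L(1)[OF that, of k x v] by (auto elim!: Reals_cases)
  define h where "h k = damped (L k) (1 / real (Suc k))" for k
  have diff: "\<bar>integral\<^sup>L (\<mu> t) (h k) - integral\<^sup>L (\<nu> t) (h k)\<bar> \<le> tv_bound t * (1 + 1 / real (Suc k))" for k
    unfolding h_def by (rule damped_difference[OF g bm t _ LG]) auto
  have meas: "h k \<in> borel_measurable (\<mu> t)" "h k \<in> borel_measurable (\<nu> t)" for k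
    unfolding h_def by (auto intro!: SL2_prob.damped_integral(1)[OF pm] SL2_prob.damped_integral(1)[OF pn])
  have bd: "\<bar>h k x\<bar> \<le> 2" for k x
  proof (cases "x \<in> SL2")
    case True
    have "\<bar>exp (- (1 / real (Suc k)) * (iw_v x)\<^sup>2) * Re (trig (L k) (iw_x x) (iw_v x) (iw_w x))\<bar> \<le> 1 * (1 + 1 / real (Suc k))"
      unfolding abs_mult using LR[OF norm_iw_w[OF SL2_iw_q[OF True]]] by (intro mult_mono) auto
    also have "\<dots> \<le> 2" by simp
    finally show ?thesis using True by (simp add: h_def damped_def)
  qed (simp add: h_def damped_def)
  have inv: "(\<lambda>k. 1 / real (Suc k)) \<longlonglongrightarrow> 0" by (rule LIMSEQ_Suc[OF lim_const_over_n])
  have lim: "(\<lambda>k. h k x) \<longlonglongrightarrow> f x" for x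
  proof (cases "x \<in> SL2")
    case True
    have "(\<lambda>k. Re (trig (L k) (iw_x x) (iw_v x) (iw_w x)) - \<phi> (torus_coord l x)) \<longlonglongrightarrow> 0"
      by (rule Lim_null_comparison[OF _ inv])
         (use L(2)[OF norm_iw_w[OF SL2_iw_q[OF True]]] in \<open>auto simp: torus_coord_def\<close>)
    then have "(\<lambda>k. Re (trig (L k) (iw_x x) (iw_v x) (iw_w x))) \<longlonglongrightarrow> \<phi> (torus_coord l x)" by (simp add: LIM_zero_iff)
    moreover have "(\<lambda>k. exp (- (1 / real (Suc k)) * (iw_v x)\<^sup>2)) \<longlonglongrightarrow> exp (- 0 * (iw_v x)\<^sup>2)"
      by (intro tendsto_intros inv)
    ultimately have "(\<lambda>k. exp (- (1 / real (Suc k)) * (iw_v x)\<^sup>2) * Re (trig (L k) (iw_x x) (iw_v x) (iw_w x))) \<longlonglongrightarrow> exp (- 0 * (iw_v x)\<^sup>2) * \<phi> (torus_coord l x)"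
      by (intro tendsto_mult)
    then show ?thesis using True by (simp add: h_def damped_def f_def)
  qed (simp add: h_def damped_def f_def)
  have b: "(\<lambda>k. tv_bound t * (1 + 1 / real (Suc k))) \<longlonglongrightarrow> tv_bound t * (1 + 0)"
    by (intro tendsto_intros inv)
  from bounded_limit_difference[OF pm pn meas lim bd diff b]
  show "f \<in> borel_measurable (\<mu> t)" "f \<in> borel_measurable (\<nu> t)" "\<bar>integral\<^sup>L (\<mu> t) f - integral\<^sup>L (\<nu> t) f\<bar> \<le> tv_bound t"
    by simp_all
qed

section \<open>From the torus to compact sets\<close>

lemma continuous_coordinates:
  "continuous_on SL2 iw_x" "continuous_on SL2 iw_v" "continuous_on SL2 iw_w"
  using Ck_imp_continuous[OF Ck_iw_x[of 0]] Ck_imp_continuous[OF Ck_iw_v[of 0]] Ck_imp_continuous[OF Ck_iw_w[of 0]] SL2_iw_q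
  by (auto intro: continuous_on_subset)

text \<open>\<open>iw_v\<close> and \<open>iw_w\<close> give the bottom row \<open>(c, d)\<close>;
  then \<open>iw_x\<close> and the determinant are two linear equations for the top row, whose
  determinant is \<open>c\<^sup>2 + d\<^sup>2\<close> up to sign.\<close>

lemma coordinates_inj:
  assumes "x \<in> SL2" "y \<in> SL2" "iw_x x = iw_x y" "iw_v x = iw_v y" "iw_w x = iw_w y"
  shows "x = y"
proof -
  note q = SL2_iw_q[OF assms(1)] SL2_iw_q[OF assms(2)]
  have qe: "iw_q x = iw_q y" using assms(4) q by (simp add: iw_v_def)
  have "Complex (x$2$2) (x$2$1) = Complex (y$2$2) (y$2$1)"
    using assms(5) q unfolding iw_w_def qe by simp
  then have cd: "x$2$2 = y$2$2" "x$2$1 = y$2$1" by simp_all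
  define c d where "c = y$2$1" and "d = y$2$2"
  have n: "x$1$1 * c + x$1$2 * d = y$1$1 * c + y$1$2 * d"
    using assms(3) q unfolding iw_x_def qe cd c_def d_def by simp
  have dt: "x$1$1 * d - x$1$2 * c = y$1$1 * d - y$1$2 * c"
    using assms(1,2) cd by (simp add: SL2_def det_2 c_def d_def)
  have s: "c * c + d * d > 0" using q(2) by (simp add: iw_q_def c_def d_def power2_eq_square)
  have "A * (c * c + d * d) = B * (c * c + d * d)" if "A * c + A' * d = B * c + B' * d" "A * d - A' * c = B * d - B' * c" for A A' B B'
  proof -
    have "A * (c * c + d * d) = c * (A * c + A' * d) + d * (A * d - A' * c)" by (simp add: algebra_simps)
    also have "\<dots> = B * (c * c + d * d)" unfolding that by (simp add: algebra_simps)
    finally show ?thesis .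
  qed
  from this[OF n dt] have a: "x$1$1 = y$1$1" using s by auto
  have "A' * (c * c + d * d) = B' * (c * c + d * d)" if "A * c + A' * d = B * c + B' * d" "A * d - A' * c = B * d - B' * c" for A A' B B'
  proof -
    have "A' * (c * c + d * d) = d * (A * c + A' * d) - c * (A * d - A' * c)" by (simp add: algebra_simps)
    also have "\<dots> = B' * (c * c + d * d)" unfolding that by (simp add: algebra_simps)
    finally show ?thesis .
  qed
  from this[OF n dt] have b: "x$1$2 = y$1$2" using s by auto
  show ?thesis using a b cd by (simp add: vec_eq_iff forall_2)
qed

lemma cis_eq_small:
  assumes "cis (2 * pi / r * a) = cis (2 * pi / r * b)" "\<bar>a - b\<bar> < r"
  shows "a = b"
proof -
  have r: "r > 0" using assms(2) by linarith
  have "cis (2 * pi / r * a - 2 * pi / r * b) = 1"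
    unfolding cis_divide[symmetric] assms(1) by simp
  then obtain n :: int where "2 * pi / r * a - 2 * pi / r * b = of_int (2 * n) * pi"
    unfolding cis_conv_exp exp_eq_1 by auto
  then have "pi * (a - b) = pi * (of_int n * r)" using r by (simp add: field_simps)
  then have n: "a - b = of_int n * r" by simp
  then have "\<bar>of_int n\<bar> * r < 1 * r" using assms(2) r by (simp add: abs_mult)
  then have "\<bar>real_of_int n\<bar> < 1" using r by (simp only: mult_less_cancel_right_pos)
  then have "n = 0" by linarith
  then show ?thesis using n by simp
qed

text \<open>For a large period the torus coordinates separate a point from the given compact set, so that first
  continuous functions on the torus and then the period can be sent to their limits.\<close>

lemma compact_difference:
  assumes g: "g \<in> SL2" and bm: "SL2_BM_law g \<mu>" "SL2_BM_law (g ** expZ (2 * a)) \<nu>" and t: "t > 4"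
    and K: "compact K"
  shows "\<bar>measure (\<mu> t) K - measure (\<nu> t) K\<bar> \<le> tv_bound t"
proof -
  have pm: "SL2_prob (\<mu> t)" by (rule SL2_BM_prob[OF bm(1)]) (use t in simp)
  have pn: "SL2_prob (\<nu> t)" by (rule SL2_BM_prob[OF bm(2)]) (use t in simp)
  define K1 where "K1 = K \<inter> SL2"
  have K1: "compact K1" "K1 \<subseteq> SL2" unfolding K1_def using compact_Int_closed[OF K closed_SL2] by auto
  have mK: "integral\<^sup>L M (indicator K1) = measure M K" if "SL2_prob M" for M
  proof -
    interpret SL2_prob M by fact
    have s: "K \<in> sets M" "K1 \<in> sets M" using K K1 sets_M by (auto simp: compact_imp_closed)
    have "measure M K = measure M K1"
      using AE_SL2 s by (intro measure_eq_AE) (auto simp: K1_def)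
    then show ?thesis using s by simp
  qed
  show ?thesis
  proof (cases "K1 = {}")
    case True
    then show ?thesis using mK[OF pm] mK[OF pn] tv_bound_nonneg[of t] by simp
  next
    case ne: False
    define l where "l k = 2 * pi / real (Suc k)" for k
    define Ct where "Ct k = torus_coord (l k) ` K1" for k
    have Ct: "compact (Ct k)" for k
      unfolding Ct_def torus_coord_def
      by (intro compact_continuous_image K1 continuous_intros continuous_on_subset[OF _ K1(2)] continuous_coordinates)
    have Cne: "Ct k \<noteq> {}" for k using ne by (simp add: Ct_def)
    define f where "f k x = indicator SL2 x * (indicator (Ct k) (torus_coord (l k) x) :: real)" for k x
    have f: "f k \<in> borel_measurable (\<mu> t)" "f k \<in> borel_measurable (\<nu> t)" "\<bar>integral\<^sup>L (\<mu> t) (f k) - integral\<^sup>L (\<nu> t) (f k)\<bar> \<le> tv_bound t" for k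
    proof -
      define \<phi> where "\<phi> n y = max 0 (1 - real n * infdist y (Ct k))" for n y
      have c: "continuous_on torus (\<phi> n)" for n
        unfolding \<phi>_def by (intro continuous_intros)
      have b: "\<bar>\<phi> n y\<bar> \<le> 1" for n y by (simp add: \<phi>_def infdist_nonneg)
      have lim: "(\<lambda>n. \<phi> n y) \<longlonglongrightarrow> indicator (Ct k) y" for y
      proof (cases "y \<in> Ct k")
        case True
        then show ?thesis by (simp add: \<phi>_def)
      next
        case False
        then have "infdist y (Ct k) > 0" using Ct Cne by (intro infdist_pos_not_in_closed) (auto simp: compact_imp_closed)
        then obtain n0 :: nat where n0: "1 < real n0 * infdist y (Ct k)" using reals_Archimedean3 by blast
        have "\<phi> n y = 0" if "n \<ge> n0" for n
        proof -
          have "real n0 * infdist y (Ct k) \<le> real n * infdist y (Ct k)" using that by (intro mult_right_mono) (auto simp: infdist_nonneg)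
          then show ?thesis using n0 by (simp add: \<phi>_def)
        qed
        then have "\<forall>\<^sub>F n in sequentially. \<phi> n y = 0" by (auto simp: eventually_sequentially)
        then show ?thesis using False by (simp add: tendsto_eventually)
      qed
      note td = torus_difference[OF g bm t c, of _ "l k", OF b]
      have lm: "(\<lambda>n. indicator SL2 x * \<phi> n (torus_coord (l k) x)) \<longlonglongrightarrow> f k x" for x
        unfolding f_def by (intro tendsto_mult tendsto_const lim)
      have bdd: "\<bar>indicator SL2 x * \<phi> n (torus_coord (l k) x)\<bar> \<le> 1" for n x
        using b[of n "torus_coord (l k) x"] by (simp add: indicator_def)
      show "f k \<in> borel_measurable (\<mu> t)" "f k \<in> borel_measurable (\<nu> t)" "\<bar>integral\<^sup>L (\<mu> t) (f k) - integral\<^sup>L (\<nu> t) (f k)\<bar> \<le> tv_bound t"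
        by (rule bounded_limit_difference[OF pm pn td(1) td(2) lm bdd td(3) tendsto_const])+
    qed
    have lim: "(\<lambda>k. f k x) \<longlonglongrightarrow> indicator K1 x" for x
    proof (cases "x \<in> SL2")
      case False
      then show ?thesis using K1 by (auto simp: f_def indicator_def)
    next
      case x: True
      show ?thesis
      proof (cases "x \<in> K1")
        case True
        then show ?thesis using x by (simp add: f_def Ct_def)
      next
        case False
        have "bounded (iw_x ` K1)" "bounded (iw_v ` K1)"
          by (intro compact_imp_bounded compact_continuous_image K1 continuous_on_subset[OF _ K1(2)] continuous_coordinates)+
        then obtain b1 b2 where b: "\<And>y. y \<in> K1 \<Longrightarrow> \<bar>iw_x y\<bar> \<le> b1" "\<And>y. y \<in> K1 \<Longrightarrow> \<bar>iw_v y\<bar> \<le> b2"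
          unfolding bounded_iff by (auto simp: image_iff)
        \<comment> \<open>From \<open>k0\<close> on, the period \<open>Suc k\<close> exceeds the
          distance in \<open>iw_x\<close> and in \<open>iw_v\<close> between \<open>x\<close> and
          any point of \<open>K1\<close>.\<close>
        obtain k0 :: nat where k0: "\<bar>iw_x x\<bar> + \<bar>iw_v x\<bar> + \<bar>b1\<bar> + \<bar>b2\<bar> < real k0" using reals_Archimedean2 by blast
        have "f k x = 0" if k: "k \<ge> k0" for k
        proof -
          have "torus_coord (l k) x \<notin> Ct k"
          proof
            assume "torus_coord (l k) x \<in> Ct k"
            then obtain y where y: "y \<in> K1" "torus_coord (l k) x = torus_coord (l k) y" by (auto simp: Ct_def)
            have e: "cis (2 * pi / real (Suc k) * iw_x x) = cis (2 * pi / real (Suc k) * iw_x y)"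
              "cis (2 * pi / real (Suc k) * iw_v x) = cis (2 * pi / real (Suc k) * iw_v y)" "iw_w x = iw_w y"
              using y(2) by (simp_all only: torus_coord_def l_def prod.inject)
            have kk: "real k0 \<le> real k" using k by simp
            have "\<bar>iw_x x - iw_x y\<bar> < real (Suc k)" "\<bar>iw_v x - iw_v y\<bar> < real (Suc k)"
              using b(1)[OF y(1)] b(2)[OF y(1)] k0 kk unfolding of_nat_Suc by linarith+
            then have "iw_x x = iw_x y" "iw_v x = iw_v y" using cis_eq_small[OF e(1)] cis_eq_small[OF e(2)] by auto
            then have "x = y" using coordinates_inj[OF x _ _ _ e(3)] y(1) K1 by auto
            then show False using False y(1) by simp
          qed
          then show ?thesis by (simp add: f_def)
        qed
        then have "\<forall>\<^sub>F k in sequentially. f k x = 0" by (auto simp: eventually_sequentially)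
        then show ?thesis using False by (simp add: tendsto_eventually)
      qed
    qed
    have "\<bar>f k x\<bar> \<le> 1" for k x by (simp add: f_def indicator_def)
    from bounded_limit_difference(3)[OF pm pn f(1) f(2) lim this f(3) tendsto_const]
    show ?thesis by (simp only: mK[OF pm] mK[OF pn])
  qed
qed

section \<open>Total variation\<close>

lemma (in SL2_prob) inner_regular_compact:
  assumes "A \<in> sets borel" "e > 0"
  shows "\<exists>K. compact K \<and> K \<subseteq> A \<and> measure M A < measure M K + e"
proof -
  have sup: "emeasure M A = (SUP K\<in>{K. K \<subseteq> A \<and> compact K}. emeasure M K)"
    by (rule inner_regular) (use sets_M assms emeasure_finite in auto)
  show ?thesis
  proof (cases "measure M A < e")
    case True
    then show ?thesis by (intro exI[of _ "{}"]) simp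
  next
    case False
    then have "ennreal (measure M A - e) < ennreal (measure M A)"
      using assms(2) by (intro ennreal_lessI) auto
    then have "ennreal (measure M A - e) < (SUP K\<in>{K. K \<subseteq> A \<and> compact K}. emeasure M K)"
      unfolding sup[symmetric] unfolding emeasure_eq_measure .
    then obtain K where K: "K \<subseteq> A" "compact K" "ennreal (measure M A - e) < ennreal (measure M K)"
      unfolding less_SUP_iff emeasure_eq_measure by auto
    then have "measure M A - e < measure M K"
      using False by (simp add: ennreal_less_iff)
    then show ?thesis using K by (intro exI[of _ K]) auto
  qed
qed

lemma tv_bound_exp:
  assumes "t > 4"
  shows "tv_bound t \<le> (8 * 83 ^ 4 / qrate ^ 5) * exp (- (- ln qrate) * t)"
proof -
  define J where "J = nat \<lfloor>t\<rfloor>"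
  have J: "J \<ge> 4" "t < real J + 1" using assms unfolding J_def by linarith+
  have "qrate ^ (J - 4) = exp (ln qrate * real (J - 4))"
    using qrate by (metis exp_ln exp_of_nat2_mult)
  also have "\<dots> \<le> exp (ln qrate * (t - 5))"
  proof -
    \<comment> \<open>Four blocks were spent on summability, and rounding \<open>t\<close> down
      costs less than one more.\<close>
    have "t - 5 \<le> real (J - 4)" using J by (simp add: of_nat_diff)
    moreover have "ln qrate \<le> 0" using qrate by simp
    ultimately have "ln qrate * real (J - 4) \<le> ln qrate * (t - 5)" by (rule mult_left_mono_neg)
    then show ?thesis by simp
  qed
  also have "\<dots> = exp (ln qrate * t) / exp (ln qrate) ^ 5"
    by (simp add: exp_diff[symmetric] exp_of_nat_mult[symmetric] algebra_simps)
  also have "\<dots> = exp (ln qrate * t) / qrate ^ 5" using qrate by simp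
  finally show ?thesis unfolding tv_bound_def J_def[symmetric] by simp
qed

lemma dist_TV_bound:
  assumes g: "g \<in> SL2" and bm: "SL2_BM_law g \<mu>" "SL2_BM_law (g ** expZ (2 * a)) \<nu>" and t: "t > 4"
  shows "dist_TV (\<mu> t) (\<nu> t) \<le> tv_bound t"
proof -
  interpret m: SL2_prob "\<mu> t" by (rule SL2_BM_prob[OF bm(1)]) (use t in simp)
  interpret n: SL2_prob "\<nu> t" by (rule SL2_BM_prob[OF bm(2)]) (use t in simp)
  show ?thesis unfolding dist_TV_def
  proof (rule cSUP_least)
    fix A assume "A \<in> sets (\<mu> t)"
    then have A: "A \<in> sets borel" using m.sets_M by simp
    show "\<bar>measure (\<mu> t) A - measure (\<nu> t) A\<bar> \<le> tv_bound t"
    proof (rule field_le_epsilon)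
      fix e :: real assume e: "e > 0"
      obtain K1 where K1: "compact K1" "K1 \<subseteq> A" "measure (\<mu> t) A < measure (\<mu> t) K1 + e"
        using m.inner_regular_compact[OF A e] by blast
      obtain K2 where K2: "compact K2" "K2 \<subseteq> A" "measure (\<nu> t) A < measure (\<nu> t) K2 + e"
        using n.inner_regular_compact[OF A e] by blast
      \<comment> \<open>A single compact set has to approximate \<open>A\<close> from inside for
        both laws.\<close>
      define K where "K = K1 \<union> K2"
      have K: "compact K" "K \<subseteq> A" "K \<in> sets borel" using K1 K2 by (auto simp: K_def borel_compact)
      have "measure (\<mu> t) K1 \<le> measure (\<mu> t) K" "measure (\<nu> t) K2 \<le> measure (\<nu> t) K"
        using K m.sets_M n.sets_M by (auto intro!: m.finite_measure_mono n.finite_measure_mono simp: K_def)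
      moreover have "measure (\<mu> t) K \<le> measure (\<mu> t) A" "measure (\<nu> t) K \<le> measure (\<nu> t) A"
        using K A m.sets_M n.sets_M by (auto intro!: m.finite_measure_mono n.finite_measure_mono)
      moreover have "\<bar>measure (\<mu> t) K - measure (\<nu> t) K\<bar> \<le> tv_bound t"
        by (rule compact_difference[OF g bm t K(1)])
      ultimately show "\<bar>measure (\<mu> t) A - measure (\<nu> t) A\<bar> \<le> tv_bound t + e"
        using K1(3) K2(3) by linarith
    qed
  qed (use sets.empty_sets in blast)
qed

theorem theorem4p3:
  shows "\<exists>C>0. \<exists>c>0. \<exists>T0>0. \<forall>a>0. \<forall>g\<in>SL2. \<forall>\<mu> \<nu>.
           SL2_BM_law g \<mu> \<longrightarrow> SL2_BM_law (g ** expZ (2*a)) \<nu> \<longrightarrow>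
           (\<forall>t>T0. dist_TV (\<mu> t) (\<nu> t) \<le> C * exp (- c * t))"
proof (intro exI conjI allI ballI impI)
  show "8 * 83 ^ 4 / qrate ^ 5 > 0" "- ln qrate > 0" "(4::real) > 0" using qrate by simp_all
  fix a :: real and g \<mu> \<nu> and t :: real
  assume "g \<in> SL2" "SL2_BM_law g \<mu>" "SL2_BM_law (g ** expZ (2*a)) \<nu>" "t > 4"
  then show "dist_TV (\<mu> t) (\<nu> t) \<le> (8 * 83 ^ 4 / qrate ^ 5) * exp (- (- ln qrate) * t)"
    by (intro order_trans[OF dist_TV_bound tv_bound_exp])
qed

end
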